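(* Let $f$ be a transcendental entire function of finite order $\rho=\rho(f)$. Let $\alpha\not\equiv 0$ and $\beta$ be $\lambda$-small functions of $f$, and let $$L(z,f)=\sum_{j=0}^{m} b_j(z)\, f^{(k_j)}(z+c_j)$$ be a linear delay-differential polynomial of $f$, where the $b_j$ are $\lambda$-small functions of $f$, the $c_j$ are distinct complex numbers, and the $k_j$ are non-negative integers. Assume that $L(z,f)\not\equiv 0$, and let $n\geq 3$ be an integer. Put $\Phi_n(z)=L(z,f)-\alpha(z) f(z)^n$. Then $\Phi_n-\beta$ has sufficiently many zeros to satisfy $\lambda(\Phi_n-\beta)=\rho(f)$.
   Context: Standard notation of Nevanlinna theory is used: $T(r,\cdot)$ is the characteristic function and $N(r,\cdot)$ the integrated counting function. $\rho(f)$ denotes the order of growth of $f$. For a meromorphic function $g\not\equiv 0$, $\lambda(g)$ (with a function as argument) denotes the exponent of convergence of the zeros of $g$, i.e. $\limsup_{r\to\infty}\frac{\log^+ N(r,1/g)}{\log r}$. This is different from the real number $\lambda$ in the term "$\lambda$-small". $S(r,f)$ denotes any quantity satisfying $S(r,f)=o(T(r,f))$ as $r\to\infty$ outside a possible exceptional set $F$ of finite logarithmic measure. $\lambda$-small function: let $f$ be a meromorphic function of finite order $\rho$ and let $\lambda<\rho$ be a real number. A meromorphic function $a$ on $\mathbb{C}$ is a $\lambda$-small function of $f$ if for every $\varepsilon\in(0,\rho-\lambda)$ one has $T(r,a)=O(r^{\lambda+\varepsilon})+S(r,f)$ outside a possible exceptional set $F$ of finite logarithmic measure. In the claim, all $\lambda$-small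 functions are taken with respect to a common $\lambda<\rho$. *)

theory Defs
  imports "HOL-Complex_Analysis.Complex_Analysis" "HOL-Library.Landau_Symbols"
begin

text \<open>
  Meromorphic functions on the plane are functions \<open>g\<close> with \<open>g meromorphic_on UNIV\<close>. This
  predicate does not constrain the values of \<open>g\<close> on a closed discrete set (in particular at the
  poles), so all notions below depend on \<open>g\<close> only up to such a set.
\<close>

definition not_identically_zero :: "(complex \<Rightarrow> complex) \<Rightarrow> bool" where
  "not_identically_zero g \<longleftrightarrow> \<not> (\<forall>\<^sub>\<approx>z\<in>UNIV. g z = 0)"

definition transcendental_entire :: "(complex \<Rightarrow> complex) \<Rightarrow> bool" where
  "transcendental_entire f \<longleftrightarrow> f holomorphic_on UNIV \<and> \<not> (\<exists>p. \<forall>z. f z = poly p z)"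


subsection \<open>The Nevanlinna functionals\<close>

text \<open>\<open>log\<^sup>+ x = max {0, log x}\<close> with \<open>log\<^sup>+ x = 0\<close> for \<open>x \<le> 0\<close>.\<close>

definition log_plus :: "real \<Rightarrow> real" where
  "log_plus x = ln (max 1 x)"

text \<open>The number \<open>n(r, g)\<close> of poles in the closed disc of radius \<open>r\<close>, counted with multiplicity.\<close>

definition pole_count :: "real \<Rightarrow> (complex \<Rightarrow> complex) \<Rightarrow> nat" where
  "pole_count r g = (\<Sum>z\<in>{z \<in> cball 0 r. is_pole g z}. nat (- zorder g z))"

text \<open>\<open>N(r, g)\<close>\<close>

definition integrated_count :: "real \<Rightarrow> (complex \<Rightarrow> complex) \<Rightarrow> real" where
  "integrated_count r g =
     integral {0..r} (\<lambda>t. (real (pole_count t g) - real (pole_count 0 g)) / t)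
       + real (pole_count 0 g) * ln r"

text \<open>\<open>m(r, g)\<close>\<close>

definition proximity :: "real \<Rightarrow> (complex \<Rightarrow> complex) \<Rightarrow> real" where
  "proximity r g =
     1 / (2 * pi) * integral {0..2 * pi} (\<lambda>\<theta>. log_plus (norm (g (of_real r * cis \<theta>))))"

text \<open>\<open>T(r, g)\<close>\<close>

definition characteristic :: "real \<Rightarrow> (complex \<Rightarrow> complex) \<Rightarrow> real" where
  "characteristic r g = proximity r g + integrated_count r g"

definition growth_order :: "(complex \<Rightarrow> complex) \<Rightarrow> ereal" where
  "growth_order g = Limsup at_top (\<lambda>r. ereal (log_plus (characteristic r g) / ln r))"

text \<open>The exponent of convergence of the zeros of \<open>g\<close>, for \<open>g\<close> not identically zero.\<close>

definition zero_exponent :: "(complex \<Rightarrow> complex) \<Rightarrow> ereal" where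
  "zero_exponent g =
     Limsup at_top (\<lambda>r. ereal (log_plus (integrated_count r (\<lambda>z. 1 / g z)) / ln r))"


subsection \<open>Small functions\<close>

text \<open>Only the part of \<open>F\<close> in \<open>[1, \<infinity>)\<close> matters, as \<open>F\<close> is used for statements about \<open>r \<rightarrow> \<infinity>\<close>.\<close>

definition finite_log_measure :: "real set \<Rightarrow> bool" where
  "finite_log_measure F \<longleftrightarrow>
     F \<in> sets lebesgue \<and> (\<integral>\<^sup>+t\<in>F \<inter> {1..}. ennreal (1 / t) \<partial>lebesgue) < \<infinity>"

text \<open>The filter for \<open>r \<rightarrow> \<infinity>\<close> with \<open>r \<notin> F\<close>.\<close>

definition at_top_outside :: "real set \<Rightarrow> real filter" where
  "at_top_outside F = inf at_top (principal (- F))"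

text \<open>\<open>S_error f h\<close> says that \<open>h(r)\<close> is a quantity of the form \<open>S(r, f)\<close>.\<close>

definition S_error :: "(complex \<Rightarrow> complex) \<Rightarrow> (real \<Rightarrow> real) \<Rightarrow> bool" where
  "S_error f h \<longleftrightarrow>
     (\<exists>F. finite_log_measure F \<and> h \<in> o[at_top_outside F](\<lambda>r. characteristic r f))"

text \<open>
  Meaningful for \<open>f\<close> of finite order \<open>\<rho>\<close> and \<open>lam < \<rho>\<close>; the condition on \<open>\<epsilon>\<close> is then
  \<open>\<epsilon> \<in> (0, \<rho> - lam)\<close>. The exceptional set may depend on \<open>\<epsilon>\<close>.
\<close>

definition lambda_small :: "real \<Rightarrow> (complex \<Rightarrow> complex) \<Rightarrow> (complex \<Rightarrow> complex) \<Rightarrow> bool" where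
  "lambda_small lam f a \<longleftrightarrow>
     a meromorphic_on UNIV \<and>
     (\<forall>\<epsilon>>0. ereal (lam + \<epsilon>) < growth_order f \<longrightarrow>
       (\<exists>F g h. finite_log_measure F
          \<and> g \<in> O[at_top_outside F](\<lambda>r. r powr (lam + \<epsilon>))
          \<and> S_error f h
          \<and> (\<forall>\<^sub>F r in at_top_outside F. characteristic r a = g r + h r)))"


subsection \<open>Linear delay-differential polynomials\<close>

definition delay_diff_poly ::
    "nat \<Rightarrow> (nat \<Rightarrow> complex \<Rightarrow> complex) \<Rightarrow> (nat \<Rightarrow> nat) \<Rightarrow> (nat \<Rightarrow> complex)
      \<Rightarrow> (complex \<Rightarrow> complex) \<Rightarrow> complex \<Rightarrow> complex" where
  "delay_diff_poly m b k c f z = (\<Sum>j\<le>m. b j z * (deriv ^^ k j) f (z + c j))"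

end

theory Submission
  imports Defs
begin

text \<open>
  Put \<open>F = \<Phi> - \<beta>\<close> and suppose that \<open>F\<close> has few zeros. Then \<open>\<psi> = F' / F\<close> is small, and eliminating
  \<open>F\<close> from \<open>F' = \<psi> F\<close> gives \<open>f\<^sup>n\<^sup>-\<^sup>1 P = Q\<close> with \<open>P = \<alpha>' f + n \<alpha> f' - \<alpha> \<psi> f\<close> and
  \<open>Q = L' - \<beta>' - \<psi> (L - \<beta>)\<close>. As \<open>Q / f\<close> is small up to \<open>(\<psi> \<beta> - \<beta>') / f\<close> and \<open>n - 1 \<ge> 2\<close>, Clunie's argument
  bounds both \<open>m(r, P)\<close> and \<open>m(r, f P)\<close>; if \<open>P \<noteq> 0\<close> then \<open>f = (f P) / P\<close> would be small. If \<open>P = 0\<close>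
  then \<open>F\<close> is a constant multiple of \<open>\<alpha> f\<^sup>n\<close>, so either \<open>\<alpha> f\<^sup>n\<close> is a multiple of \<open>L - \<beta>\<close>, which grows too
  slowly, or \<open>L = \<beta>\<close> and \<open>F = - \<alpha> f\<^sup>n\<close>, and then both \<open>m(r, 1/f)\<close> and \<open>N(r, 1/f)\<close> are small.

  The estimates for \<open>m(r, g' / g)\<close> and for \<open>m(r, f\<^sup>(\<^sup>k\<^sup>)(z + c) / f)\<close> come from one source: a meromorphic
  function on a disc is a finite Blaschke product times \<open>exp H\<close>, Schwarz' formula bounds \<open>H'\<close>, and the mean
  of \<open>log (1 + D / |z - a|)\<close> over \<open>|z| = r\<close> is \<open>O(r\<^sup>-\<^sup>1\<^sup>/\<^sup>2)\<close>. This saves a factor \<open>r\<^sup>1\<^sup>/\<^sup>2\<close> over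
  \<open>T(r, f)\<close>, which suffices because an error \<open>O(r\<^sup>\<sigma>)\<close> with \<open>\<sigma> < \<rho>\<close> is negligible. Exceptional sets are
  avoided throughout, so only circles free of zeros and poles occur.
\<close>

subsection \<open>Means over circles\<close>

text \<open>Two error classes run side by side. Small terms are at most \<eta> T(r, f) + C
  r^\<sigma> with one \<sigma> < \<rho> for all \<eta>, while of F only order at most \<rho> is
  known. The estimate for m(r, g'/g) takes the second class into the first, so F'/F is small
  although F is not. The argument lives on T(r, f) not being small, and two obstacles shape that
  part. The radii at which T is large because of the order may all be exceptional, so the bound is
  carried to a good radius by T(s) <= 9 T(R) + C for R >= 2 s; this stands in for the monotonicity
  of T. And for \<rho> = 0 a constant is not O(r^\<sigma>), so constants are absorbed through log r
  = o(T(r, f)), where the transcendence of f matters. In Clunie's argument the quotient \<beta> / f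
  is under control only where |f| > 1. Where |f| <= 1 the factorization P = f W, with W built from
  f'/f and small coefficients, bounds P and f P instead.\<close>

definition circle_mean :: "real \<Rightarrow> (complex \<Rightarrow> real) \<Rightarrow> real" where
  "circle_mean r u = 1 / (2 * pi) * integral {0..2 * pi} (\<lambda>\<theta>. u (of_real r * cis \<theta>))"

lemma proximity_eq_circle_mean: "proximity r g = circle_mean r (\<lambda>z. log_plus (norm (g z)))"
  by (simp add: proximity_def circle_mean_def)

lemma continuous_on_circle:
  fixes u :: "complex \<Rightarrow> 'a :: topological_space"
  assumes "continuous_on (sphere 0 r) u" "r \<ge> 0"
  shows "continuous_on A (\<lambda>\<theta>. u (of_real r * cis \<theta>))"
  by (rule continuous_on_compose2[OF assms(1)])
     (use assms(2) in \<open>auto intro!: continuous_intros simp: norm_mult\<close>)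

lemma integrable_on_circle:
  fixes u :: "complex \<Rightarrow> 'a :: euclidean_space"
  assumes "continuous_on (sphere 0 r) u" "r \<ge> 0"
  shows "(\<lambda>\<theta>. u (of_real r * cis \<theta>)) integrable_on {a..b}"
  by (intro integrable_continuous_interval continuous_on_circle assms)

lemma circle_mean_mono:
  assumes "continuous_on (sphere 0 r) u" "continuous_on (sphere 0 r) v" "r \<ge> 0"
    and "\<And>z. norm z = r \<Longrightarrow> u z \<le> v z"
  shows "circle_mean r u \<le> circle_mean r v"
  unfolding circle_mean_def
  by (intro mult_left_mono integral_le integrable_on_circle assms) (use assms(3) in \<open>auto simp: norm_mult\<close>)

lemma circle_mean_cong:
  assumes "r \<ge> 0" "\<And>z. norm z = r \<Longrightarrow> u z = v z"
  shows "circle_mean r u = circle_mean r v"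
  unfolding circle_mean_def
  by (intro arg_cong[where f = "\<lambda>x. _ * x"] integral_cong) (use assms in \<open>auto simp: norm_mult\<close>)

lemma circle_mean_add:
  assumes "continuous_on (sphere 0 r) u" "continuous_on (sphere 0 r) v" "r \<ge> 0"
  shows "circle_mean r (\<lambda>z. u z + v z) = circle_mean r u + circle_mean r v"
  unfolding circle_mean_def
  by (subst integral_add) (auto intro!: integrable_on_circle assms simp: distrib_left add_divide_distrib)

lemma circle_mean_cmult: "circle_mean r (\<lambda>z. c * u z) = c * circle_mean r u"
  by (simp add: circle_mean_def)

lemma circle_mean_const [simp]: "circle_mean r (\<lambda>z. c) = c"
  by (simp add: circle_mean_def)

lemma circle_mean_diff:
  assumes "continuous_on (sphere 0 r) u" "continuous_on (sphere 0 r) v" "r \<ge> 0"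
  shows "circle_mean r (\<lambda>z. u z - v z) = circle_mean r u - circle_mean r v"
  using circle_mean_add[of r u "\<lambda>z. -1 * v z"] assms
  by (simp add: circle_mean_cmult[of r "-1", simplified] continuous_on_minus)

lemma circle_mean_sum:
  assumes "finite A" "\<And>a. a \<in> A \<Longrightarrow> continuous_on (sphere 0 r) (u a)" "r \<ge> 0"
  shows "circle_mean r (\<lambda>z. \<Sum>a\<in>A. u a z) = (\<Sum>a\<in>A. circle_mean r (u a))"
  using assms(1,2)
proof (induction A rule: finite_induct)
  case empty
  thus ?case by simp
next
  case (insert a A)
  have "circle_mean r (\<lambda>z. \<Sum>b\<in>insert a A. u b z) = circle_mean r (\<lambda>z. u a z + (\<Sum>b\<in>A. u b z))"
    using insert by simp
  also have "\<dots> = circle_mean r (u a) + circle_mean r (\<lambda>z. \<Sum>b\<in>A. u b z)"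
    by (intro circle_mean_add continuous_on_sum) (use insert assms(3) in auto)
  finally show ?case using insert by simp
qed

lemma circle_mean_nonneg:
  assumes "continuous_on (sphere 0 r) u" "r \<ge> 0" "\<And>z. norm z = r \<Longrightarrow> u z \<ge> 0"
  shows "circle_mean r u \<ge> 0"
  using circle_mean_mono[of r "\<lambda>_. 0" u] assms by simp

lemma contour_integral_circlepath_eq:
  "contour_integral (circlepath 0 r) f =
     integral {0..2*pi} (\<lambda>t. f (of_real r * cis t) * of_real r * \<i> * cis t)"
  unfolding circlepath_def by (subst contour_integral_part_circlepath_eq) simp_all

text \<open>Cauchy's formula at the centre: the kernel 1/u cancels against the derivative of the
  circle parametrization.\<close>

lemma circle_mean_Re_holomorphic:
  assumes "H holomorphic_on ball 0 R'" "0 < R" "R < R'"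
  shows "circle_mean R (\<lambda>z. Re (H z)) = Re (H 0)"
proof -
  have sub: "cball (0::complex) R \<subseteq> ball 0 R'" "sphere (0::complex) R \<subseteq> ball 0 R'"
    using assms by auto
  have cont: "continuous_on (ball 0 R') H"
    using assms(1) holomorphic_on_imp_continuous_on by blast
  have "((\<lambda>u. H u / (u - 0)) has_contour_integral (2 * of_real pi * \<i> * H 0)) (circlepath 0 R)"
    by (rule Cauchy_integral_circlepath)
       (use assms sub cont in \<open>auto intro: continuous_on_subset holomorphic_on_subset\<close>)
  hence "contour_integral (circlepath 0 R) (\<lambda>u. H u / u) = 2 * of_real pi * \<i> * H 0"
    by (simp add: contour_integral_unique)
  hence "integral {0..2*pi} (\<lambda>t. H (of_real R * cis t) / (of_real R * cis t) * of_real R * \<i> * cis t) = 2 * of_real pi * \<i> * H 0"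
    by (simp add: contour_integral_circlepath_eq)
  also have "(\<lambda>t. H (of_real R * cis t) / (of_real R * cis t) * of_real R * \<i> * cis t) = (\<lambda>t. \<i> * H (of_real R * cis t))"
    using assms(2) by (auto simp: fun_eq_iff)
  finally have *: "integral {0..2*pi} (\<lambda>t. H (of_real R * cis t)) = 2 * of_real pi * H 0"
    by simp
  have int: "(\<lambda>t. H (of_real R * cis t)) integrable_on {0..2*pi}"
    by (intro integrable_on_circle) (use assms sub cont in \<open>auto intro: continuous_on_subset\<close>)
  have "integral {0..2*pi} (\<lambda>t. Re (H (of_real R * cis t))) = Re (integral {0..2*pi} (\<lambda>t. H (of_real R * cis t)))"
    using integral_linear[OF int bounded_linear_Re] by (simp add: o_def)
  thus ?thesis using * by (simp add: circle_mean_def)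
qed

text \<open>
  Schwarz' formula: on the circle the conjugate of \<open>H\<close> contributes nothing to Cauchy's formula
  for \<open>H'\<close>, so \<open>H\<close> may be replaced by \<open>2 Re H\<close> there.
\<close>
lemma norm_deriv_le_circle_mean_Re:
  assumes H: "H holomorphic_on ball 0 R'" and R: "R < R'" and z: "norm z < R"
  shows "norm (deriv H z) \<le> 2 * R / (R - norm z)\<^sup>2 * circle_mean R (\<lambda>w. \<bar>Re (H w)\<bar>)"
proof -
  define W where "W = (\<lambda>t. of_real R * cis t)"
  have R0: "R > 0" using z norm_ge_zero[of z] by linarith
  have nW: "norm (W t) = R" for t using R0 by (simp add: W_def norm_mult)
  have WcW: "W t * cnj (W t) = of_real R ^ 2" for t
    using complex_norm_square[of "W t"] nW by simp
  have Wnz: "W t \<noteq> z" "W t \<noteq> 0" for t using nW[of t] z R0 by auto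
  have sub: "cball (0::complex) R \<subseteq> ball 0 R'" "sphere (0::complex) R \<subseteq> ball 0 R'" "ball (0::complex) R \<subseteq> ball 0 R'"
    using R0 R by auto
  have cont: "continuous_on (ball 0 R') H"
    using H holomorphic_on_imp_continuous_on by blast
  have "(H has_field_derivative (1 / (2 * of_real pi * \<i>) * contour_integral(circlepath 0 R) (\<lambda>u. H u / (u-z)^2))) (at z)"
    by (rule Cauchy_derivative_integral_circlepath)
       (use z sub cont H in \<open>auto intro: continuous_on_subset holomorphic_on_subset\<close>)
  hence d: "deriv H z = 1 / (2 * of_real pi * \<i>) * contour_integral(circlepath 0 R) (\<lambda>u. H u / (u-z)^2)"
    by (rule DERIV_imp_deriv)
  define K where "K = (\<lambda>t. W t / (W t - z)\<^sup>2)"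
  have "contour_integral(circlepath 0 R) (\<lambda>u. H u / (u-z)^2) = \<i> * integral {0..2*pi} (\<lambda>t. H (W t) * K t)"
    by (simp add: contour_integral_circlepath_eq K_def W_def algebra_simps flip: integral_mult_right)
  hence d1: "2 * of_real pi * deriv H z = integral {0..2*pi} (\<lambda>t. H (W t) * K t)"
    by (simp add: d)
  \<comment> \<open>\<open>G\<close> carries the reflected Cauchy kernel: its pole is the mirror
    image of \<open>z\<close>, outside the closed disc, so \<open>G\<close> integrates to zero.
    Conjugating on the circle, where u * cnj u = R^2, turns this into a vanishing integral of cnj H
    against the kernel \<open>K\<close>.\<close>
  define G where "G = (\<lambda>u. H u * of_real R ^ 2 / (of_real R ^ 2 - cnj z * u)\<^sup>2)"
  have nzG: "of_real R ^ 2 - cnj z * u \<noteq> 0" if "norm u \<le> R" for u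
  proof
    assume "of_real R ^ 2 - cnj z * u = 0"
    hence "norm (cnj z * u) = R ^ 2" by (metis eq_iff_diff_eq_0 norm_of_real norm_power power2_abs)
    hence "norm z * norm u = R * R" by (simp add: norm_mult power2_eq_square)
    moreover have "norm z * norm u \<le> norm z * R" using that by (simp add: mult_left_mono)
    moreover have "norm z * R < R * R" using z R0 by simp
    ultimately show False by linarith
  qed
  have "(G has_contour_integral 0) (circlepath 0 R)"
  proof (rule Cauchy_theorem_disc_simple[of _ 0])
    \<comment> \<open>The radius stays below R', where \<open>H\<close> is holomorphic, and below
      the pole of \<open>G\<close> at distance R^2 / |z| = R + R (R - |z|) / |z|. The 1 in the
      denominator covers z = 0.\<close>
    show "path_image (circlepath 0 R) \<subseteq> ball 0 (R + min (R' - R) (R * (R - norm z) / (norm z + 1)))"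
      using R0 R z by (auto simp: add_nonneg_pos)
    show "G holomorphic_on ball 0 (R + min (R' - R) (R * (R - norm z) / (norm z + 1)))"
    proof -
      have "of_real R ^ 2 - cnj z * u \<noteq> 0" if "norm u < R + R * (R - norm z) / (norm z + 1)" for u
      proof
        assume "of_real R ^ 2 - cnj z * u = 0"
        hence "norm (cnj z * u) = R ^ 2" by (metis eq_iff_diff_eq_0 norm_of_real norm_power power2_abs)
        hence e: "norm z * norm u = R * R" by (simp add: norm_mult power2_eq_square)
        have "norm z \<noteq> 0" using e R0 by auto
        hence "norm z * norm u < norm z * (R + R * (R - norm z) / (norm z + 1))" using that by simp
        also have "\<dots> = norm z * R + R * (R - norm z) * (norm z / (norm z + 1))" by (simp add: distrib_left mult.commute)
        also have "\<dots> \<le> norm z * R + R * (R - norm z) * 1"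
          using z R0 by (intro add_left_mono mult_left_mono divide_le_eq_1_pos[THEN iffD2]) (auto intro: add_nonneg_pos)
        also have "\<dots> = R * R" by (simp add: algebra_simps)
        finally show False using e by simp
      qed
      thus ?thesis unfolding G_def
        by (intro holomorphic_intros holomorphic_on_subset[OF H]) auto
    qed
  qed auto
  hence "contour_integral (circlepath 0 R) G = 0" by (simp add: contour_integral_unique)
  hence "integral {0..2*pi} (\<lambda>t. \<i> * (G (W t) * W t)) = 0"
    by (simp add: contour_integral_circlepath_eq W_def algebra_simps)
  hence "integral {0..2*pi} (\<lambda>t. G (W t) * W t) = 0"
    by (subst (asm) integral_mult_right) auto
  hence "cnj (integral {0..2*pi} (\<lambda>t. G (W t) * W t)) = 0" by simp
  hence d2: "integral {0..2*pi} (\<lambda>t. cnj (G (W t) * W t)) = 0"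
    by (simp add: integral_cnj)
  have "cnj (G (W t) * W t) = cnj (H (W t)) * K t" for t
  proof -
    have "of_real R ^ 2 - z * cnj (W t) = cnj (W t) * (W t - z)" using WcW[of t] by (simp add: algebra_simps)
    hence "cnj (G (W t) * W t) = cnj (H (W t)) * of_real R ^ 2 * cnj (W t) / (cnj (W t) * (W t - z))\<^sup>2"
      by (simp add: G_def)
    also have "\<dots> = cnj (H (W t)) * (W t * cnj (W t)) * cnj (W t) / (cnj (W t) * (W t - z))\<^sup>2"
      by (simp add: WcW)
    also have "\<dots> = cnj (H (W t)) * K t"
    proof -
      have "x * (w * c) * c / (c * d)\<^sup>2 = x * (w / d\<^sup>2)" if "c \<noteq> 0" "d \<noteq> 0" for x w c d :: complex
        using that by (simp add: power2_eq_square field_simps)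
      thus ?thesis using Wnz[of t] by (simp add: K_def)
    qed
    finally show ?thesis .
  qed
  with d2 have d3: "integral {0..2*pi} (\<lambda>t. cnj (H (W t)) * K t) = 0" by simp
  have cK: "continuous_on {0..2*pi} K" and cHW: "continuous_on {0..2*pi} (\<lambda>t. H (W t))"
    unfolding K_def
    subgoal using Wnz by (intro continuous_intros) (auto simp: W_def intro!: continuous_intros)
    subgoal unfolding W_def using R0 sub cont by (intro continuous_on_circle) (auto intro: continuous_on_subset)
    done
  have "2 * of_real pi * deriv H z = integral {0..2*pi} (\<lambda>t. H (W t) * K t + cnj (H (W t)) * K t)"
    using d1 d3 by (subst integral_add) (auto intro!: integrable_continuous_interval continuous_intros cK cHW)
  also have "\<dots> = integral {0..2*pi} (\<lambda>t. of_real (2 * Re (H (W t))) * K t)"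
    by (intro integral_cong) (simp add: complex_eq_iff algebra_simps)
  finally have e: "2 * of_real pi * deriv H z = integral {0..2*pi} (\<lambda>t. of_real (2 * Re (H (W t))) * K t)" .
  have "norm (2 * of_real pi * deriv H z) \<le> integral {0..2*pi} (\<lambda>t. 2 * R / (R - norm z)\<^sup>2 * \<bar>Re (H (W t))\<bar>)"
    unfolding e
  proof (rule integral_norm_bound_integral)
    fix t assume "t \<in> {0..2*pi}"
    have "norm (K t) \<le> R / (R - norm z)\<^sup>2"
      using nW[of t] z R0 norm_triangle_ineq2[of "W t" z]
      by (auto simp: K_def norm_divide norm_power intro!: divide_left_mono power_mono mult_pos_pos)
    hence "2 * \<bar>Re (H (W t))\<bar> * norm (K t) \<le> 2 * \<bar>Re (H (W t))\<bar> * (R / (R - norm z)\<^sup>2)"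
      by (intro mult_left_mono) auto
    thus "norm (of_real (2 * Re (H (W t))) * K t) \<le> 2 * R / (R - norm z)\<^sup>2 * \<bar>Re (H (W t))\<bar>"
      by (simp add: norm_mult mult_ac)
  qed (use z in \<open>auto intro!: integrable_continuous_interval continuous_intros cK cHW\<close>)
  hence "2 * pi * norm (deriv H z) \<le> 2 * R / (R - norm z)\<^sup>2 * integral {0..2*pi} (\<lambda>t. \<bar>Re (H (W t))\<bar>)"
    by (simp add: norm_mult)
  hence "norm (deriv H z) \<le> 2 * R / (R - norm z)\<^sup>2 * integral {0..2*pi} (\<lambda>t. \<bar>Re (H (W t))\<bar>) / (2 * pi)"
    by (subst pos_le_divide_eq) (simp_all add: mult.commute)
  thus ?thesis by (simp add: circle_mean_def W_def)
qed

subsection \<open>Blaschke factorization\<close>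

lemma eventually_nonzero_cosparse:
  assumes "g meromorphic_on UNIV" "not_identically_zero g"
  shows "\<forall>\<^sub>\<approx>z\<in>UNIV. g z \<noteq> 0"
  using meromorphic_imp_constant_or_avoid[of g UNIV 0] assms by (auto simp: not_identically_zero_def)

lemma eventually_nonzero_at:
  assumes "g meromorphic_on UNIV" "not_identically_zero g"
  shows "\<forall>\<^sub>F z in at a. g z \<noteq> 0"
  using eventually_nonzero_cosparse[OF assms] by (simp add: eventually_cosparse_open_eq)

text \<open>Order zero excludes a pole and, as \<open>g\<close> is not locally zero, a zero of the
  extension; only the value at \<open>z\<close> itself may have been wrong.\<close>

lemma remove_sings_zorder_0:
  assumes "g meromorphic_on {z}" "\<forall>\<^sub>F w in at z. g w \<noteq> 0" "zorder g z = 0"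
  shows "remove_sings g analytic_on {z}" "remove_sings g z \<noteq> 0"
proof -
  have iso: "isolated_singularity_at g z" and ne: "not_essential g z"
    using assms(1) by (auto simp: meromorphic_at_iff)
  have np: "\<not> is_pole g z"
    using isolated_pole_imp_neg_zorder[OF iso] assms(3) by auto
  then obtain c where c: "g \<midarrow>z\<rightarrow> c" using ne by (auto simp: not_essential_def)
  show "remove_sings g analytic_on {z}" by (rule remove_sings_analytic_at[OF iso c])
  show "remove_sings g z \<noteq> 0"
  proof
    assume "remove_sings g z = 0"
    hence "g \<midarrow>z\<rightarrow> 0" using np by (simp add: remove_sings_eq_0_iff[OF ne])
    hence "isolated_zero g z" using assms(2) by (simp add: isolated_zero_def)
    hence "zorder g z > 0" using iso by (rule zorder_isolated_zero_pos')
    thus False using assms(3) by simp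
  qed
qed

text \<open>Normalized to be unimodular on |z| = R. For a = 0 it is z / R, so the origin needs no
  factor of a different shape.\<close>

definition blaschke :: "real \<Rightarrow> complex \<Rightarrow> complex \<Rightarrow> complex" where
  "blaschke R a z = of_real R * (z - a) / (of_real R ^ 2 - cnj a * z)"

lemma blaschke_denom_bound:
  assumes "norm a < R" "norm z \<le> s" "s \<le> R"
  shows "norm (of_real R ^ 2 - cnj a * z) \<ge> R * (R - s)"
    and "of_real R ^ 2 - cnj a * z \<noteq> 0"
proof -
  have R: "R > 0" using assms(1) norm_ge_zero[of a] by linarith
  have *: "norm (of_real R ^ 2 - cnj a * z) \<ge> R\<^sup>2 - norm a * norm z"
    using norm_triangle_ineq2[of "of_real R ^ 2" "cnj a * z"] R by (simp add: norm_mult norm_power)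
  have "norm a * norm z \<le> R * s" using assms R by (intro mult_mono) auto
  thus 1: "norm (of_real R ^ 2 - cnj a * z) \<ge> R * (R - s)"
    using * by (simp add: algebra_simps power2_eq_square)
  show "of_real R ^ 2 - cnj a * z \<noteq> 0"
  proof -
    have "norm a * norm z \<le> norm a * R" using assms by (intro mult_left_mono) auto
    also have "\<dots> < R * R" using assms R by simp
    finally show ?thesis using * by (auto simp: power2_eq_square)
  qed
qed

lemma blaschke_analytic:
  assumes "norm a < R"
  shows "blaschke R a analytic_on cball 0 R"
  unfolding blaschke_def
  by (intro analytic_intros) (use blaschke_denom_bound(2)[OF assms] in auto)

lemma blaschke_eq_0_iff:
  assumes "norm a < R" "norm z \<le> R"
  shows "blaschke R a z = 0 \<longleftrightarrow> z = a"
  using blaschke_denom_bound(2)[OF assms order.refl] assms norm_ge_zero[of a] by (auto simp: blaschke_def)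

lemma norm_blaschke_0: "R > 0 \<Longrightarrow> norm (blaschke R a 0) = norm a / R"
  by (simp add: blaschke_def norm_mult norm_divide power2_eq_square)

lemma norm_blaschke_circle:
  assumes "norm a < R" "norm z = R"
  shows "norm (blaschke R a z) = 1"
proof -
  have "of_real R ^ 2 = z * cnj z" using complex_norm_square[of z] assms(2) by simp
  hence "of_real R ^ 2 - cnj a * z = z * cnj (z - a)" by (simp add: algebra_simps)
  hence "norm (of_real R ^ 2 - cnj a * z) = R * norm (z - a)"
    using assms(2) by (simp add: norm_mult complex_mod_cnj del: complex_cnj_diff)
  moreover have "z \<noteq> a" using assms by auto
  moreover have "R > 0" using assms norm_ge_zero[of a] by linarith
  ultimately show ?thesis by (simp add: blaschke_def norm_mult norm_divide)
qed

lemma norm_blaschke_le: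
  assumes "norm a < R" "norm z \<le> R"
  shows "norm (blaschke R a z) \<le> 1"
proof (cases "norm z = R")
  case False
  have an: "blaschke R a analytic_on cball 0 R" using blaschke_analytic[OF assms(1)] .
  have R: "R > 0" using assms(1) norm_ge_zero[of a] by linarith
  show ?thesis
  proof (rule maximum_modulus_frontier[of "blaschke R a" "cball 0 R"])
    show "blaschke R a holomorphic_on interior (cball 0 R)"
      using an analytic_imp_holomorphic holomorphic_on_subset interior_subset by blast
    show "continuous_on (closure (cball 0 R)) (blaschke R a)"
      using an analytic_imp_holomorphic holomorphic_on_imp_continuous_on by auto
  qed (use assms R norm_blaschke_circle in auto)
qed (use norm_blaschke_circle assms in auto)

lemma zorder_blaschke:
  assumes "norm a < R" "norm z \<le> R"
  shows "zorder (blaschke R a) z = (if z = a then 1 else 0)"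
proof (cases "z = a")
  case False
  have "blaschke R a analytic_on {z}"
    by (rule analytic_on_subset[OF blaschke_analytic]) (use assms in auto)
  thus ?thesis using False blaschke_eq_0_iff[OF assms] by (auto intro!: zorder_eq_0I)
next
  case True
  define k where "k = (\<lambda>w. of_real R / (of_real R ^ 2 - cnj a * w))"
  have R: "R > 0" using assms(1) norm_ge_zero[of a] by linarith
  have "zorder (blaschke R a) a = 1"
  proof (rule zorder_eqI[of "ball 0 R" a k])
    show "k holomorphic_on ball 0 R" unfolding k_def
      by (intro holomorphic_intros) (use blaschke_denom_bound(2)[OF assms(1) _ order.refl] in simp)
    show "k a \<noteq> 0" using R blaschke_denom_bound(2)[OF assms(1), of a R] assms(1) by (simp add: k_def)
  qed (use assms in \<open>auto simp: k_def blaschke_def\<close>)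
  thus ?thesis using True by simp
qed

text \<open>The logarithmic derivative is 1 / (z - a) + cnj a / (R^2 - cnj a * z), and the second
  summand stays bounded on the smaller disc.\<close>

lemma blaschke_logderiv:
  assumes "norm a < R" "norm z \<le> s" "s < R" "z \<noteq> a"
  shows "norm (deriv (blaschke R a) z / blaschke R a z) \<le> 1 / norm (z - a) + 1 / (R - s)"
proof -
  define d where "d = of_real R ^ 2 - cnj a * z"
  have R: "R > 0" using assms(1) norm_ge_zero[of a] by linarith
  have d: "d \<noteq> 0" "norm d \<ge> R * (R - s)"
    using blaschke_denom_bound[OF assms(1,2)] assms(3) by (auto simp: d_def)
  have "(blaschke R a has_field_derivative (of_real R * d + of_real R * (z - a) * cnj a) / d ^ 2) (at z)"
    unfolding blaschke_def d_def
    by (rule derivative_eq_intros refl d[unfolded d_def])+ (simp add: power2_eq_square)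
  hence "deriv (blaschke R a) z = (of_real R * d + of_real R * (z - a) * cnj a) / d ^ 2"
    by (rule DERIV_imp_deriv)
  hence "deriv (blaschke R a) z / blaschke R a z = 1 / (z - a) + cnj a / d"
    using d R assms(4) by (simp add: blaschke_def flip: d_def) (simp add: field_simps power2_eq_square)
  also have "norm \<dots> \<le> norm (1 / (z - a)) + norm (cnj a / d)" by (rule norm_triangle_ineq)
  also have "norm (cnj a / d) \<le> R / (R * (R - s))"
    unfolding norm_divide using d assms R by (intro frac_le) auto
  finally show ?thesis using R by (simp add: norm_divide)
qed

text \<open>Moving the argument by at most \<open>D\<close> changes numerator and denominator by the
  relative amounts D / |z - a| and D / (R - s). The first factor is large only near
  \<open>a\<close>, and its logarithm has a small mean over circles.\<close>

lemma blaschke_ratio: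
  assumes "norm a < R" "norm z \<le> s" "norm w \<le> s" "s < R" "z \<noteq> a" "norm (w - z) \<le> D"
  shows "norm (blaschke R a w) \<le> norm (blaschke R a z) * ((1 + D / norm (z - a)) * (1 + D / (R - s)))"
proof -
  define d where "d = (\<lambda>z. of_real R ^ 2 - cnj a * z)"
  have R: "R > 0" using assms(1) norm_ge_zero[of a] by linarith
  have d: "d z \<noteq> 0" "norm (d z) \<ge> R * (R - s)" "d w \<noteq> 0" "norm (d w) \<ge> R * (R - s)"
    using blaschke_denom_bound[OF assms(1,2)] blaschke_denom_bound[OF assms(1,3)] assms(4) by (auto simp: d_def)
  have "norm (w - a) \<le> norm (w - z) + norm (z - a)"
    using norm_triangle_ineq[of "w - z" "z - a"] by simp
  also have "\<dots> \<le> norm (z - a) * (1 + D / norm (z - a))" using assms by (simp add: field_simps)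
  finally have 1: "norm (w - a) \<le> norm (z - a) * (1 + D / norm (z - a))" .
  have "d z = d w + cnj a * (w - z)" by (simp add: d_def algebra_simps)
  hence "norm (d z) \<le> norm (d w) + norm a * norm (w - z)"
    using norm_triangle_ineq[of "d w" "cnj a * (w - z)"] by (simp add: norm_mult)
  also have "norm a * norm (w - z) \<le> R * D" using assms R by (intro mult_mono) auto
  also have "R * D \<le> norm (d w) * (D / (R - s))"
  proof -
    have "D \<ge> 0" using assms(6) norm_ge_zero order_trans by blast
    hence "(R * (R - s)) * (D / (R - s)) \<le> norm (d w) * (D / (R - s))" using d assms by (intro mult_right_mono) auto
    thus ?thesis using assms by simp
  qed
  finally have 2: "norm (d z) \<le> norm (d w) * (1 + D / (R - s))" by (simp add: algebra_simps)
  have frac: "p / q \<le> (u / v) * (x * y)" if "p * v \<le> (u * x) * (q * y)" "q > 0" "v > 0" for p q u v x y :: real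
  proof -
    have "p / q \<le> ((u * x) * (q * y)) / v / q"
      using that by (intro divide_right_mono) (auto simp: le_divide_eq)
    thus ?thesis using that by simp
  qed
  have "norm (w - a) * norm (d z) \<le> (norm (z - a) * (1 + D / norm (z - a))) * (norm (d w) * (1 + D / (R - s)))"
    by (intro mult_mono 1 2) (use 1 in \<open>auto intro: order_trans[OF norm_ge_zero]\<close>)
  hence "norm (w - a) / norm (d w) \<le> (norm (z - a) / norm (d z)) * ((1 + D / norm (z - a)) * (1 + D / (R - s)))"
    by (rule frac) (use d in simp_all)
  hence "R * (norm (w - a) / norm (d w)) \<le> R * ((norm (z - a) / norm (d z)) * ((1 + D / norm (z - a)) * (1 + D / (R - s))))"
    using R by (intro mult_left_mono) auto
  thus ?thesis using R by (simp add: blaschke_def d_def norm_mult norm_divide mult_ac)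
qed

text \<open>A finite superset of the zeros and poles in the disc. It may contain points of order 0,
  which contribute trivial factors. The origin is always a member, so it can be split off from every
  sum and product.\<close>

definition divisor_set :: "real \<Rightarrow> (complex \<Rightarrow> complex) \<Rightarrow> complex set" where
  "divisor_set R g = insert 0 {z \<in> cball 0 R. \<not> g analytic_on {z} \<or> g z = 0}"

lemma finite_divisor_set:
  assumes "g meromorphic_on UNIV" "not_identically_zero g"
  shows "finite (divisor_set R g)"
proof -
  have "\<forall>\<^sub>\<approx>z\<in>UNIV. g z \<noteq> 0" by (rule eventually_nonzero_cosparse[OF assms])
  moreover have "\<forall>\<^sub>\<approx>z\<in>UNIV. g analytic_on {z}" using meromorphic_on_imp_analytic_cosparse[OF assms(1)] .
  ultimately have "\<forall>\<^sub>\<approx>z\<in>UNIV. \<not> (\<not> g analytic_on {z} \<or> g z = 0)"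
    by eventually_elim auto
  hence "{z. \<not> g analytic_on {z} \<or> g z = 0} sparse_in UNIV"
    by (simp add: eventually_cosparse)
  hence "{z. \<not> g analytic_on {z} \<or> g z = 0} sparse_in cball 0 R" using sparse_in_subset by blast
  hence "finite (cball 0 R \<inter> {z. \<not> g analytic_on {z} \<or> g z = 0})"
    by (intro sparse_in_compact_finite) auto
  thus ?thesis by (simp add: divisor_set_def Int_def)
qed

text \<open>On such a circle log |g| is continuous, so no improper integrals arise. If
  \<open>g\<close> is meromorphic and not identically zero, only countably many radii are
  lost.\<close>

definition regular_circle :: "real \<Rightarrow> (complex \<Rightarrow> complex) \<Rightarrow> bool" where
  "regular_circle R g \<longleftrightarrow> (\<forall>z. norm z = R \<longrightarrow> g analytic_on {z} \<and> g z \<noteq> 0)"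

text \<open>Dividing \<open>g\<close> by the Blaschke factors raised to its orders leaves order 0
  throughout the closed disc, and removing singularities gives \<open>h\<close>. The value of
  \<open>h\<close> at 0 is recorded because it becomes one side of Jensen's formula.\<close>

lemma blaschke_factorization:
  assumes g: "g meromorphic_on UNIV" "not_identically_zero g" and R: "R > 0"
    and circ: "regular_circle R g"
  obtains h where "h analytic_on cball 0 R" "\<And>z. norm z \<le> R \<Longrightarrow> h z \<noteq> 0"
    "\<And>z. norm z \<le> R \<Longrightarrow> g analytic_on {z} \<Longrightarrow> g z \<noteq> 0 \<Longrightarrow>
        g z = h z * (\<Prod>a\<in>divisor_set R g. blaschke R a z powi zorder g a)"
    "h 0 = zor_poly g 0 0 * of_real R powi zorder g 0 *
        (\<Prod>a\<in>divisor_set R g - {0}. blaschke R a 0 powi (- zorder g a))"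
proof -
  define S where "S = divisor_set R g"
  have fin: "finite S" using finite_divisor_set[OF g] by (simp add: S_def)
  have S: "norm a < R" if "a \<in> S" for a
    using that circ R by (auto simp: regular_circle_def S_def divisor_set_def less_le)
  have "0 \<in> S" by (simp add: S_def divisor_set_def)
  have notS: "g analytic_on {z}" "g z \<noteq> 0" if "norm z \<le> R" "z \<notin> S" for z
    using that by (auto simp: S_def divisor_set_def)
  define h0 where "h0 = (\<lambda>z. g z * (\<Prod>a\<in>S. blaschke R a z powi (- zorder g a)))"
  have B_an: "blaschke R a analytic_on {z}" if "a \<in> S" "norm z \<le> R" for a z
    by (rule analytic_on_subset[OF blaschke_analytic]) (use S that in auto)
  have B_mer: "blaschke R a meromorphic_on {z}" if "a \<in> S" "norm z \<le> R" for a z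
    using B_an[OF that] by (rule analytic_on_imp_meromorphic_on)
  have g_ev: "\<forall>\<^sub>F w in at z. g w \<noteq> 0" for z using eventually_nonzero_at[OF g] .
  have B_ev: "\<forall>\<^sub>F w in at z. blaschke R a w \<noteq> 0" if "a \<in> S" "norm z \<le> R" for a z
  proof -
    have "isCont (\<lambda>w. of_real R ^ 2 - cnj a * w) z" by (intro continuous_intros)
    hence "\<forall>\<^sub>F w in at z. of_real R ^ 2 - cnj a * w \<noteq> 0"
      using blaschke_denom_bound(2)[OF S[OF that(1)] that(2) order.refl]
      by (intro tendsto_imp_eventually_ne) (auto simp: isCont_def)
    moreover have "\<forall>\<^sub>F w in at z. w \<noteq> a"
      using eventually_neq_at_within[of a z UNIV] by simp
    ultimately show ?thesis by eventually_elim (use R in \<open>auto simp: blaschke_def\<close>)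
  qed
  have P_ev: "\<forall>\<^sub>F w in at z. (\<Prod>a\<in>S. blaschke R a w powi (- zorder g a)) \<noteq> 0" if "norm z \<le> R" for z
  proof -
    have "\<forall>\<^sub>F w in at z. \<forall>a\<in>S. blaschke R a w \<noteq> 0"
      using B_ev[OF _ that] fin by (simp add: eventually_ball_finite)
    thus ?thesis by eventually_elim (use fin in auto)
  qed
  have P_mer: "(\<lambda>w. \<Prod>a\<in>S. blaschke R a w powi (- zorder g a)) meromorphic_on {z}" if "norm z \<le> R" for z
    by (intro meromorphic_intros B_mer that)
  have g_mer: "g meromorphic_on {z}" for z using g(1) meromorphic_on_subset by blast
  have h0_mer: "h0 meromorphic_on {z}" if "norm z \<le> R" for z
    unfolding h0_def by (intro meromorphic_on_mult g_mer P_mer that)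
  have h0_ev: "\<forall>\<^sub>F w in at z. h0 w \<noteq> 0" if "norm z \<le> R" for z
    using g_ev P_ev[OF that] unfolding h0_def by eventually_elim auto
  have h0_ord: "zorder h0 z = 0" if z: "norm z \<le> R" for z
  proof -
    have "zorder h0 z = zorder g z + zorder (\<lambda>w. \<Prod>a\<in>S. blaschke R a w powi (- zorder g a)) z"
      unfolding h0_def by (intro zorder_mult g_mer P_mer z eventually_frequently g_ev P_ev) auto
    also have "zorder (\<lambda>w. \<Prod>a\<in>S. blaschke R a w powi (- zorder g a)) z =
        (\<Sum>a\<in>S. zorder (\<lambda>w. blaschke R a w powi (- zorder g a)) z)"
      by (intro zorder_prod P_ev z meromorphic_intros B_mer)
    also have "\<dots> = (\<Sum>a\<in>S. - zorder g a * zorder (blaschke R a) z)"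
      by (intro sum.cong zorder_power_int B_mer z eventually_frequently B_ev) auto
    also have "\<dots> = (\<Sum>a\<in>S. if z = a then - zorder g z else 0)"
      by (intro sum.cong) (auto simp: zorder_blaschke S z)
    also have "\<dots> = (if z \<in> S then - zorder g z else 0)" using fin by simp
    finally show ?thesis using notS[OF z] by (auto simp: zorder_eq_0I)
  qed
  define h where "h = remove_sings h0"
  have h_an: "h analytic_on {z}" "h z \<noteq> 0" if "norm z \<le> R" for z
    unfolding h_def using remove_sings_zorder_0[OF h0_mer h0_ev h0_ord] that by auto
  \<comment> \<open>Where \<open>g\<close> is analytic and nonzero, a factor can vanish only if its
    exponent is 0, and \<open>0 powi 0 = 1\<close>.\<close>
  have nz: "zorder g a = 0 \<or> blaschke R a z \<noteq> 0"
    if "a \<in> S" "norm z \<le> R" "g analytic_on {z}" "g z \<noteq> 0" for a z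
    using blaschke_eq_0_iff[OF S[OF that(1)] that(2)] zorder_eq_0I[OF that(3,4)] by metis
  have h_eq: "h z = h0 z" if z: "norm z \<le> R" "g analytic_on {z}" "g z \<noteq> 0" for z
  proof -
    have "(\<lambda>w. \<Prod>a\<in>S. blaschke R a w powi (- zorder g a)) analytic_on {z}"
    proof (rule analytic_on_prod)
      fix a assume a: "a \<in> S"
      show "(\<lambda>w. blaschke R a w powi (- zorder g a)) analytic_on {z}"
        using nz[OF a z] a B_an[of a z] z(1) by (intro analytic_on_power_int) auto
    qed
    hence "h0 analytic_on {z}" unfolding h0_def by (rule analytic_on_mult[OF z(2)])
    thus ?thesis by (simp add: h_def)
  qed
  show ?thesis
  proof (rule that[of h])
    show "h analytic_on cball 0 R" by (subst analytic_on_analytic_at) (use h_an(1) in auto)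
    show "h z \<noteq> 0" if "norm z \<le> R" for z using h_an that by blast
    show "g z = h z * (\<Prod>a\<in>divisor_set R g. blaschke R a z powi zorder g a)"
      if z: "norm z \<le> R" "g analytic_on {z}" "g z \<noteq> 0" for z
    proof -
      have "(\<Prod>a\<in>S. blaschke R a z powi (- zorder g a)) * (\<Prod>a\<in>S. blaschke R a z powi zorder g a) = 1"
        unfolding prod.distrib[symmetric]
      proof (rule prod.neutral, safe)
        fix a assume a: "a \<in> S"
        show "blaschke R a z powi (- zorder g a) * blaschke R a z powi zorder g a = 1"
          using nz[OF a z] by (auto simp: power_int_minus)
      qed
      thus ?thesis using h_eq[OF z] by (simp add: S_def h0_def mult.assoc)
    qed
    show "h 0 = zor_poly g 0 0 * of_real R powi zorder g 0 *
        (\<Prod>a\<in>divisor_set R g - {0}. blaschke R a 0 powi (- zorder g a))"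
    \<comment> \<open>The product \<open>h0\<close> is not reliable at 0 itself, where
      \<open>g\<close> may have a pole and the factor of the origin vanishes; hence a limit.\<close>
    proof (rule tendsto_unique[of "at 0"])
      have "isCont h 0" using h_an[of 0] R by (simp add: analytic_at_imp_isCont)
      moreover have "\<forall>\<^sub>F z in at 0. h z = h0 z"
        unfolding h_def by (rule eventually_remove_sings_eq_at)
          (use h0_mer[of 0] R in \<open>auto simp: meromorphic_at_iff\<close>)
      ultimately show "h0 \<midarrow>0\<rightarrow> h 0" by (metis isCont_def tendsto_cong)
      have ex: "\<exists>r>0. zor_poly g 0 holomorphic_on cball 0 r \<and>
          (\<forall>w\<in>cball 0 r - {0}. g w = zor_poly g 0 w * (w - 0) powi zorder g 0 \<and> zor_poly g 0 w \<noteq> 0)"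
        using zorder_exist[of g 0] g_mer[of 0] g_ev[of 0]
        by (auto simp: meromorphic_at_iff eventually_frequently)
      then obtain r where r: "r > 0" "zor_poly g 0 holomorphic_on cball 0 r"
          "\<And>w. w \<in> cball 0 r - {0} \<Longrightarrow> g w = zor_poly g 0 w * w powi zorder g 0" by auto
      have ev: "\<forall>\<^sub>F z in at 0. h0 z = zor_poly g 0 z * of_real R powi zorder g 0 *
        (\<Prod>a\<in>S - {0}. blaschke R a z powi (- zorder g a))"
      proof -
        have "\<forall>\<^sub>F z in at (0::complex). z \<in> ball 0 r - {0}"
          using eventually_at_in_open[of "ball 0 r" "0::complex"] r(1) by (simp only: open_ball centre_in_ball)
        thus ?thesis
        proof eventually_elim
          case (elim z)
          have "h0 z = (zor_poly g 0 z * z powi zorder g 0) * (blaschke R 0 z powi (- zorder g 0) * (\<Prod>a\<in>S - {0}. blaschke R a z powi (- zorder g a)))"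
            using elim r(3)[of z] \<open>0 \<in> S\<close> fin by (simp add: h0_def prod.remove[of S 0])
          also have "blaschke R 0 z = z / of_real R" using R by (simp add: blaschke_def power2_eq_square)
          also have "(z / of_real R) powi (- zorder g 0) = of_real R powi zorder g 0 / z powi zorder g 0"
            by (simp add: power_int_divide_distrib power_int_minus field_simps)
          finally show ?case using elim by simp
        qed
      qed
      have "isCont (zor_poly g 0) 0"
        using holomorphic_on_imp_continuous_on[OF holomorphic_on_subset[OF r(2) ball_subset_cball]] r(1) by (simp add: continuous_on_eq_continuous_at)
      moreover have "isCont (blaschke R a) 0" if "a \<in> S" for a using B_an[OF that, of 0] R by (simp add: analytic_at_imp_isCont)
      moreover have "blaschke R a 0 \<noteq> 0" if "a \<in> S - {0}" for a
        using blaschke_eq_0_iff[OF S, of a 0] that R by auto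
      ultimately have "(\<lambda>z. zor_poly g 0 z * of_real R powi zorder g 0 *
        (\<Prod>a\<in>S - {0}. blaschke R a z powi (- zorder g a))) \<midarrow>0\<rightarrow> zor_poly g 0 0 * of_real R powi zorder g 0 *
        (\<Prod>a\<in>S - {0}. blaschke R a 0 powi (- zorder g a))"
        by (auto intro!: tendsto_intros simp: isCont_def)
      thus "h0 \<midarrow>0\<rightarrow> zor_poly g 0 0 * of_real R powi zorder g 0 *
        (\<Prod>a\<in>divisor_set R g - {0}. blaschke R a 0 powi (- zorder g a))"
        using tendsto_cong[OF ev] by (simp add: S_def)
    qed auto
  qed
qed

section \<open>Pole orders, Jensen weights and the logarithm of the zero-free factor\<close>

lemma meromorphic_on_UNIV_at: "g meromorphic_on UNIV \<Longrightarrow> g meromorphic_on {z}"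
  using meromorphic_on_subset by blast

text \<open>The test \<open>is_pole\<close> yields 0 for functions that vanish near
  \<open>a\<close>, where \<open>zorder\<close> carries no information.\<close>

definition pole_order :: "(complex \<Rightarrow> complex) \<Rightarrow> complex \<Rightarrow> nat" where
  "pole_order g a = (if is_pole g a then nat (- zorder g a) else 0)"

text \<open>The share of a simple pole at \<open>a\<close> in N(r, g): the integral of 1/t from |a|
  to r, or log r at the origin. The latter is nonnegative only for r \<ge> 1, whence that hypothesis
  in the lemmas on N.\<close>

definition jensen_weight :: "real \<Rightarrow> complex \<Rightarrow> real" where
  "jensen_weight r a = (if a = 0 then ln r else ln (r / norm a))"

lemma jensen_weight_nonneg: "r \<ge> 1 \<Longrightarrow> norm a \<le> r \<Longrightarrow> jensen_weight r a \<ge> 0"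
  by (auto simp: jensen_weight_def)

lemma pole_order_eq:
  assumes "g meromorphic_on {a}" "\<forall>\<^sub>F z in at a. g z \<noteq> 0"
  shows "pole_order g a = nat (- zorder g a)"
proof -
  have "is_pole g a \<longleftrightarrow> zorder g a < 0"
    using isolated_pole_imp_neg_zorder neg_zorder_imp_is_pole assms
    by (auto simp: meromorphic_at_iff eventually_frequently)
  thus ?thesis by (auto simp: pole_order_def)
qed

lemma pole_order_inverse_eq:
  assumes "g meromorphic_on {a}" "\<forall>\<^sub>F z in at a. g z \<noteq> 0"
  shows "pole_order (\<lambda>z. 1 / g z) a = nat (zorder g a)"
proof -
  have "zorder (\<lambda>z. 1 / g z) a = zorder (\<lambda>z. 1) a - zorder g a"
    by (intro zorder_divide assms eventually_frequently) auto
  also have "zorder (\<lambda>z. 1 :: complex) a = 0" by (intro zorder_eq_0I) auto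
  finally have "zorder (\<lambda>z. 1 / g z) a = - zorder g a" by simp
  moreover have "pole_order (\<lambda>z. 1 / g z) a = nat (- zorder (\<lambda>z. 1 / g z) a)"
    by (intro pole_order_eq meromorphic_intros assms eventually_mono[OF assms(2)]) auto
  ultimately show ?thesis by simp
qed

lemma zorder_eq_pole_order_diff:
  assumes "g meromorphic_on {a}" "\<forall>\<^sub>F z in at a. g z \<noteq> 0"
  shows "zorder g a = int (pole_order (\<lambda>z. 1 / g z) a) - int (pole_order g a)"
    and "\<bar>zorder g a\<bar> = int (pole_order (\<lambda>z. 1 / g z) a) + int (pole_order g a)"
  using pole_order_eq[OF assms] pole_order_inverse_eq[OF assms] by auto

lemma is_pole_imp_in_divisor_set:
  assumes "g meromorphic_on UNIV" "norm a \<le> R"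
  shows "is_pole g a \<Longrightarrow> a \<in> divisor_set R g"
    and "is_pole (\<lambda>z. 1 / g z) a \<Longrightarrow> a \<in> divisor_set R g"
proof -
  show "is_pole g a \<Longrightarrow> a \<in> divisor_set R g"
    using assms analytic_at_imp_no_pole[of g a] by (auto simp: divisor_set_def)
  show "is_pole (\<lambda>z. 1 / g z) a \<Longrightarrow> a \<in> divisor_set R g"
  proof (rule ccontr)
    assume "is_pole (\<lambda>z. 1 / g z) a" "a \<notin> divisor_set R g"
    hence "g analytic_on {a}" "g a \<noteq> 0" using assms by (auto simp: divisor_set_def)
    hence "(\<lambda>z. 1 / g z) analytic_on {a}" by (intro analytic_intros) auto
    thus False using \<open>is_pole (\<lambda>z. 1 / g z) a\<close> analytic_at_imp_no_pole by blast
  qed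
qed

text \<open>The factor \<open>h\<close> is zero-free on a slightly larger disc, hence of the form
  exp H. The Blaschke factors are unimodular on |z| = R, so Re H = log |g| there; Schwarz' formula
  then bounds H', and the mean value property gives Re (H 0). Evaluating h(0) from the product gives
  a second expression for Re (H 0), and equating the two is Jensen's formula.\<close>

lemma log_factorization:
  assumes g: "g meromorphic_on UNIV" "not_identically_zero g" and R: "R > 0"
    and circ: "regular_circle R g"
  obtains H R' where "H holomorphic_on ball 0 R'" "R < R'"
    "\<And>z. norm z \<le> R \<Longrightarrow> g analytic_on {z} \<Longrightarrow> g z \<noteq> 0 \<Longrightarrow>
        g z = exp (H z) * (\<Prod>a\<in>divisor_set R g. blaschke R a z powi zorder g a)"
    "\<And>z. norm z < R \<Longrightarrow> norm (deriv H z) \<le>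
        2 * R / (R - norm z)\<^sup>2 * circle_mean R (\<lambda>z. \<bar>ln (norm (g z))\<bar>)"
    "Re (H 0) = circle_mean R (\<lambda>z. ln (norm (g z)))"
    "Re (H 0) = ln (norm (zor_poly g 0 0)) + (\<Sum>a\<in>divisor_set R g. real_of_int (zorder g a) * jensen_weight R a)"
proof -
  define S where "S = divisor_set R g"
  have fin: "finite S" using finite_divisor_set[OF g] by (simp add: S_def)
  have S: "norm a < R" if "a \<in> S" for a
    using that circ R by (auto simp: regular_circle_def S_def divisor_set_def less_le)
  have "0 \<in> S" by (simp add: S_def divisor_set_def)
  obtain h where
    h: "h analytic_on cball 0 R" "\<And>z. norm z \<le> R \<Longrightarrow> h z \<noteq> 0"
    "\<And>z. norm z \<le> R \<Longrightarrow> g analytic_on {z} \<Longrightarrow> g z \<noteq> 0 \<Longrightarrow> g z = h z * (\<Prod>a\<in>S. blaschke R a z powi zorder g a)"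
    "h 0 = zor_poly g 0 0 * of_real R powi zorder g 0 * (\<Prod>a\<in>S - {0}. blaschke R a 0 powi (- zorder g a))"
    by (rule blaschke_factorization[OF g R circ, folded S_def]) (rule that)
  obtain U where U: "open U" "cball 0 R \<subseteq> U" "h holomorphic_on U"
    using h(1) by (auto simp: analytic_on_holomorphic)
  have "open {z \<in> U. h z \<noteq> 0}"
    using continuous_open_preimage[OF holomorphic_on_imp_continuous_on[OF U(3)] U(1), of "- {0}"]
    by (simp add: vimage_def Int_def open_Compl)
  moreover have "cball 0 R \<subseteq> {z \<in> U. h z \<noteq> 0}" using U h(2) by auto
  ultimately obtain e where e: "e > 0" "(\<Union>z\<in>cball 0 R. ball z e) \<subseteq> {z \<in> U. h z \<noteq> 0}"
    using compact_subset_open_imp_ball_epsilon_subset[of "cball 0 R" "{z \<in> U. h z \<noteq> 0}"] by auto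
  have ball_sub: "ball 0 (R + e) \<subseteq> {z \<in> U. h z \<noteq> 0}"
  proof
    fix z :: complex assume z: "z \<in> ball 0 (R + e)"
    show "z \<in> {z \<in> U. h z \<noteq> 0}"
    proof (cases "norm z \<le> R")
      case True thus ?thesis using U h(2) by auto
    next
      case False
      \<comment> \<open>The radial projection of \<open>z\<close> to |w| = R, at distance |z| - R <
        e from \<open>z\<close>.\<close>
      define w where "w = (R / norm z) *\<^sub>R z"
      have "z - w = (1 - R / norm z) *\<^sub>R z" by (simp add: w_def algebra_simps)
      moreover have "norm z > 0" using False R by linarith
      moreover have "R / norm z \<le> 1" using False R by (intro divide_le_eq_1_pos[THEN iffD2]; linarith)
      ultimately have "norm (z - w) = norm z - R"
        by (simp only: norm_scaleR) (simp add: left_diff_distrib)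
      hence "dist w z = norm z - R"
        by (simp add: dist_norm norm_minus_commute)
      hence "z \<in> ball w e" "norm w \<le> R" using z R False by (auto simp: w_def)
      hence "z \<in> (\<Union>z\<in>cball 0 R. ball z e)" by (intro UN_I[of w]) auto
      thus ?thesis using e(2) by blast
    qed
  qed
  obtain H where H: "H holomorphic_on ball 0 (R + e)" "\<And>z. z \<in> ball 0 (R + e) \<Longrightarrow> exp (H z) = h z"
  proof (rule holomorphic_logarithm_exists[of "ball 0 (R + e)" h 0])
    show "h holomorphic_on ball 0 (R + e)" using holomorphic_on_subset[OF U(3)] ball_sub by blast
    show "h z \<noteq> 0" if "z \<in> ball 0 (R + e)" for z using ball_sub that by blast
  qed (use R e(1) in auto)
  have S_circ: "g analytic_on {z}" "g z \<noteq> 0" if "norm z = R" for z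
    using circ that by (auto simp: regular_circle_def)
  have Re_H: "Re (H z) = ln (norm (g z))" if "norm z = R" for z
  proof -
    have "norm (\<Prod>a\<in>S. blaschke R a z powi zorder g a) = 1"
      unfolding prod_norm[symmetric] using S that
      by (intro prod.neutral) (auto simp: norm_power_int norm_blaschke_circle)
    hence "norm (g z) = norm (exp (H z))" using h(3)[OF _ S_circ] H(2)[of z] that e(1) by (simp add: norm_mult)
    thus ?thesis by simp
  qed
  have "circle_mean R (\<lambda>z. \<bar>Re (H z)\<bar>) = circle_mean R (\<lambda>z. \<bar>ln (norm (g z))\<bar>)"
    using R by (intro circle_mean_cong) (auto simp: Re_H)
  moreover have "circle_mean R (\<lambda>z. Re (H z)) = circle_mean R (\<lambda>z. ln (norm (g z)))"
    using R by (intro circle_mean_cong) (auto simp: Re_H)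
  moreover have "Re (H 0) = ln (norm (zor_poly g 0 0)) + (\<Sum>a\<in>S. real_of_int (zorder g a) * jensen_weight R a)"
  proof -
    have "norm (h 0) \<noteq> 0" using h(2)[of 0] R by simp
    hence nz: "zor_poly g 0 0 \<noteq> 0" using h(4) by auto
    have B: "blaschke R a 0 \<noteq> 0" if "a \<in> S - {0}" for a
      using blaschke_eq_0_iff[OF S, of a 0] that R by auto
    have "Re (H 0) = ln (norm (h 0))" using H(2)[of 0] R e(1) by (metis norm_exp_eq_Re ln_exp add_pos_pos centre_in_ball)
    also have "norm (h 0) = norm (zor_poly g 0 0) * (R powi zorder g 0) * (\<Prod>a\<in>S-{0}. norm (blaschke R a 0) powi (- zorder g a))"
      using R by (simp add: h(4) norm_mult norm_power_int flip: prod_norm)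
    also have "ln \<dots> = ln (norm (zor_poly g 0 0)) + (ln (R powi zorder g 0) + ln (\<Prod>a\<in>S-{0}. norm (blaschke R a 0) powi (- zorder g a)))"
      using nz R B by (subst ln_mult_pos ln_mult_pos; (intro mult_pos_pos prod_pos)?; auto simp: ln_mult_pos)+
    also have "ln (R powi zorder g 0) = zorder g 0 * jensen_weight R 0"
      using R by (simp add: jensen_weight_def flip: powr_real_of_int') 
    also have "ln (\<Prod>a\<in>S-{0}. norm (blaschke R a 0) powi (- zorder g a)) = (\<Sum>a\<in>S-{0}. ln (norm (blaschke R a 0) powi (- zorder g a)))"
      using B fin by (intro ln_prod) auto
    also have "\<dots> = (\<Sum>a\<in>S-{0}. zorder g a * jensen_weight R a)"
    proof (intro sum.cong refl)
      fix a assume a: "a \<in> S - {0}"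
      have "ln (norm (blaschke R a 0) powi (- zorder g a)) = - zorder g a * ln (norm a / R)"
        using B[OF a] R a by (simp add: norm_blaschke_0 flip: powr_real_of_int')
      also have "ln (norm a / R) = - ln (R / norm a)" using a R by (simp add: ln_div)
      finally show "ln (norm (blaschke R a 0) powi (- zorder g a)) = zorder g a * jensen_weight R a"
        using a by (simp add: jensen_weight_def)
    qed
    also have "zorder g 0 * jensen_weight R 0 + \<dots> = (\<Sum>a\<in>S. real_of_int (zorder g a) * jensen_weight R a)"
      using fin \<open>0 \<in> S\<close> by (simp add: sum.remove[of S 0])
    finally show ?thesis .
  qed
  moreover have "circle_mean R (\<lambda>z. Re (H z)) = Re (H 0)"
    by (rule circle_mean_Re_holomorphic[OF H(1)]) (use R e in auto)
  moreover have "norm (deriv H z) \<le> 2 * R / (R - norm z)\<^sup>2 * circle_mean R (\<lambda>z. \<bar>Re (H z)\<bar>)" if "norm z < R" for z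
    by (rule norm_deriv_le_circle_mean_Re[OF H(1)]) (use that e in auto)
  ultimately show ?thesis
    using H e h(3) by (intro that[of H "R + e"]) (auto simp flip: S_def)
qed

subsection \<open>Jensen's formula and pole orders\<close>

lemma jensen_formula:
  assumes g: "g meromorphic_on UNIV" "not_identically_zero g" and R: "R > 0" "regular_circle R g"
  shows "circle_mean R (\<lambda>z. ln (norm (g z))) =
    ln (norm (zor_poly g 0 0)) + (\<Sum>a\<in>divisor_set R g. real_of_int (zorder g a) * jensen_weight R a)"
  using log_factorization[OF g R] by metis

lemma pole_count_eq_sum:
  assumes "finite S" "{z \<in> cball 0 R. is_pole g z} \<subseteq> S" "r \<le> R"
  shows "real (pole_count r g) = (\<Sum>a\<in>S. if norm a \<le> r then real (pole_order g a) else 0)"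
proof -
  have "real (pole_count r g) = (\<Sum>a\<in>{z \<in> cball 0 r. is_pole g z}. if norm a \<le> r then real (pole_order g a) else 0)"
    by (simp add: pole_count_def pole_order_def)
  also have "\<dots> = (\<Sum>a\<in>S. if norm a \<le> r then real (pole_order g a) else 0)"
    using assms by (intro sum.mono_neutral_left) (auto simp: pole_order_def)
  finally show ?thesis .
qed

lemma integrated_count_eq_sum:
  assumes S: "finite S" "{z \<in> cball 0 r. is_pole g z} \<subseteq> S" "S \<subseteq> cball 0 r" and r: "r > 0"
  shows "integrated_count r g = (\<Sum>a\<in>S. real (pole_order g a) * jensen_weight r a)"
proof -
  have n0: "real (pole_count 0 g) = (\<Sum>a\<in>S. if a = 0 then real (pole_order g a) else 0)"
    using pole_count_eq_sum[OF S(1,2), of 0] r by simp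
  have "((\<lambda>t. \<Sum>a\<in>S. if a = 0 then 0 else real (pole_order g a) * (if t \<in> {norm a..r} then 1 / t else 0))
          has_integral (\<Sum>a\<in>S. if a = 0 then 0 else real (pole_order g a) * jensen_weight r a)) {0..r}"
  proof (intro has_integral_sum S(1))
    fix a assume a: "a \<in> S"
    show "((\<lambda>t. if a = 0 then 0 else real (pole_order g a) * (if t \<in> {norm a..r} then 1 / t else 0))
      has_integral (if a = 0 then 0 else real (pole_order g a) * jensen_weight r a)) {0..r}"
    proof (cases "a = 0")
      case False
      have ar: "norm a \<le> r" using a S(3) by auto
      have "((\<lambda>t. 1 / t) has_integral (ln r - ln (norm a))) {norm a..r}"
      proof (rule fundamental_theorem_of_calculus[OF ar])
        fix t assume "t \<in> {norm a..r}"
        moreover have "norm a > 0" using False by simp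
        ultimately have "t > 0" by (simp only: atLeastAtMost_iff) linarith
        thus "(ln has_vector_derivative 1 / t) (at t within {norm a..r})"
          by (auto intro!: derivative_eq_intros simp flip: has_real_derivative_iff_has_vector_derivative)
      qed
      also have "ln r - ln (norm a) = jensen_weight r a"
        using False r by (simp add: jensen_weight_def ln_div)
      finally have "((\<lambda>t. if t \<in> {norm a..r} then 1 / t else 0) has_integral jensen_weight r a) {0..r}"
        by (subst has_integral_restrict) auto
      from has_integral_mult_right[OF this, of "real (pole_order g a)"] show ?thesis using False by simp
    qed simp
  qed
  also have "?this \<longleftrightarrow> ((\<lambda>t. (real (pole_count t g) - real (pole_count 0 g)) / t)
          has_integral (\<Sum>a\<in>S. if a = 0 then 0 else real (pole_order g a) * jensen_weight r a)) {0..r}"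
  proof (intro has_integral_cong)
    fix t assume t: "t \<in> {0..r}"
    have "(real (pole_count t g) - real (pole_count 0 g)) / t =
       (\<Sum>a\<in>S. (if norm a \<le> t then real (pole_order g a) else 0) - (if a = 0 then real (pole_order g a) else 0)) / t"
      using pole_count_eq_sum[OF S(1,2), of t] n0 t by (simp add: sum_subtractf)
    also have "\<dots> = (\<Sum>a\<in>S. if a = 0 then 0 else real (pole_order g a) * (if t \<in> {norm a..r} then 1 / t else 0))"
      unfolding sum_divide_distrib using t by (intro sum.cong) auto
    finally show "(\<Sum>a\<in>S. if a = 0 then 0 else real (pole_order g a) * (if t \<in> {norm a..r} then 1 / t else 0)) =
       (real (pole_count t g) - real (pole_count 0 g)) / t" by simp
  qed
  finally have "integrated_count r g = (\<Sum>a\<in>S. if a = 0 then 0 else real (pole_order g a) * jensen_weight r a)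
      + (\<Sum>a\<in>S. if a = 0 then real (pole_order g a) * jensen_weight r a else 0)"
    by (simp add: integrated_count_def integral_unique n0 sum_distrib_right jensen_weight_def if_distrib if_distribR cong: if_cong)
  also have "\<dots> = (\<Sum>a\<in>S. real (pole_order g a) * jensen_weight r a)"
    unfolding sum.distrib[symmetric] by (intro sum.cong) auto
  finally show ?thesis .
qed

lemma jensen_integrated_count:
  assumes g: "g meromorphic_on UNIV" "not_identically_zero g" and R: "R > 0" "regular_circle R g"
  shows "circle_mean R (\<lambda>z. ln (norm (g z))) =
    ln (norm (zor_poly g 0 0)) + integrated_count R (\<lambda>z. 1 / g z) - integrated_count R g"
proof -
  define S where "S = divisor_set R g"
  have S: "finite S" "S \<subseteq> cball 0 R" using finite_divisor_set[OF g] R(1) by (auto simp: S_def divisor_set_def)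
  have "integrated_count R (\<lambda>z. 1 / g z) = (\<Sum>a\<in>S. real (pole_order (\<lambda>z. 1 / g z) a) * jensen_weight R a)"
    by (rule integrated_count_eq_sum) (use S R is_pole_imp_in_divisor_set[OF g(1)] in \<open>auto simp: S_def\<close>)
  moreover have "integrated_count R g = (\<Sum>a\<in>S. real (pole_order g a) * jensen_weight R a)"
    by (rule integrated_count_eq_sum) (use S R is_pole_imp_in_divisor_set[OF g(1)] in \<open>auto simp: S_def\<close>)
  moreover have "real_of_int (zorder g a) * jensen_weight R a =
      real (pole_order (\<lambda>z. 1 / g z) a) * jensen_weight R a - real (pole_order g a) * jensen_weight R a" for a
    using zorder_eq_pole_order_diff(1)[OF meromorphic_on_UNIV_at[OF g(1)] eventually_nonzero_at[OF g], of a]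
    by (simp add: left_diff_distrib)
  ultimately show ?thesis
    using jensen_formula[OF g R] by (simp add: S_def sum_subtractf)
qed


lemma finite_poles:
  assumes "g meromorphic_on UNIV"
  shows "finite {z \<in> cball 0 r. is_pole g z}"
proof -
  have "{z. is_pole g z} sparse_in UNIV"
    using meromorphic_on_imp_not_pole_cosparse[OF assms] by (simp add: eventually_cosparse)
  hence "{z. is_pole g z} sparse_in cball 0 r" using sparse_in_subset by blast
  hence "finite (cball 0 r \<inter> {z. is_pole g z})"
    by (intro sparse_in_compact_finite) auto
  thus ?thesis by (simp add: Int_def)
qed

lemma integrated_count_nonneg:
  assumes "g meromorphic_on UNIV" "r \<ge> 1"
  shows "integrated_count r g \<ge> 0"
proof -
  have "integrated_count r g = (\<Sum>a\<in>{z \<in> cball 0 r. is_pole g z}. real (pole_order g a) * jensen_weight r a)"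
    by (rule integrated_count_eq_sum) (use assms finite_poles in auto)
  thus ?thesis using assms(2) by (auto intro!: sum_nonneg mult_nonneg_nonneg jensen_weight_nonneg)
qed

text \<open>N is a sum of pole orders with nonnegative weights, so a pointwise inequality between
  pole orders suffices once all sums run over the union of the pole sets.\<close>

lemma integrated_count_le_sum:
  assumes g: "g meromorphic_on UNIV" and G: "finite I" "\<And>i. i \<in> I \<Longrightarrow> G i meromorphic_on UNIV"
    and le: "\<And>a. pole_order g a \<le> (\<Sum>i\<in>I. pole_order (G i) a)" and r: "r \<ge> 1"
  shows "integrated_count r g \<le> (\<Sum>i\<in>I. integrated_count r (G i))"
proof -
  define S where "S = {z \<in> cball 0 r. is_pole g z} \<union> (\<Union>i\<in>I. {z \<in> cball 0 r. is_pole (G i) z})"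
  have S: "finite S" "S \<subseteq> cball 0 r" using finite_poles g G by (auto simp: S_def)
  have "integrated_count r g = (\<Sum>a\<in>S. real (pole_order g a) * jensen_weight r a)"
    by (rule integrated_count_eq_sum) (use S r in \<open>auto simp: S_def\<close>)
  also have "\<dots> \<le> (\<Sum>a\<in>S. real (\<Sum>i\<in>I. pole_order (G i) a) * jensen_weight r a)"
    by (intro sum_mono mult_right_mono of_nat_mono le jensen_weight_nonneg) (use S r in auto)
  also have "\<dots> = (\<Sum>i\<in>I. \<Sum>a\<in>S. real (pole_order (G i) a) * jensen_weight r a)"
    by (subst sum.swap) (simp add: sum_distrib_right)
  also have "\<dots> = (\<Sum>i\<in>I. integrated_count r (G i))"
    by (intro sum.cong refl integrated_count_eq_sum[symmetric]) (use S r in \<open>auto simp: S_def\<close>)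
  finally show ?thesis .
qed

lemma integrated_count_le_add:
  assumes "g meromorphic_on UNIV" "g1 meromorphic_on UNIV" "g2 meromorphic_on UNIV"
    and "\<And>a. pole_order g a \<le> pole_order g1 a + pole_order g2 a" "r \<ge> 1"
  shows "integrated_count r g \<le> integrated_count r g1 + integrated_count r g2"
  using integrated_count_le_sum[of g "UNIV :: bool set" "\<lambda>b. if b then g1 else g2" r] assms
  by (simp add: UNIV_bool add.commute)

text \<open>Every weight grows with the radius and new poles add nonnegative terms. This later
  carries a bound on N across exceptional radii.\<close>

lemma integrated_count_mono:
  assumes g: "g meromorphic_on UNIV" and r: "1 \<le> r" "r \<le> r'"
  shows "integrated_count r g \<le> integrated_count r' g"
proof -
  define S where "S = {z \<in> cball 0 r. is_pole g z}"
  define S' where "S' = {z \<in> cball 0 r'. is_pole g z}"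
  have S: "finite S" "finite S'" "S \<subseteq> S'" using finite_poles g r by (auto simp: S_def S'_def)
  have "integrated_count r g = (\<Sum>a\<in>S. real (pole_order g a) * jensen_weight r a)"
    by (rule integrated_count_eq_sum) (use S r in \<open>auto simp: S_def\<close>)
  also have "\<dots> \<le> (\<Sum>a\<in>S. real (pole_order g a) * jensen_weight r' a)"
    by (intro sum_mono mult_left_mono) (use r in \<open>auto simp: jensen_weight_def divide_right_mono\<close>)
  also have "\<dots> \<le> (\<Sum>a\<in>S'. real (pole_order g a) * jensen_weight r' a)"
    by (intro sum_mono2 S mult_nonneg_nonneg jensen_weight_nonneg) (use r in \<open>auto simp: S'_def\<close>)
  also have "\<dots> = integrated_count r' g"
    by (rule integrated_count_eq_sum[symmetric]) (use S r in \<open>auto simp: S'_def\<close>)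
  finally show ?thesis .
qed

text \<open>At radius R' \<ge> 2 R every point of |a| \<le> R has weight at least log 2, so the
  plain count in the smaller disc is controlled by N on the larger one.\<close>

lemma sum_zorder_le_integrated_count:
  assumes g: "g meromorphic_on UNIV" "not_identically_zero g" and R: "R \<ge> 1" "2 * R \<le> R'"
  shows "(\<Sum>a\<in>divisor_set R g. \<bar>real_of_int (zorder g a)\<bar>) * ln 2 \<le>
           integrated_count R' g + integrated_count R' (\<lambda>z. 1 / g z)"
proof -
  define S where "S = divisor_set R g"
  define S' where "S' = divisor_set R' g"
  have S: "finite S" "finite S'" "S \<subseteq> S'" "S' \<subseteq> cball 0 R'" "S \<subseteq> cball 0 R"
    using finite_divisor_set[OF g] R by (auto simp: S_def S'_def divisor_set_def)
  have "(\<Sum>a\<in>S. \<bar>real_of_int (zorder g a)\<bar>) * ln 2 = (\<Sum>a\<in>S. \<bar>real_of_int (zorder g a)\<bar> * ln 2)"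
    by (rule sum_distrib_right)
  also have "\<dots> \<le> (\<Sum>a\<in>S. \<bar>real_of_int (zorder g a)\<bar> * jensen_weight R' a)"
  proof (intro sum_mono mult_left_mono)
    fix a assume a: "a \<in> S"
    show "ln 2 \<le> jensen_weight R' a"
    proof (cases "a = 0")
      case False
      have "2 * norm a \<le> R'" using a S(5) R by auto
      hence "2 \<le> R' / norm a" using False by (simp add: le_divide_eq)
      thus ?thesis using False by (simp add: jensen_weight_def)
    qed (use R in \<open>auto simp: jensen_weight_def\<close>)
  qed auto
  also have "\<dots> \<le> (\<Sum>a\<in>S'. \<bar>real_of_int (zorder g a)\<bar> * jensen_weight R' a)"
    by (intro sum_mono2 S mult_nonneg_nonneg jensen_weight_nonneg) (use R S in auto)
  also have "\<dots> = (\<Sum>a\<in>S'. real (pole_order g a) * jensen_weight R' a) + (\<Sum>a\<in>S'. real (pole_order (\<lambda>z. 1 / g z) a) * jensen_weight R' a)"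
  proof -
    have "\<bar>real_of_int (zorder g a)\<bar> = real (pole_order g a) + real (pole_order (\<lambda>z. 1 / g z) a)" for a
      using zorder_eq_pole_order_diff(2)[OF meromorphic_on_UNIV_at[OF g(1)] eventually_nonzero_at[OF g], of a] by linarith
    thus ?thesis by (simp add: sum.distrib[symmetric] distrib_right)
  qed
  also have "(\<Sum>a\<in>S'. real (pole_order g a) * jensen_weight R' a) = integrated_count R' g"
    by (rule integrated_count_eq_sum[symmetric]) (use S R is_pole_imp_in_divisor_set[OF g(1)] in \<open>auto simp: S'_def\<close>)
  also have "(\<Sum>a\<in>S'. real (pole_order (\<lambda>z. 1 / g z) a) * jensen_weight R' a) = integrated_count R' (\<lambda>z. 1 / g z)"
    by (rule integrated_count_eq_sum[symmetric]) (use S R is_pole_imp_in_divisor_set[OF g(1)] in \<open>auto simp: S'_def\<close>)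
  finally show ?thesis by (simp add: S_def)
qed

section \<open>Pole orders of sums, products and derivatives\<close>

lemma pole_order_cong:
  assumes "\<forall>\<^sub>F z in at a. f z = g z"
  shows "pole_order f a = pole_order g a"
  unfolding pole_order_def using is_pole_cong[OF assms refl] zorder_cong[OF assms refl] by simp

lemma pole_order_eq_0_iff:
  assumes "g meromorphic_on {a}"
  shows "pole_order g a = 0 \<longleftrightarrow> \<not> is_pole g a"
proof (cases "is_pole g a")
  case True
  hence "zorder g a < 0" using isolated_pole_imp_neg_zorder assms by (auto simp: meromorphic_at_iff)
  thus ?thesis using True by (simp add: pole_order_def)
qed (simp add: pole_order_def)

lemma pole_order_analytic: "g analytic_on {a} \<Longrightarrow> pole_order g a = 0"
  using analytic_at_imp_no_pole[of g a] by (simp add: pole_order_def)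

lemma not_is_pole_iff_bigo:
  assumes "g meromorphic_on {a}"
  shows "\<not> is_pole g a \<longleftrightarrow> g \<in> O[at a](\<lambda>_. 1)"
proof
  assume "\<not> is_pole g a"
  then obtain c where "g \<midarrow>a\<rightarrow> c" using assms by (auto simp: meromorphic_at_iff not_essential_def)
  thus "g \<in> O[at a](\<lambda>_. 1)" by (intro bigoI_tendsto[where c = c]) auto
next
  assume "g \<in> O[at a](\<lambda>_. 1)"
  from landau_o.bigE[OF this] obtain C where C: "\<forall>\<^sub>F z in at a. norm (g z) \<le> C"
    by (metis mult.right_neutral norm_one)
  show "\<not> is_pole g a"
  proof
    assume "is_pole g a"
    hence "filterlim (\<lambda>z. norm (g z)) at_top (at a)"
      unfolding is_pole_def by (rule filterlim_at_infinity_imp_norm_at_top)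
    hence "\<forall>\<^sub>F z in at a. norm (g z) \<ge> C + 1" by (simp add: filterlim_at_top)
    with C have "\<forall>\<^sub>F z in at a. False" by eventually_elim auto
    thus False by simp
  qed
qed

text \<open>Boundedness of (z - a)^k g(z) describes the pole order even if \<open>g\<close> vanishes
  near \<open>a\<close>, and passes to sums and products; cancellations then need no case
  distinction.\<close>

lemma pole_order_le_iff:
  assumes g: "g meromorphic_on {a}"
  shows "pole_order g a \<le> k \<longleftrightarrow> (\<lambda>z. (z - a) ^ k * g z) \<in> O[at a](\<lambda>_. 1)"
proof -
  have mero: "(\<lambda>z. (z - a) ^ k * g z) meromorphic_on {a}" by (intro meromorphic_intros g)
  have iff: "(\<lambda>z. (z - a) ^ k * g z) \<in> O[at a](\<lambda>_. 1) \<longleftrightarrow> pole_order (\<lambda>z. (z - a) ^ k * g z) a = 0"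
    using not_is_pole_iff_bigo[OF mero] pole_order_eq_0_iff[OF mero] by simp
  show ?thesis
  proof (cases "\<exists>\<^sub>F z in at a. g z = 0")
    case True
    hence ev: "\<forall>\<^sub>F z in at a. g z = 0"
      using not_essential_frequently_0_imp_eventually_0 g by (auto simp: meromorphic_at_iff)
    have "pole_order g a = pole_order (\<lambda>_. 0) a" by (rule pole_order_cong) (use ev in simp)
    moreover have "pole_order (\<lambda>z. (z - a) ^ k * g z) a = pole_order (\<lambda>_. 0) a"
      by (rule pole_order_cong) (use ev in \<open>auto elim: eventually_mono\<close>)
    ultimately show ?thesis unfolding iff by (simp add: pole_order_analytic)
  next
    case False
    hence nz: "\<forall>\<^sub>F z in at a. g z \<noteq> 0" by (simp add: frequently_def)
    have "\<forall>\<^sub>F z in at a. z \<noteq> a" using eventually_neq_at_within[of a a UNIV] by simp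
    hence nz': "\<forall>\<^sub>F z in at a. (z - a) ^ k \<noteq> 0" by eventually_elim simp
    have "zorder (\<lambda>z. (z - a) ^ k * g z) a = zorder (\<lambda>z. (z - a) ^ k) a + zorder g a"
      by (intro zorder_mult meromorphic_intros g eventually_frequently nz nz') auto
    also have "zorder (\<lambda>z. (z - a) ^ k) a = int k"
      by (rule zorder_eqI[of UNIV _ "\<lambda>_. 1"]) auto
    finally have "zorder (\<lambda>z. (z - a) ^ k * g z) a = int k + zorder g a" .
    moreover have "\<forall>\<^sub>F z in at a. (z - a) ^ k * g z \<noteq> 0" using nz nz' by eventually_elim auto
    ultimately show ?thesis unfolding iff
      using pole_order_eq[OF g nz] pole_order_eq[OF mero] by auto
  qed
qed

lemma pole_order_mult_le:
  assumes "f meromorphic_on {a}" "g meromorphic_on {a}"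
  shows "pole_order (\<lambda>z. f z * g z) a \<le> pole_order f a + pole_order g a"
proof -
  have "(\<lambda>z. (z - a) ^ pole_order f a * f z * ((z - a) ^ pole_order g a * g z)) \<in> O[at a](\<lambda>_. 1 * 1)"
    by (intro landau_o.big.mult) (use pole_order_le_iff[OF assms(1)] pole_order_le_iff[OF assms(2)] in auto)
  thus ?thesis by (subst pole_order_le_iff) (auto intro!: meromorphic_intros assms simp: power_add mult_ac)
qed

lemma pole_order_add_le:
  assumes "f meromorphic_on {a}" "g meromorphic_on {a}"
  shows "pole_order (\<lambda>z. f z + g z) a \<le> pole_order f a + pole_order g a"
proof -
  have 1: "(\<lambda>z. (z - a) ^ k) \<in> O[at a](\<lambda>_. 1)" for k
    by (intro bigoI_tendsto[where c = "(a - a) ^ k"]) (auto intro!: tendsto_eq_intros)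
  have "(\<lambda>z. (z - a) ^ pole_order g a * ((z - a) ^ pole_order f a * f z)) \<in> O[at a](\<lambda>_. 1 * 1)"
    by (intro landau_o.big.mult 1) (use pole_order_le_iff[OF assms(1)] in auto)
  moreover have "(\<lambda>z. (z - a) ^ pole_order f a * ((z - a) ^ pole_order g a * g z)) \<in> O[at a](\<lambda>_. 1 * 1)"
    by (intro landau_o.big.mult 1) (use pole_order_le_iff[OF assms(2)] in auto)
  ultimately have "(\<lambda>z. (z - a) ^ pole_order g a * ((z - a) ^ pole_order f a * f z) +
      (z - a) ^ pole_order f a * ((z - a) ^ pole_order g a * g z)) \<in> O[at a](\<lambda>_. 1)"
    by (intro sum_in_bigo) auto
  thus ?thesis by (subst pole_order_le_iff) (auto intro!: meromorphic_intros assms simp: power_add algebra_simps)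
qed

lemma pole_order_uminus: "pole_order (\<lambda>z. - g z) a = pole_order g a"
  by (simp add: pole_order_def)

text \<open>A pole of order p \<ge> 1 becomes one of order p + 1 \<le> 2 p. In this form no separate
  count of distinct poles is needed.\<close>

lemma pole_order_deriv_le:
  assumes g: "g meromorphic_on {a}"
  shows "pole_order (deriv g) a \<le> 2 * pole_order g a"
proof (cases "is_pole g a")
  case False
  thus ?thesis using is_pole_deriv_iff[OF g] by (simp add: pole_order_def)
next
  case True
  have z: "zorder g a < 0" using isolated_pole_imp_neg_zorder[OF _ True] g by (auto simp: meromorphic_at_iff)
  have "zorder (deriv g) a = zorder g a - 1"
    by (rule zorder_deriv_minus_1)
       (use g z True non_zero_neighbour_pole in \<open>auto simp: meromorphic_at_iff intro!: eventually_frequently\<close>)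
  moreover have "nat (1 - zorder g a) \<le> 2 * nat (- zorder g a)" using z by linarith
  ultimately show ?thesis using z True by (simp add: pole_order_def)
qed

text \<open>A logarithmic derivative has at most simple poles, and only at zeros and poles of
  \<open>g\<close>, where the right-hand side is at least 1.\<close>

lemma pole_order_logderiv_le:
  assumes g: "g meromorphic_on {a}" "\<forall>\<^sub>F z in at a. g z \<noteq> 0"
  shows "pole_order (\<lambda>z. deriv g z / g z) a \<le> pole_order g a + pole_order (\<lambda>z. 1 / g z) a"
proof (cases "zorder g a = 0")
  case True
  have 0: "pole_order g a = 0" "pole_order (\<lambda>z. 1 / g z) a = 0"
    using True pole_order_eq[OF g] pole_order_inverse_eq[OF g] by auto
  have "pole_order (\<lambda>z. deriv g z * (1 / g z)) a \<le> pole_order (deriv g) a + pole_order (\<lambda>z. 1 / g z) a"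
    by (intro pole_order_mult_le meromorphic_intros g)
  thus ?thesis using pole_order_deriv_le[OF g(1)] 0 by simp
next
  case False
  have mero: "(\<lambda>z. (z - a) ^ 1 * (deriv g z / g z)) meromorphic_on {a}" by (intro meromorphic_intros g)
  have d: "zorder (deriv g) a = zorder g a - 1"
    by (rule zorder_deriv_minus_1)
       (use g False in \<open>auto simp: meromorphic_at_iff intro!: eventually_frequently\<close>)
  have "pole_order (\<lambda>z. deriv g z / g z) a \<le> 1"
  proof (cases "\<exists>\<^sub>F z in at a. deriv g z = 0")
    case True
    have "(deriv g) meromorphic_on {a}" by (intro meromorphic_intros g)
    hence ev: "\<forall>\<^sub>F z in at a. deriv g z = 0"
      using not_essential_frequently_0_imp_eventually_0 True by (auto simp: meromorphic_at_iff)
    have "pole_order (\<lambda>z. deriv g z / g z) a = pole_order (\<lambda>_. 0) a" by (rule pole_order_cong) (use ev in \<open>auto elim: eventually_mono\<close>)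
    thus ?thesis by (simp add: pole_order_analytic)
  next
    case False
    hence nz: "\<forall>\<^sub>F z in at a. deriv g z \<noteq> 0" by (simp add: frequently_def)
    have "zorder (\<lambda>z. deriv g z / g z) a = zorder (deriv g) a - zorder g a"
      by (intro zorder_divide meromorphic_intros g eventually_frequently nz) auto
    moreover have "pole_order (\<lambda>z. deriv g z / g z) a = nat (- zorder (\<lambda>z. deriv g z / g z) a)"
      by (intro pole_order_eq meromorphic_intros g eventually_elim2[OF nz g(2)]) auto
    ultimately show ?thesis using d by simp
  qed
  moreover have "1 \<le> pole_order g a + pole_order (\<lambda>z. 1 / g z) a"
    using False pole_order_eq[OF g] pole_order_inverse_eq[OF g] by linarith
  ultimately show ?thesis by linarith
qed

subsection \<open>The first main theorem and pointwise estimates\<close>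

lemma log_plus_nonneg: "log_plus x \<ge> 0"
  by (simp add: log_plus_def)

lemma log_plus_mono: "x \<le> y \<Longrightarrow> log_plus x \<le> log_plus y"
  by (simp add: log_plus_def)

lemma log_plus_le: "x \<le> exp y \<Longrightarrow> y \<ge> 0 \<Longrightarrow> log_plus x \<le> y"
  using ln_mono[of "max 1 x" "exp y"] by (simp add: log_plus_def)

lemma le_exp_log_plus: "x \<le> exp (log_plus x)"
  by (simp add: log_plus_def)

lemma log_plus_mult_le:
  assumes "x \<ge> 0" "y \<ge> 0"
  shows "log_plus (x * y) \<le> log_plus x + log_plus y"
  by (rule log_plus_le)
     (use assms in \<open>auto simp: exp_add log_plus_nonneg intro!: mult_mono le_exp_log_plus add_nonneg_nonneg\<close>)

lemma log_plus_diff_inverse: "x > 0 \<Longrightarrow> log_plus x - log_plus (1 / x) = ln x"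
  by (auto simp: log_plus_def max_def ln_div)

lemma log_plus_add_inverse: "x > 0 \<Longrightarrow> log_plus x + log_plus (1 / x) = \<bar>ln x\<bar>"
  by (auto simp: log_plus_def max_def ln_div)

lemma continuous_on_log_plus [continuous_intros]:
  "continuous_on A u \<Longrightarrow> continuous_on A (\<lambda>z. log_plus (u z))"
  unfolding log_plus_def by (intro continuous_intros) auto

lemma regular_circle_continuous:
  assumes "regular_circle r g"
  shows "continuous_on (sphere 0 r) g"
proof -
  have "g analytic_on sphere 0 r"
    by (subst analytic_on_analytic_at) (use assms in \<open>auto simp: regular_circle_def\<close>)
  thus ?thesis using analytic_imp_holomorphic holomorphic_on_imp_continuous_on by blast
qed

lemma regular_circle_continuous_inverse:
  assumes "regular_circle r g"
  shows "continuous_on (sphere 0 r) (\<lambda>z. 1 / g z)"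
  by (intro continuous_intros regular_circle_continuous[OF assms]) (use assms in \<open>auto simp: regular_circle_def\<close>)

lemma proximity_nonneg:
  assumes "continuous_on (sphere 0 r) g" "r \<ge> 0"
  shows "proximity r g \<ge> 0"
  unfolding proximity_eq_circle_mean
  by (intro circle_mean_nonneg continuous_intros assms log_plus_nonneg)

lemma circle_mean_ln_norm:
  assumes "regular_circle r g" "r \<ge> 0"
  shows "circle_mean r (\<lambda>z. ln (norm (g z))) = proximity r g - proximity r (\<lambda>z. 1 / g z)"
    and "circle_mean r (\<lambda>z. \<bar>ln (norm (g z))\<bar>) = proximity r g + proximity r (\<lambda>z. 1 / g z)"
proof -
  note c = regular_circle_continuous[OF assms(1)] regular_circle_continuous_inverse[OF assms(1)]
  have nz: "norm (g z) > 0" if "norm z = r" for z using assms that by (auto simp: regular_circle_def)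
  have "proximity r g - proximity r (\<lambda>z. 1 / g z) =
      circle_mean r (\<lambda>z. log_plus (norm (g z)) - log_plus (norm (1 / g z)))"
    unfolding proximity_eq_circle_mean by (intro circle_mean_diff[symmetric] continuous_intros c assms)
  also have "\<dots> = circle_mean r (\<lambda>z. ln (norm (g z)))"
    using assms(2) by (intro circle_mean_cong) (use nz log_plus_diff_inverse in \<open>auto simp: norm_divide\<close>)
  finally show "circle_mean r (\<lambda>z. ln (norm (g z))) = proximity r g - proximity r (\<lambda>z. 1 / g z)" ..
  have "proximity r g + proximity r (\<lambda>z. 1 / g z) =
      circle_mean r (\<lambda>z. log_plus (norm (g z)) + log_plus (norm (1 / g z)))"
    unfolding proximity_eq_circle_mean by (intro circle_mean_add[symmetric] continuous_intros c assms)
  also have "\<dots> = circle_mean r (\<lambda>z. \<bar>ln (norm (g z))\<bar>)"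
    using assms(2) by (intro circle_mean_cong) (use nz log_plus_add_inverse in \<open>auto simp: norm_divide\<close>)
  finally show "circle_mean r (\<lambda>z. \<bar>ln (norm (g z))\<bar>) = proximity r g + proximity r (\<lambda>z. 1 / g z)" ..
qed

text \<open>Jensen's formula together with log x = log+ x - log+ (1/x). On a regular circle this is
  an exact identity; the constant is the leading Laurent coefficient of \<open>g\<close> at
  0.\<close>

theorem first_main_theorem:
  assumes g: "g meromorphic_on UNIV" "not_identically_zero g" and R: "R > 0" "regular_circle R g"
  shows "characteristic R (\<lambda>z. 1 / g z) = characteristic R g - ln (norm (zor_poly g 0 0))"
  using jensen_integrated_count[OF g R] circle_mean_ln_norm(1)[OF R(2)] R(1) by (simp add: characteristic_def)

text \<open>The mean of |log |g|| is m(R, g) + m(R, 1/g), at most T(R, g) + T(R, 1/g), and the two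
  characteristics differ by a constant.\<close>

lemma circle_mean_abs_ln_le:
  assumes g: "g meromorphic_on UNIV" "not_identically_zero g" and R: "R \<ge> 1" "regular_circle R g"
  shows "circle_mean R (\<lambda>z. \<bar>ln (norm (g z))\<bar>) \<le> 2 * characteristic R g + \<bar>ln (norm (zor_poly g 0 0))\<bar>"
proof -
  have "(\<lambda>z. 1 / g z) meromorphic_on UNIV" by (intro meromorphic_intros g)
  thus ?thesis
    using first_main_theorem[OF g _ R(2)] circle_mean_ln_norm(2)[OF R(2)] R(1)
      integrated_count_nonneg[of g R] integrated_count_nonneg[of "\<lambda>z. 1 / g z" R] g(1)
    by (simp add: characteristic_def)
qed

lemma sum_zorder_le_characteristic:
  assumes g: "g meromorphic_on UNIV" "not_identically_zero g" and R: "R \<ge> 1" "2 * R \<le> R'" "regular_circle R' g"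
  shows "(\<Sum>a\<in>divisor_set R g. \<bar>real_of_int (zorder g a)\<bar>) * ln 2 \<le>
           2 * characteristic R' g + \<bar>ln (norm (zor_poly g 0 0))\<bar>"
  using sum_zorder_le_integrated_count[OF g R(1,2)] first_main_theorem[OF g _ R(3)] R
    proximity_nonneg[OF regular_circle_continuous[OF R(3)]]
    proximity_nonneg[OF regular_circle_continuous_inverse[OF R(3)]]
  by (simp add: characteristic_def)

text \<open>Bounds \<open>|(log h)'|\<close> on \<open>|z| \<le> s\<close>, where \<open>h\<close> is the zero-free factor of \<open>g\<close> on the disc of radius \<open>R\<close>.\<close>
definition schwarz_bound :: "real \<Rightarrow> real \<Rightarrow> (complex \<Rightarrow> complex) \<Rightarrow> real" where
  "schwarz_bound R s g = 2 * R / (R - s)\<^sup>2 * circle_mean R (\<lambda>z. \<bar>ln (norm (g z))\<bar>)"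

text \<open>A form for pointwise use: points of order 0 are dropped, so a point where
  \<open>g\<close> is analytic and nonzero never belongs to \<open>S\<close>, and the bound on H' is
  uniform for |z| \<le> s.\<close>

lemma log_factorization':
  assumes g: "g meromorphic_on UNIV" "not_identically_zero g"
    and R: "0 \<le> s" "s < R" and circ: "regular_circle R g"
  obtains H S where "H holomorphic_on ball 0 R" "S = {a \<in> divisor_set R g. zorder g a \<noteq> 0}" "finite S"
    "\<And>a. a \<in> S \<Longrightarrow> norm a < R"
    "\<And>z. norm z \<le> R \<Longrightarrow> g analytic_on {z} \<Longrightarrow> g z \<noteq> 0 \<Longrightarrow> z \<notin> S \<and>
        g z = exp (H z) * (\<Prod>a\<in>S. blaschke R a z powi zorder g a)"
    "\<And>z. norm z \<le> s \<Longrightarrow> norm (deriv H z) \<le> schwarz_bound R s g"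
    "Re (H 0) = circle_mean R (\<lambda>z. ln (norm (g z)))"
proof -
  have R0: "R > 0" using R by simp
  obtain H R' where H: "H holomorphic_on ball 0 R'" "R < R'"
    "\<And>z. norm z \<le> R \<Longrightarrow> g analytic_on {z} \<Longrightarrow> g z \<noteq> 0 \<Longrightarrow>
        g z = exp (H z) * (\<Prod>a\<in>divisor_set R g. blaschke R a z powi zorder g a)"
    "\<And>z. norm z < R \<Longrightarrow> norm (deriv H z) \<le>
        2 * R / (R - norm z)\<^sup>2 * circle_mean R (\<lambda>z. \<bar>ln (norm (g z))\<bar>)"
    "Re (H 0) = circle_mean R (\<lambda>z. ln (norm (g z)))"
    by (rule log_factorization[OF g R0 circ]) (rule that)
  define S where "S = {a \<in> divisor_set R g. zorder g a \<noteq> 0}"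
  have fin: "finite (divisor_set R g)" by (rule finite_divisor_set[OF g])
  have S: "norm a < R" if "a \<in> S" for a
    using that circ R0 by (auto simp: S_def regular_circle_def divisor_set_def less_le)
  have "circle_mean R (\<lambda>z. \<bar>ln (norm (g z))\<bar>) \<ge> 0"
    using R0 circ regular_circle_continuous[OF circ]
    by (intro circle_mean_nonneg continuous_intros) (auto simp: regular_circle_def)
  hence 1: "norm (deriv H z) \<le> schwarz_bound R s g" if "norm z \<le> s" for z
    unfolding schwarz_bound_def
    by (intro order_trans[OF H(4)] mult_right_mono divide_left_mono power_mono)
       (use that R R0 in auto)
  have 2: "(\<Prod>a\<in>divisor_set R g. blaschke R a z powi zorder g a) = (\<Prod>a\<in>S. blaschke R a z powi zorder g a)" for z
    by (intro prod.mono_neutral_right fin) (auto simp: S_def)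
  have 3: "z \<notin> S" if "g analytic_on {z}" "g z \<noteq> 0" for z
    using zorder_eq_0I[OF that] by (auto simp: S_def)
  show ?thesis
  proof (rule that[of H S])
    show "H holomorphic_on ball 0 R" using H(1,2) by (auto intro: holomorphic_on_subset)
    show "finite S" using fin by (simp add: S_def)
    show "z \<notin> S \<and> g z = exp (H z) * (\<Prod>a\<in>S. blaschke R a z powi zorder g a)"
      if "norm z \<le> R" "g analytic_on {z}" "g z \<noteq> 0" for z
      using H(3)[OF that] 3[OF that(2,3)] unfolding 2 by blast
  qed (fact S_def S 1 H(5))+
qed

lemma log_factor_diff_le:
  assumes "H holomorphic_on ball 0 R" "s < R" "\<And>z. norm z \<le> s \<Longrightarrow> norm (deriv H z) \<le> B"
    and "norm z \<le> s" "norm w \<le> s"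
  shows "\<bar>Re (H w) - Re (H z)\<bar> \<le> B * norm (w - z)"
proof -
  have "norm (H w - H z) \<le> B * norm (w - z)"
  proof (rule field_differentiable_bound[of "cball 0 s"])
    fix u assume u: "u \<in> cball (0::complex) s"
    show "(H has_field_derivative deriv H u) (at u within cball 0 s)"
    proof (rule has_field_derivative_at_within)
      show "(H has_field_derivative deriv H u) (at u)"
        by (rule holomorphic_derivI[OF assms(1)]) (use u assms(2) in simp_all)
    qed
    show "norm (deriv H u) \<le> B" using assms(3) u by simp
  qed (use assms(4,5) in simp_all)
  thus ?thesis using abs_Re_le_cmod[of "H w - H z"] by simp
qed

text \<open>Logarithmic differentiation of exp H times the Blaschke product: the exponential
  contributes H', each factor its order times its own logarithmic derivative.\<close>

lemma norm_logderiv_le: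
  assumes g: "g meromorphic_on UNIV" "not_identically_zero g"
    and R: "s < R" and circ: "regular_circle R g"
    and z: "norm z \<le> s" "g analytic_on {z}" "g z \<noteq> 0"
  shows "norm (deriv g z / g z) \<le> schwarz_bound R s g +
    (\<Sum>a\<in>divisor_set R g. \<bar>real_of_int (zorder g a)\<bar> * (1 / norm (z - a) + 1 / (R - s)))"
proof -
  have s: "s \<ge> 0" using z(1) norm_ge_zero order_trans by blast
  obtain H S where H: "H holomorphic_on ball 0 R" "S = {a \<in> divisor_set R g. zorder g a \<noteq> 0}" "finite S"
    "\<And>a. a \<in> S \<Longrightarrow> norm a < R"
    "\<And>z. norm z \<le> R \<Longrightarrow> g analytic_on {z} \<Longrightarrow> g z \<noteq> 0 \<Longrightarrow> z \<notin> S \<and>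
        g z = exp (H z) * (\<Prod>a\<in>S. blaschke R a z powi zorder g a)"
    "\<And>z. norm z \<le> s \<Longrightarrow> norm (deriv H z) \<le> schwarz_bound R s g"
    "Re (H 0) = circle_mean R (\<lambda>z. ln (norm (g z)))"
    by (rule log_factorization'[OF g s R circ]) (rule that)
  define P where "P = (\<lambda>z. exp (H z) * (\<Prod>a\<in>S. blaschke R a z powi zorder g a))"
  have zS: "z \<notin> S" "g z = P z" using H(5)[of z] z R by (auto simp: P_def)
  have zR: "norm z < R" using z R by simp
  \<comment> \<open>The factorization holds only at good points, so it is extended to a
    neighbourhood of \<open>z\<close> before differentiating.\<close>
  have "\<forall>\<^sub>F w in nhds z. g w = P w"
  proof -
    obtain U where U: "open U" "z \<in> U" "g holomorphic_on U" using z(2) by (auto simp: analytic_at)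
    have "\<forall>\<^sub>F w in nhds z. w \<in> U" using U by (simp add: eventually_nhds_in_open)
    moreover have "\<forall>\<^sub>F w in nhds z. w \<in> ball 0 R" using zR by (intro eventually_nhds_in_open) auto
    moreover have "\<forall>\<^sub>F w in nhds z. g w \<noteq> 0"
      using z analytic_at_imp_isCont[OF z(2)] by (intro tendsto_imp_eventually_ne) (auto simp: continuous_at tendsto_at_iff_tendsto_nhds)
    ultimately show ?thesis
    proof eventually_elim
      case (elim w)
      hence "g analytic_on {w}" using U analytic_at by blast
      thus ?case using H(5)[of w] elim by (auto simp: P_def)
    qed
  qed
  hence d: "deriv g z = deriv P z" by (rule deriv_cong_ev) simp
  have nz: "blaschke R a z \<noteq> 0" if "a \<in> S" for a
    using blaschke_eq_0_iff[OF H(4)[OF that], of z] zS that zR by auto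
  have B: "(blaschke R a has_field_derivative deriv (blaschke R a) z) (at z)" if "a \<in> S" for a
  proof -
    have "blaschke R a analytic_on {z}"
      by (rule analytic_on_subset[OF blaschke_analytic[OF H(4)[OF that]]]) (use zR in auto)
    thus ?thesis by (simp add: analytic_on_imp_differentiable_at field_differentiable_derivI)
  qed
  have Bp: "((\<lambda>w. blaschke R a w powi zorder g a) has_field_derivative
     (of_int (zorder g a) * blaschke R a z powi (zorder g a - 1) * deriv (blaschke R a) z)) (at z)" if "a \<in> S" for a
    by (rule DERIV_power_int[OF B[OF that]]) (use nz[OF that] in auto)
  define Q where "Q = (\<Prod>a\<in>S. blaschke R a z powi zorder g a)"
  define L where "L = (\<Sum>a\<in>S. of_int (zorder g a) * (deriv (blaschke R a) z / blaschke R a z))"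
  have "((\<lambda>w. \<Prod>a\<in>S. blaschke R a w powi zorder g a) has_field_derivative
     (Q * (\<Sum>a\<in>S. of_int (zorder g a) * blaschke R a z powi (zorder g a - 1) * deriv (blaschke R a) z / blaschke R a z powi zorder g a))) (at z)"
    unfolding Q_def by (rule has_field_derivative_prod'[OF _ Bp]) (use nz in auto)
  also have "(\<Sum>a\<in>S. of_int (zorder g a) * blaschke R a z powi (zorder g a - 1) * deriv (blaschke R a) z / blaschke R a z powi zorder g a) = L"
    unfolding L_def by (intro sum.cong refl) (use nz in \<open>auto simp: power_int_diff\<close>)
  finally have Pd: "((\<lambda>w. \<Prod>a\<in>S. blaschke R a w powi zorder g a) has_field_derivative Q * L) (at z)" .
  have "(H has_field_derivative deriv H z) (at z)" using holomorphic_derivI[OF H(1)] zR by simp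
  hence "((\<lambda>w. exp (H w)) has_field_derivative exp (H z) * deriv H z) (at z)" by (rule DERIV_chain2[OF DERIV_exp])
  from DERIV_mult[OF this Pd] have "(P has_field_derivative P z * (deriv H z + L)) (at z)"
    unfolding P_def by (rule DERIV_cong) (simp add: Q_def algebra_simps)
  hence "deriv g z / g z = deriv H z + L"
    using d zS z(3) by (simp add: DERIV_imp_deriv)
  also have "norm \<dots> \<le> norm (deriv H z) + norm L" by (rule norm_triangle_ineq)
  also have "norm (deriv H z) \<le> schwarz_bound R s g" using H(6) z(1) by blast
  also have "norm L \<le> (\<Sum>a\<in>S. \<bar>real_of_int (zorder g a)\<bar> * (1 / norm (z - a) + 1 / (R - s)))"
    unfolding L_def
  proof (rule sum_norm_le)
    fix a assume a: "a \<in> S"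
    show "norm (of_int (zorder g a) * (deriv (blaschke R a) z / blaschke R a z)) \<le>
        \<bar>real_of_int (zorder g a)\<bar> * (1 / norm (z - a) + 1 / (R - s))"
      unfolding norm_mult norm_of_int of_int_abs
      by (intro mult_left_mono blaschke_logderiv[OF H(4)[OF a] z(1) R]) (use zS a in auto)
  qed
  also have "\<dots> \<le> (\<Sum>a\<in>divisor_set R g. \<bar>real_of_int (zorder g a)\<bar> * (1 / norm (z - a) + 1 / (R - s)))"
    by (rule sum_mono2) (use finite_divisor_set[OF g] R in \<open>auto simp: H(2)\<close>)
  finally show ?thesis by simp
qed


section \<open>Entire functions inside a regular circle\<close>

lemma zorder_entire_ge_0:
  assumes "g holomorphic_on UNIV" "not_identically_zero g"
  shows "zorder g a \<ge> 0"
proof (rule zorder_ge_0)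
  show an: "g analytic_on {a}" using assms(1) by (auto simp: analytic_at)
  have "g meromorphic_on UNIV" using assms(1) by (simp add: analytic_on_imp_meromorphic_on analytic_on_open)
  thus "\<exists>\<^sub>F z in at a. g z \<noteq> 0"
    using eventually_nonzero_at[OF _ assms(2)] by (intro eventually_frequently) auto
qed

text \<open>
  Dominates \<open>log |f(w) / f(z)|\<close> for \<open>|w - z| \<le> D\<close> uniformly in \<open>w\<close>, so that Cauchy's inequality turns it
  into a bound for shifted derivatives.
\<close>
definition ratio_bound :: "real \<Rightarrow> real \<Rightarrow> real \<Rightarrow> (complex \<Rightarrow> complex) \<Rightarrow> complex \<Rightarrow> real" where
  "ratio_bound R s D f z = D * schwarz_bound R s f +
     (\<Sum>a\<in>divisor_set R f. \<bar>real_of_int (zorder f a)\<bar> * (ln (1 + D / norm (z - a)) + D / (R - s)))"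

text \<open>Each factor is compared at \<open>w\<close> and \<open>z\<close> by
  \<open>blaschke_ratio\<close>. For entire \<open>f\<close> all orders are nonnegative, so these
  inequalities survive taking powers and can be multiplied.\<close>

lemma norm_entire_le_ratio_bound:
  assumes f: "f holomorphic_on UNIV" "not_identically_zero f"
    and R: "s < R" and circ: "regular_circle R f"
    and z: "norm z \<le> s" "f z \<noteq> 0" and w: "norm w \<le> s" "norm (w - z) \<le> D"
  shows "norm (f w) \<le> norm (f z) * exp (ratio_bound R s D f z)"
proof (cases "f w = 0")
  case False
  have s: "s \<ge> 0" using z(1) norm_ge_zero order_trans by blast
  have D: "D \<ge> 0" using w(2) norm_ge_zero order_trans by blast
  have an: "f analytic_on {u}" for u using f(1) by (auto simp: analytic_at)
  have mero: "f meromorphic_on UNIV" using f(1) by (simp add: analytic_on_imp_meromorphic_on analytic_on_open)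
  obtain H S where H: "H holomorphic_on ball 0 R" "S = {a \<in> divisor_set R f. zorder f a \<noteq> 0}" "finite S"
    "\<And>a. a \<in> S \<Longrightarrow> norm a < R"
    "\<And>z. norm z \<le> R \<Longrightarrow> f analytic_on {z} \<Longrightarrow> f z \<noteq> 0 \<Longrightarrow> z \<notin> S \<and>
        f z = exp (H z) * (\<Prod>a\<in>S. blaschke R a z powi zorder f a)"
    "\<And>z. norm z \<le> s \<Longrightarrow> norm (deriv H z) \<le> schwarz_bound R s f"
    "Re (H 0) = circle_mean R (\<lambda>z. ln (norm (f z)))"
    by (rule log_factorization'[OF mero f(2) s R circ]) (rule that)
  have eq: "norm (f u) = exp (Re (H u)) * (\<Prod>a\<in>S. norm (blaschke R a u) ^ nat (zorder f a))"
    if "norm u \<le> s" "f u \<noteq> 0" for u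
  proof -
    have "norm (f u) = norm (exp (H u) * (\<Prod>a\<in>S. blaschke R a u powi zorder f a))" using H(5)[of u] that R an by auto
    also have "\<dots> = exp (Re (H u)) * (\<Prod>a\<in>S. norm (blaschke R a u) powi zorder f a)"
      by (simp add: norm_mult norm_power_int flip: prod_norm)
    also have "(\<Prod>a\<in>S. norm (blaschke R a u) powi zorder f a) = (\<Prod>a\<in>S. norm (blaschke R a u) ^ nat (zorder f a))"
      by (intro prod.cong refl) (simp add: power_int_def zorder_entire_ge_0[OF f])
    finally show ?thesis .
  qed
  have zS: "z \<notin> S" using H(5)[of z] z R an by auto
  have hd: "Re (H w) \<le> Re (H z) + D * schwarz_bound R s f"
  proof -
    have "\<bar>Re (H w) - Re (H z)\<bar> \<le> schwarz_bound R s f * norm (w - z)"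
      by (rule log_factor_diff_le[OF H(1) R H(6)]) (use z w in auto)
    also have "\<dots> \<le> schwarz_bound R s f * D"
      using w(2) norm_ge_zero order_trans[OF norm_ge_zero H(6)[OF z(1)]] by (intro mult_left_mono) auto
    finally show ?thesis by (simp add: mult.commute)
  qed
  have bl: "norm (blaschke R a w) ^ nat (zorder f a) \<le> norm (blaschke R a z) ^ nat (zorder f a) *
      exp (\<bar>real_of_int (zorder f a)\<bar> * (ln (1 + D / norm (z - a)) + D / (R - s)))" if a: "a \<in> S" for a
  proof -
    have za: "norm (z - a) > 0" using zS a by auto
    have "norm (blaschke R a w) \<le> norm (blaschke R a z) * ((1 + D / norm (z - a)) * (1 + D / (R - s)))"
      by (rule blaschke_ratio[OF H(4)[OF a] z(1) w(1) R]) (use zS a w in auto)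
    also have "\<dots> \<le> norm (blaschke R a z) * (exp (ln (1 + D / norm (z - a))) * exp (D / (R - s)))"
      using D za R by (intro mult_left_mono mult_mono exp_ge_add_one_self) (auto simp: add_pos_nonneg)
    also have "\<dots> = norm (blaschke R a z) * exp (ln (1 + D / norm (z - a)) + D / (R - s))" by (simp only: exp_add)
    finally have "norm (blaschke R a w) ^ nat (zorder f a) \<le>
        (norm (blaschke R a z) * exp (ln (1 + D / norm (z - a)) + D / (R - s))) ^ nat (zorder f a)"
      by (intro power_mono) auto
    also have "\<dots> = norm (blaschke R a z) ^ nat (zorder f a) * exp (real (nat (zorder f a)) * (ln (1 + D / norm (z - a)) + D / (R - s)))"
      by (simp add: power_mult_distrib exp_of_nat_mult)
    also have "real (nat (zorder f a)) = \<bar>real_of_int (zorder f a)\<bar>" using zorder_entire_ge_0[OF f, of a] by simp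
    finally show ?thesis .
  qed
  have "norm (f w) = exp (Re (H w)) * (\<Prod>a\<in>S. norm (blaschke R a w) ^ nat (zorder f a))"
    by (rule eq) (use w False in auto)
  also have "\<dots> \<le> exp (Re (H z) + D * schwarz_bound R s f) * (\<Prod>a\<in>S. norm (blaschke R a z) ^ nat (zorder f a) *
      exp (\<bar>real_of_int (zorder f a)\<bar> * (ln (1 + D / norm (z - a)) + D / (R - s))))"
    by (intro mult_mono prod_mono) (use hd bl in \<open>auto intro!: prod_nonneg\<close>)
  also have "\<dots> = norm (f z) * exp (D * schwarz_bound R s f + (\<Sum>a\<in>S. \<bar>real_of_int (zorder f a)\<bar> * (ln (1 + D / norm (z - a)) + D / (R - s))))"
    by (simp add: eq[OF z] prod.distrib exp_add exp_sum H(3))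
  also have "\<dots> \<le> norm (f z) * exp (ratio_bound R s D f z)"
    unfolding ratio_bound_def
    by (intro mult_left_mono exp_le_cancel_iff[THEN iffD2] add_left_mono sum_mono2)
       (use finite_divisor_set[OF mero f(2)] R D in \<open>auto simp: H(2)\<close>)
  finally show ?thesis .
qed auto

text \<open>All Blaschke factors have modulus at most 1 and positive exponents, so |f| \<le> exp (Re
  H); Re (H 0) is the mean of log |f|, and the bound on H' controls the way from 0 to
  \<open>z\<close>.\<close>

lemma norm_entire_le_circle_mean:
  assumes f: "f holomorphic_on UNIV" "not_identically_zero f"
    and R: "s < R" and circ: "regular_circle R f" and z: "norm z \<le> s"
  shows "norm (f z) \<le> exp (circle_mean R (\<lambda>z. ln (norm (f z))) + s * schwarz_bound R s f)"
proof (cases "f z = 0")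
  case False
  have s: "s \<ge> 0" using z(1) norm_ge_zero order_trans by blast
  have an: "f analytic_on {u}" for u using f(1) by (auto simp: analytic_at)
  have mero: "f meromorphic_on UNIV" using f(1) by (simp add: analytic_on_imp_meromorphic_on analytic_on_open)
  obtain H S where H: "H holomorphic_on ball 0 R" "S = {a \<in> divisor_set R f. zorder f a \<noteq> 0}" "finite S"
    "\<And>a. a \<in> S \<Longrightarrow> norm a < R"
    "\<And>z. norm z \<le> R \<Longrightarrow> f analytic_on {z} \<Longrightarrow> f z \<noteq> 0 \<Longrightarrow> z \<notin> S \<and>
        f z = exp (H z) * (\<Prod>a\<in>S. blaschke R a z powi zorder f a)"
    "\<And>z. norm z \<le> s \<Longrightarrow> norm (deriv H z) \<le> schwarz_bound R s f"
    "Re (H 0) = circle_mean R (\<lambda>z. ln (norm (f z)))"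
    by (rule log_factorization'[OF mero f(2) s R circ]) (rule that)
  have "norm (f z) = norm (exp (H z) * (\<Prod>a\<in>S. blaschke R a z powi zorder f a))" using H(5)[of z] z False R an by auto
  also have "\<dots> = exp (Re (H z)) * (\<Prod>a\<in>S. norm (blaschke R a z) powi zorder f a)"
    by (simp add: norm_mult norm_power_int flip: prod_norm)
  also have "(\<Prod>a\<in>S. norm (blaschke R a z) powi zorder f a) = (\<Prod>a\<in>S. norm (blaschke R a z) ^ nat (zorder f a))"
    by (intro prod.cong refl) (simp add: power_int_def zorder_entire_ge_0[OF f])
  also have "\<dots> \<le> 1" using H(4) z R by (intro prod_le_1 conjI power_le_one norm_blaschke_le zero_le_power) auto
  finally have 1: "norm (f z) \<le> exp (Re (H z))" by simp
  have "\<bar>Re (H z) - Re (H 0)\<bar> \<le> schwarz_bound R s f * norm (z - 0)"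
    by (rule log_factor_diff_le[OF H(1) R H(6)]) (use z s in auto)
  also have "\<dots> \<le> schwarz_bound R s f * s"
    using z order_trans[OF norm_ge_zero H(6)[OF z(1)]] by (intro mult_left_mono) auto
  finally have "Re (H z) \<le> circle_mean R (\<lambda>z. ln (norm (f z))) + s * schwarz_bound R s f"
    using H(7) by (simp add: mult.commute)
  with 1 show ?thesis by (meson exp_le_cancel_iff order_trans)
qed auto

section \<open>The mean of log (1 + D / |z - a|) over a circle\<close>

lemma sin_ge_third:
  assumes "0 \<le> y" "y \<le> pi / 2"
  shows "sin y \<ge> y / 3"
proof (cases "y \<le> pi / 3")
  case True
  have "(\<lambda>x. sin x - x / 3) 0 \<le> (\<lambda>x. sin x - x / 3) y"
  proof (rule DERIV_nonneg_imp_nondecreasing[OF assms(1)])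
    fix x assume x: "0 \<le> x" "x \<le> y"
    have "cos (pi / 3) \<le> cos x" using x True by (intro cos_monotone_0_pi_le) auto
    hence "0 \<le> cos x - 1 / 3" by (simp add: cos_60)
    moreover have "((\<lambda>x. sin x - x / 3) has_real_derivative (cos x - 1 / 3)) (at x)"
      by (auto intro!: derivative_eq_intros)
    ultimately show "\<exists>D. ((\<lambda>x. sin x - x / 3) has_real_derivative D) (at x) \<and> 0 \<le> D" by blast
  qed
  thus ?thesis by simp
next
  case False
  have "y / 3 \<le> sqrt 3 / 2"
  proof -
    have "y / 3 \<le> 4 / 6" using assms(2) pi_less_4 by simp
    also have "\<dots> \<le> sqrt 3 / 2" using real_le_rsqrt[of "4/3" 3] by (simp add: power2_eq_square)
    finally show ?thesis .
  qed
  also have "sqrt 3 / 2 = sin (pi / 3)" by (simp add: sin_60)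
  also have "\<dots> \<le> sin y" using False assms by (intro sin_monotone_2pi_le) auto
  finally show ?thesis .
qed

text \<open>Subtracting the nearest multiple of \<pi> preserves |sin x| and leads to
  [-\<pi>/2, \<pi>/2], where a linear lower bound is available.\<close>

lemma abs_sin_ge_third:
  obtains k :: int where "\<bar>sin x\<bar> \<ge> \<bar>x - of_int k * pi\<bar> / 3" "\<bar>x - of_int k * pi\<bar> \<le> pi / 2"
proof
  define k where "k = round (x / pi)"
  have "\<bar>of_int k - x / pi\<bar> \<le> 1 / 2" unfolding k_def by (rule of_int_round_abs_le)
  hence "\<bar>of_int k - x / pi\<bar> * pi \<le> 1 / 2 * pi" by (intro mult_right_mono) auto
  also have "\<bar>of_int k - x / pi\<bar> * pi = \<bar>(of_int k - x / pi) * pi\<bar>" by (simp add: abs_mult)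
  also have "(of_int k - x / pi) * pi = - (x - of_int k * pi)" by (simp add: algebra_simps)
  finally show le: "\<bar>x - of_int k * pi\<bar> \<le> pi / 2" by (simp add: abs_minus_commute)
  define y where "y = x - of_int k * pi"
  have "sin x = sin (y + of_int k * pi)" by (simp add: y_def)
  also have "\<dots> = sin y * cos (of_int k * pi)"
    by (simp add: sin_add sin_times_pi_eq_0)
  finally have "\<bar>sin x\<bar> = \<bar>sin y\<bar> * \<bar>cos (of_int k * pi)\<bar>" by (simp add: abs_mult)
  also have "\<bar>cos (of_int k * pi)\<bar> = 1"
  proof -
    have "sin (of_int k * pi) = 0" by (simp add: sin_times_pi_eq_0)
    hence "(cos (of_int k * pi))\<^sup>2 = 1"
      using sin_cos_squared_add[of "of_int k * pi"] by (simp del: sin_cos_squared_add)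
    hence "cos (of_int k * pi) = 1 \<or> cos (of_int k * pi) = -1" by (simp only: power2_eq_1_iff)
    thus ?thesis by auto
  qed
  finally have "\<bar>sin x\<bar> = \<bar>sin y\<bar>" by simp
  also have "\<bar>sin y\<bar> = \<bar>sin \<bar>y\<bar>\<bar>" by (cases "y \<ge> 0") auto
  also have "\<dots> \<ge> \<bar>y\<bar> / 3" using sin_ge_third[of "\<bar>y\<bar>"] le by (simp add: y_def)
  finally show "\<bar>sin x\<bar> \<ge> \<bar>x - of_int k * pi\<bar> / 3" by (simp add: y_def)
qed

text \<open>The function \<open>sqrt\<close> is odd on the reals, so 2 sqrt (x - c) is an
  antiderivative on both sides of the singularity and is continuous across it.\<close>

lemma has_integral_inverse_sqrt_dist:
  assumes "a \<le> b"
  shows "((\<lambda>x. 1 / sqrt \<bar>x - c\<bar>) has_integral (2 * sqrt (b - c) - 2 * sqrt (a - c))) {a..b}"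
proof (rule fundamental_theorem_of_calculus_interior_strong[of "{c}" a b "\<lambda>x. 2 * sqrt (x - c)"])
  fix x assume "x \<in> {a<..<b} - {c}"
  hence ne: "x - c \<noteq> 0" by auto
  have "(sqrt has_real_derivative (1 / (2 * sqrt \<bar>x - c\<bar>))) (at (x - c))"
    by (rule DERIV_real_sqrt_generic[OF ne])
       (use real_sqrt_minus[of "x - c"] in \<open>auto simp: field_simps\<close>)
  hence "((\<lambda>x. sqrt (x - c)) has_real_derivative (1 / (2 * sqrt \<bar>x - c\<bar>) * 1)) (at x)"
    by (rule DERIV_chain2) (auto intro!: derivative_eq_intros)
  from DERIV_cmult[OF this, of 2] have "((\<lambda>x. 2 * sqrt (x - c)) has_real_derivative (1 / sqrt \<bar>x - c\<bar>)) (at x)"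
    by simp
  thus "((\<lambda>x. 2 * sqrt (x - c)) has_vector_derivative 1 / sqrt \<bar>x - c\<bar>) (at x)"
    by (simp add: has_real_derivative_iff_has_vector_derivative)
qed (auto intro!: continuous_intros assms)

text \<open>Since 1 + x \<le> (1 + sqrt x)^2. This trades the logarithm for an integrable power that
  scales like r^(-1/2) on the circle of radius r.\<close>

lemma ln_one_plus_le_sqrt:
  assumes "x \<ge> 0"
  shows "ln (1 + x) \<le> 2 * sqrt (x :: real)"
proof -
  have "1 + x \<le> (1 + sqrt x)\<^sup>2" using assms by (simp add: power2_eq_square algebra_simps)
  hence "ln (1 + x) \<le> ln ((1 + sqrt x)\<^sup>2)" using assms by (intro ln_mono) auto
  also have "\<dots> = 2 * ln (1 + sqrt x)" using assms by (simp add: ln_realpow add_nonneg_eq_0_iff)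
  also have "\<dots> \<le> 2 * sqrt x" using ln_add_one_self_le_self[of "sqrt x"] assms by simp
  finally show ?thesis .
qed

text \<open>
  On \<open>|z| = r\<close> the distance to \<open>a\<close> is at least \<open>r |sin (\<theta> - arg a)|\<close>, and \<open>|sin|\<^sup>-\<^sup>1\<^sup>/\<^sup>2\<close> is integrable.
\<close>
lemma circle_mean_ln_dist_le:
  obtains C where "C \<ge> 0"
    "\<And>r D a. r > 0 \<Longrightarrow> D \<ge> 0 \<Longrightarrow> norm a \<noteq> r \<Longrightarrow>
        circle_mean r (\<lambda>z. ln (1 + D / norm (z - a))) \<le> C * sqrt (D / r)"
proof -
  \<comment> \<open>For \<theta> in [0, 2 \<pi>] the angle \<theta> - arg a lies in
    [-\<pi>, 3 \<pi>], so its nearest multiple k \<pi> has |k| \<le> 4. The number 10 \<pi> is a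
    crude bound for the square-root arguments in the integral below.\<close>
  define I where "I = (\<Sum>k\<in>{-4..4::int}. 4 * sqrt (10 * pi))"
  define C where "C = 1 / (2 * pi) * (2 * sqrt 3 * I)"
  have I0: "I \<ge> 0" unfolding I_def by (intro sum_nonneg) auto
  show ?thesis
  proof (rule that[of C])
    show "C \<ge> 0" using I0 by (simp add: C_def)
  next
    fix r D :: real and a :: complex assume r: "r > 0" and D: "D \<ge> 0" and a: "norm a \<noteq> r"
    define \<phi> where "\<phi> = Arg a"
    have \<phi>: "-pi < \<phi>" "\<phi> \<le> pi" unfolding \<phi>_def by (rule mpi_less_Arg, rule Arg_le_pi)
    have a_eq: "a = of_real (norm a) * cis \<phi>" unfolding \<phi>_def using rcis_cmod_Arg[of a] by (simp add: rcis_def)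
    define g where "g = (\<lambda>\<theta>. \<Sum>k\<in>{-4..4::int}. 1 / sqrt \<bar>\<theta> - (\<phi> + of_int k * pi)\<bar>)"
    define f where "f = (\<lambda>\<theta>. ln (1 + D / norm (of_real r * cis \<theta> - a)))"
    \<comment> \<open>At the singularities of \<open>g\<close> division by zero returns 0 and the
      comparison may fail; these finitely many angles are excluded from it.\<close>
    define E where "E = (\<lambda>k. \<phi> + of_int k * pi) ` {-4..4::int}"
    have fin: "finite E" by (simp add: E_def)
    have ne: "of_real r * cis \<theta> \<noteq> a" for \<theta> using a r by (auto simp: norm_mult)
    have pt: "f \<theta> \<le> 2 * sqrt (D / r) * sqrt 3 * g \<theta>" if \<theta>: "\<theta> \<in> {0..2*pi} - E" for \<theta>
    proof -
      obtain k :: int where k: "\<bar>sin (\<theta> - \<phi>)\<bar> \<ge> \<bar>\<theta> - \<phi> - of_int k * pi\<bar> / 3" "\<bar>\<theta> - \<phi> - of_int k * pi\<bar> \<le> pi / 2"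
        by (rule abs_sin_ge_third)
      have "\<bar>of_int k * pi\<bar> \<le> \<bar>\<theta> - \<phi>\<bar> + pi / 2" using k(2) by linarith
      also have "\<dots> \<le> 3 * pi + pi / 2" using \<theta> \<phi> by auto
      also have "\<dots> \<le> 4 * pi" by simp
      finally have "\<bar>real_of_int k\<bar> * pi \<le> 4 * pi" by (simp add: abs_mult)
      hence k4: "k \<in> {-4..4}" by auto
      define d where "d = \<bar>\<theta> - (\<phi> + of_int k * pi)\<bar>"
      have d: "d > 0" using \<theta> k4 by (auto simp: d_def E_def)
      have "r * (d / 3) \<le> r * \<bar>sin (\<theta> - \<phi>)\<bar>" using k(1) r by (intro mult_left_mono) (auto simp: d_def algebra_simps)
      \<comment> \<open>Rotating \<open>a\<close> onto the real axis removes it from the imaginary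
        part.\<close>
      also have "\<dots> = \<bar>Im ((of_real r * cis \<theta> - a) * cis (-\<phi>))\<bar>"
        by (subst a_eq) (use r in \<open>simp add: left_diff_distrib mult.assoc cis_mult abs_mult\<close>)
      also have "\<dots> \<le> norm ((of_real r * cis \<theta> - a) * cis (-\<phi>))" by (rule abs_Im_le_cmod)
      also have "\<dots> = norm (of_real r * cis \<theta> - a)" by (simp add: norm_mult)
      finally have dist: "r * d / 3 \<le> norm (of_real r * cis \<theta> - a)" by simp
      have "f \<theta> \<le> 2 * sqrt (D / norm (of_real r * cis \<theta> - a))"
        unfolding f_def using D by (intro ln_one_plus_le_sqrt) auto
      also have "D / norm (of_real r * cis \<theta> - a) \<le> D / (r * d / 3)"
        using dist d r D by (intro divide_left_mono) (auto simp: ne mult_pos_pos)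
      also have "D / (r * d / 3) = D / r * 3 * (1 / d)" by simp
      also have "2 * sqrt (D / r * 3 * (1 / d)) = 2 * sqrt (D / r) * sqrt 3 * (1 / sqrt d)"
        by (simp add: real_sqrt_mult real_sqrt_divide)
      also have "1 / sqrt d \<le> g \<theta>"
        unfolding g_def d_def by (rule member_le_sum[OF k4]) auto
      finally show ?thesis using D r by (simp add: mult_left_mono)
    qed
    have gi: "(g has_integral (\<Sum>k\<in>{-4..4::int}. 2 * sqrt (2*pi - (\<phi> + of_int k * pi)) - 2 * sqrt (0 - (\<phi> + of_int k * pi)))) {0..2*pi}"
      unfolding g_def by (intro has_integral_sum has_integral_inverse_sqrt_dist) auto
    have f_cont: "continuous_on {0..2*pi} f" unfolding f_def
      by (intro continuous_intros) (use ne D in \<open>auto intro!: add_pos_nonneg simp: add_nonneg_eq_0_iff\<close>)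
    have "integral {0..2*pi} f \<le> 2 * sqrt (D / r) * sqrt 3 * (\<Sum>k\<in>{-4..4::int}. 2 * sqrt (2*pi - (\<phi> + of_int k * pi)) - 2 * sqrt (0 - (\<phi> + of_int k * pi)))"
    proof (rule has_integral_le)
      show "(f has_integral integral {0..2*pi} f) {0..2*pi}"
        by (intro integrable_integral integrable_continuous_interval f_cont)
      show "((\<lambda>\<theta>. if \<theta> \<in> E then f \<theta> else 2 * sqrt (D / r) * sqrt 3 * g \<theta>) has_integral
        2 * sqrt (D / r) * sqrt 3 * (\<Sum>k\<in>{-4..4::int}. 2 * sqrt (2*pi - (\<phi> + of_int k * pi)) - 2 * sqrt (0 - (\<phi> + of_int k * pi)))) {0..2*pi}"
        by (rule has_integral_spike_finite[OF fin _ has_integral_mult_right[OF gi]]) auto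
    qed (use pt in auto)
    also have "\<dots> \<le> 2 * sqrt (D / r) * sqrt 3 * I" unfolding I_def
    proof (intro mult_left_mono sum_mono)
      fix k :: int assume "k \<in> {-4..4}"
      hence "real_of_int k \<le> 4" "real_of_int k \<ge> -4" by auto
      hence "real_of_int k * pi \<le> 4 * pi" "real_of_int k * pi \<ge> (-4) * pi"
        using mult_right_mono[of "real_of_int k" 4 pi] mult_right_mono[of "-4" "real_of_int k" pi] by simp_all
      hence "2*pi - (\<phi> + of_int k * pi) \<le> 10 * pi" "\<phi> + of_int k * pi \<le> 10 * pi"
        using \<phi> by linarith+
      hence "sqrt (2*pi - (\<phi> + of_int k * pi)) \<le> sqrt (10 * pi)" "sqrt (\<phi> + of_int k * pi) \<le> sqrt (10 * pi)"
        by (auto intro!: real_sqrt_le_mono)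
      thus "2 * sqrt (2*pi - (\<phi> + of_int k * pi)) - 2 * sqrt (0 - (\<phi> + of_int k * pi)) \<le> 4 * sqrt (10 * pi)"
        unfolding diff_0 real_sqrt_minus by linarith
    qed (use D r in auto)
    finally have "1 / (2 * pi) * integral {0..2*pi} f \<le> 1 / (2 * pi) * (2 * sqrt (D / r) * sqrt 3 * I)"
      by (intro mult_left_mono) auto
    thus "circle_mean r (\<lambda>z. ln (1 + D / norm (z - a))) \<le> C * sqrt (D / r)"
      by (simp add: circle_mean_def f_def C_def mult_ac)
  qed
qed

subsection \<open>Exceptional sets and growth classes\<close>

text \<open>The exceptional set is hidden, so each estimate may bring its own; finitely many are
  merged by taking unions.\<close>

definition eventually_outside :: "(real \<Rightarrow> bool) \<Rightarrow> bool" where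
  "eventually_outside P \<longleftrightarrow> (\<exists>E. finite_log_measure E \<and> (\<forall>\<^sub>F r in at_top. r \<notin> E \<longrightarrow> P r))"

lemma finite_log_measure_countable:
  assumes "countable E"
  shows "finite_log_measure E"
proof -
  have "E \<in> null_sets lebesgue" using countable_imp_null_set_lborel[OF assms] by (simp add: null_sets_completionI)
  hence "E \<inter> {1..} \<in> null_sets lebesgue" by (intro null_set_Int2) auto
  thus ?thesis using \<open>E \<in> null_sets lebesgue\<close> 
    unfolding finite_log_measure_def by (simp add: nn_integral_null_set null_setsD2)
qed

lemma finite_log_measure_Un:
  assumes "finite_log_measure E" "finite_log_measure F"
  shows "finite_log_measure (E \<union> F)"
proof -
  have m: "E \<in> sets lebesgue" "F \<in> sets lebesgue" using assms by (auto simp: finite_log_measure_def)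
  have meas: "(\<lambda>t::real. ennreal (1 / t)) \<in> borel_measurable lebesgue"
    by (intro measurable_completion) simp
  have "(\<integral>\<^sup>+t\<in>(E \<union> F) \<inter> {1..}. ennreal (1 / t) \<partial>lebesgue) \<le>
      (\<integral>\<^sup>+t. ennreal (1 / t) * indicator (E \<inter> {1..}) t + ennreal (1 / t) * indicator (F \<inter> {1..}) t \<partial>lebesgue)"
    by (intro nn_integral_mono) (auto simp: indicator_def)
  also have "\<dots> = (\<integral>\<^sup>+t\<in>E \<inter> {1..}. ennreal (1 / t) \<partial>lebesgue) + (\<integral>\<^sup>+t\<in>F \<inter> {1..}. ennreal (1 / t) \<partial>lebesgue)"
    by (intro nn_integral_add borel_measurable_times_ennreal meas borel_measurable_indicator) (use m in auto)
  also have "\<dots> < \<infinity>" using assms by (simp add: finite_log_measure_def)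
  finally show ?thesis using m by (simp add: finite_log_measure_def)
qed

lemma eventually_outside_mono:
  assumes "eventually_outside P" "\<And>r. P r \<Longrightarrow> Q r"
  shows "eventually_outside Q"
  using assms unfolding eventually_outside_def by (metis (mono_tags, lifting) eventually_mono)

lemma eventually_outside_conj:
  assumes "eventually_outside P" "eventually_outside Q"
  shows "eventually_outside (\<lambda>r. P r \<and> Q r)"
proof -
  obtain E F where "finite_log_measure E" "finite_log_measure F"
    "\<forall>\<^sub>F r in at_top. r \<notin> E \<longrightarrow> P r" "\<forall>\<^sub>F r in at_top. r \<notin> F \<longrightarrow> Q r"
    using assms unfolding eventually_outside_def by blast
  moreover from this(3,4) have "\<forall>\<^sub>F r in at_top. r \<notin> E \<union> F \<longrightarrow> P r \<and> Q r" by eventually_elim auto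
  ultimately show ?thesis unfolding eventually_outside_def using finite_log_measure_Un by blast
qed

lemma eventually_outsideI:
  assumes "\<forall>\<^sub>F r in at_top. P r"
  shows "eventually_outside P"
  unfolding eventually_outside_def using finite_log_measure_countable[of "{}"] assms by auto

lemma eventually_outside_ball_finite:
  assumes "finite A" "\<And>a. a \<in> A \<Longrightarrow> eventually_outside (P a)"
  shows "eventually_outside (\<lambda>r. \<forall>a\<in>A. P a r)"
  using assms
proof (induction A rule: finite_induct)
  case empty
  thus ?case by (auto intro!: eventually_outsideI)
next
  case (insert a A)
  hence "eventually_outside (\<lambda>r. P a r \<and> (\<forall>a\<in>A. P a r))" by (intro eventually_outside_conj) auto
  thus ?case by simp
qed

lemma eventually_outside_at_top_outside:
  assumes "finite_log_measure E" "\<forall>\<^sub>F r in at_top_outside E. P r"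
  shows "eventually_outside P"
  using assms unfolding at_top_outside_def eventually_inf_principal eventually_outside_def by auto

text \<open>The interval [2 r, 3 r] has logarithmic measure at least 1/3 for every r, whereas the
  part of \<open>E\<close> beyond r has measure tending to 0. Starting at 2 r leaves the room that
  estimates between concentric discs require.\<close>

lemma eventually_ex_outside:
  assumes "eventually_outside P"
  shows "\<forall>\<^sub>F r in at_top. \<exists>R\<in>{2 * r..3 * r}. P R"
proof -
  obtain E where E: "finite_log_measure E" "\<forall>\<^sub>F r in at_top. r \<notin> E \<longrightarrow> P r"
    using assms unfolding eventually_outside_def by blast
  have Em: "E \<in> sets lebesgue" using E(1) by (simp add: finite_log_measure_def)
  define M where "M = density lebesgue (\<lambda>t. ennreal (1 / t) * indicator (E \<inter> {1..}) t)"
  have meas: "(\<lambda>t::real. ennreal (1 / t) * indicator (E \<inter> {1..}) t) \<in> borel_measurable lebesgue"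
    using Em by (intro borel_measurable_times_ennreal borel_measurable_indicator measurable_completion) auto
  have sM: "sets M = sets lebesgue" by (simp add: M_def)
  have emM: "emeasure M A = (\<integral>\<^sup>+t. (ennreal (1 / t) * indicator (E \<inter> {1..}) t) * indicator A t \<partial>lebesgue)"
    if "A \<in> sets lebesgue" for A
    unfolding M_def by (rule emeasure_density[OF meas that])
  have fin: "emeasure M A \<noteq> \<infinity>" for A
  proof -
    have "emeasure M UNIV < \<infinity>" using E(1) by (simp add: emM finite_log_measure_def)
    moreover have "emeasure M A \<le> emeasure M UNIV" by (intro emeasure_mono) (auto simp: sM)
    ultimately show ?thesis by auto
  qed
  have "(\<lambda>n::nat. emeasure M {real n..}) \<longlonglongrightarrow> emeasure M (\<Inter>n::nat. {real n..})"
  proof (rule Lim_emeasure_decseq)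
    show "decseq (\<lambda>n::nat. {real n..})" by (auto simp: decseq_def)
  qed (use fin in \<open>auto simp: sM\<close>)
  also have "(\<Inter>n::nat. {real n..}) = {}"
    by (auto, meson linorder_not_le reals_Archimedean2)
  finally have "(\<lambda>n::nat. emeasure M {real n..}) \<longlonglongrightarrow> 0" by simp
  hence "\<forall>\<^sub>F n::nat in sequentially. emeasure M {real n..} < ennreal (1 / 3)"
    by (rule order_tendstoD(2)) simp
  then obtain n :: nat where n: "emeasure M {real n..} < ennreal (1 / 3)"
    by (auto simp: eventually_sequentially)
  obtain r0 where r0: "\<And>r. r \<ge> r0 \<Longrightarrow> r \<notin> E \<Longrightarrow> P r"
    using E(2) by (auto simp: eventually_at_top_linorder)
  show ?thesis unfolding eventually_at_top_linorder
  proof (intro exI allI impI)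
    fix r assume r: "r \<ge> Max {1, real n, r0}"
    hence r1: "r \<ge> 1" "r \<ge> real n" "r \<ge> r0" by auto
    show "\<exists>R\<in>{2 * r..3 * r}. P R"
    proof (rule ccontr)
      assume "\<not> (\<exists>R\<in>{2 * r..3 * r}. P R)"
      have sub: "{2 * r..3 * r} \<subseteq> E"
      proof
        fix t assume t: "t \<in> {2 * r..3 * r}"
        hence "t \<ge> r0" using r1 by auto
        thus "t \<in> E" using r0[of t] t \<open>\<not> (\<exists>R\<in>{2 * r..3 * r}. P R)\<close> by blast
      qed
      \<comment> \<open>The length r of the interval times 1 / (3 r), the least value of the density
        1/t on it.\<close>
      have "ennreal (1 / 3) = ennreal (1 / (3 * r)) * emeasure lebesgue {2 * r..3 * r}"
        using r1 by (simp add: emeasure_lborel_Icc_eq flip: ennreal_mult')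
      also have "\<dots> = (\<integral>\<^sup>+t. ennreal (1 / (3 * r)) * indicator {2 * r..3 * r} t \<partial>lebesgue)"
        by (simp add: nn_integral_cmult_indicator)
      also have "\<dots> \<le> (\<integral>\<^sup>+t. (ennreal (1 / t) * indicator (E \<inter> {1..}) t) * indicator {real n..} t \<partial>lebesgue)"
      proof (intro nn_integral_mono)
        fix t :: real
        show "ennreal (1 / (3 * r)) * indicator {2 * r..3 * r} t \<le> (ennreal (1 / t) * indicator (E \<inter> {1..}) t) * indicator {real n..} t"
        proof (cases "t \<in> {2 * r..3 * r}")
          case True
          hence "t \<in> E" "t \<ge> 1" "t \<ge> real n" "1 / (3 * r) \<le> 1 / t" using sub r1 by (auto intro!: divide_left_mono)
          thus ?thesis using True by (simp add: ennreal_leI)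
        qed simp
      qed
      also have "\<dots> = emeasure M {real n..}" by (simp add: emM)
      finally show False using n by simp
    qed
  qed
qed

text \<open>A set without accumulation points in the plane is countable, so the radii of the circles
  meeting it form a null set.\<close>

lemma cosparse_imp_eventually_circle:
  assumes "\<forall>\<^sub>\<approx>z\<in>UNIV. Q (z :: complex)"
  shows "eventually_outside (\<lambda>r. \<forall>z. norm z = r \<longrightarrow> Q z)"
proof -
  have "countable (UNIV \<inter> {z. \<not> Q z})"
    by (rule sparse_imp_countable) (use assms in \<open>auto simp: eventually_cosparse\<close>)
  hence "finite_log_measure (norm ` {z. \<not> Q z})" by (intro finite_log_measure_countable) auto
  thus ?thesis unfolding eventually_outside_def
    by (intro exI[of _ "norm ` {z. \<not> Q z}"] conjI always_eventually) auto
qed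

lemma eventually_continuous_circle:
  assumes "g meromorphic_on UNIV"
  shows "eventually_outside (\<lambda>r. continuous_on (sphere 0 r) g)"
proof -
  have "eventually_outside (\<lambda>r. \<forall>z. norm z = r \<longrightarrow> g analytic_on {z})"
    by (intro cosparse_imp_eventually_circle meromorphic_on_imp_analytic_cosparse assms)
  thus ?thesis
  proof (rule eventually_outside_mono)
    fix r assume r: "\<forall>z. norm z = r \<longrightarrow> g analytic_on {z}"
    have "g analytic_on sphere 0 r" by (subst analytic_on_analytic_at) (use r in auto)
    thus "continuous_on (sphere 0 r) g"
      using analytic_imp_holomorphic holomorphic_on_imp_continuous_on by blast
  qed
qed

lemma eventually_regular_circle:
  assumes "g meromorphic_on UNIV" "not_identically_zero g"
  shows "eventually_outside (\<lambda>r. regular_circle r g)"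
proof -
  have "\<forall>\<^sub>\<approx>z\<in>UNIV. g analytic_on {z} \<and> g z \<noteq> 0"
    using eventually_nonzero_cosparse[OF assms] meromorphic_on_imp_analytic_cosparse[OF assms(1)]
    by eventually_elim auto
  from cosparse_imp_eventually_circle[OF this] show ?thesis
    unfolding regular_circle_def by simp
qed

section \<open>Classes of admissible error terms\<close>

lemma log_plus_sum_le:
  assumes "finite I" "\<And>i. i \<in> I \<Longrightarrow> x i \<ge> 0"
  shows "log_plus (\<Sum>i\<in>I. x i) \<le> (\<Sum>i\<in>I. log_plus (x i)) + ln (1 + real (card I))"
proof (rule log_plus_le)
  have "(\<Sum>i\<in>I. x i) \<le> (\<Sum>i\<in>I. exp (\<Sum>j\<in>I. log_plus (x j)))"
  proof (rule sum_mono)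
    fix i assume "i \<in> I"
    hence "log_plus (x i) \<le> (\<Sum>j\<in>I. log_plus (x j))"
      using assms(1) by (intro member_le_sum log_plus_nonneg) auto
    thus "x i \<le> exp (\<Sum>j\<in>I. log_plus (x j))"
      using le_exp_log_plus[of "x i"] by (meson exp_le_cancel_iff order_trans)
  qed
  also have "\<dots> = real (card I) * exp (\<Sum>j\<in>I. log_plus (x j))" by simp
  \<comment> \<open>Adding 1 makes the factor positive for empty \<open>I\<close> too, so that it is
    the exponential of its logarithm.\<close>
  also have "\<dots> \<le> (1 + real (card I)) * exp (\<Sum>j\<in>I. log_plus (x j))" by (intro mult_right_mono) auto
  also have "\<dots> = exp ((\<Sum>i\<in>I. log_plus (x i)) + ln (1 + real (card I)))"
    by (simp add: exp_add add_pos_nonneg mult.commute)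
  finally show "(\<Sum>i\<in>I. x i) \<le> exp ((\<Sum>i\<in>I. log_plus (x i)) + ln (1 + real (card I)))" .
qed (auto intro!: add_nonneg_nonneg sum_nonneg log_plus_nonneg)

text \<open>The common rules for small terms and for terms of order at most \<rho>, proved once and
  used for both. Membership is one-sided: it bounds a function from above only.\<close>

locale growth_class =
  fixes K :: "(real \<Rightarrow> real) set"
  assumes K_add: "u \<in> K \<Longrightarrow> v \<in> K \<Longrightarrow> (\<lambda>r. u r + v r) \<in> K"
    and K_le: "u \<in> K \<Longrightarrow> eventually_outside (\<lambda>r. v r \<le> u r) \<Longrightarrow> v \<in> K"
    and K_const: "(\<lambda>_. c) \<in> K"
begin

text \<open>Proximity and counting function are kept apart, because quotients such as L / f have
  small m(r, \<cdot>) while nothing is known about their poles.\<close>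

definition small_proximity :: "(complex \<Rightarrow> complex) \<Rightarrow> bool" where
  "small_proximity g \<longleftrightarrow> g meromorphic_on UNIV \<and> (\<lambda>r. proximity r g) \<in> K"

definition small_count :: "(complex \<Rightarrow> complex) \<Rightarrow> bool" where
  "small_count g \<longleftrightarrow> g meromorphic_on UNIV \<and> (\<lambda>r. integrated_count r g) \<in> K"

lemma K_sum:
  assumes "finite I" "\<And>i. i \<in> I \<Longrightarrow> u i \<in> K"
  shows "(\<lambda>r. \<Sum>i\<in>I. u i r) \<in> K"
  using assms
proof (induction I rule: finite_induct)
  case (insert i I)
  hence "(\<lambda>r. u i r + (\<Sum>i\<in>I. u i r)) \<in> K" by (intro K_add) auto
  thus ?case using insert by simp
qed (simp add: K_const)

text \<open>The inequality may fail on a closed discrete set, since only circles missing it are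
  used. Arguments split according to |f| \<le> 1 or |f| > 1 enter in this form, with the bounds of
  both cases added up.\<close>

lemma small_proximity_dominated:
  assumes g: "g meromorphic_on UNIV" and I: "finite I" "\<And>i. i \<in> I \<Longrightarrow> small_proximity (G i)"
    and le: "\<forall>\<^sub>\<approx>z\<in>UNIV. norm (g z) \<le> (\<Sum>i\<in>I. norm (G i z))"
  shows "small_proximity g"
proof -
  have "(\<lambda>r. (\<Sum>i\<in>I. proximity r (G i)) + ln (1 + real (card I))) \<in> K"
    by (intro K_add K_sum K_const I) (use I in \<open>auto simp: small_proximity_def\<close>)
  moreover have "eventually_outside (\<lambda>r. proximity r g \<le> (\<Sum>i\<in>I. proximity r (G i)) + ln (1 + real (card I)))"
  proof (rule eventually_outside_mono)
    show "eventually_outside (\<lambda>r. (r \<ge> 0 \<and> continuous_on (sphere 0 r) g) \<and>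
        (\<forall>i\<in>I. continuous_on (sphere 0 r) (G i)) \<and> (\<forall>z. norm z = r \<longrightarrow> norm (g z) \<le> (\<Sum>i\<in>I. norm (G i z))))"
      by (intro eventually_outside_conj eventually_outside_ball_finite I(1) eventually_continuous_circle g
            cosparse_imp_eventually_circle le eventually_outsideI eventually_ge_at_top)
         (use I(2) in \<open>auto simp: small_proximity_def\<close>)
  next
    fix r assume r: "(r \<ge> 0 \<and> continuous_on (sphere 0 r) g) \<and>
        (\<forall>i\<in>I. continuous_on (sphere 0 r) (G i)) \<and> (\<forall>z. norm z = r \<longrightarrow> norm (g z) \<le> (\<Sum>i\<in>I. norm (G i z)))"
    have "proximity r g \<le> circle_mean r (\<lambda>z. (\<Sum>i\<in>I. log_plus (norm (G i z))) + ln (1 + real (card I)))"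
      unfolding proximity_eq_circle_mean
    proof (intro circle_mean_mono continuous_intros)
      fix z :: complex assume "norm z = r"
      hence "log_plus (norm (g z)) \<le> log_plus (\<Sum>i\<in>I. norm (G i z))" using r by (intro log_plus_mono) auto
      also have "\<dots> \<le> (\<Sum>i\<in>I. log_plus (norm (G i z))) + ln (1 + real (card I))"
        by (intro log_plus_sum_le I(1)) auto
      finally show "log_plus (norm (g z)) \<le> (\<Sum>i\<in>I. log_plus (norm (G i z))) + ln (1 + real (card I))" .
    qed (use r in auto)
    also have "\<dots> = (\<Sum>i\<in>I. proximity r (G i)) + ln (1 + real (card I))"
      using r I(1) unfolding proximity_eq_circle_mean
      by (subst circle_mean_add) (auto intro!: continuous_intros circle_mean_sum)
    finally show "proximity r g \<le> (\<Sum>i\<in>I. proximity r (G i)) + ln (1 + real (card I))" .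
  qed
  ultimately have "(\<lambda>r. proximity r g) \<in> K" by (rule K_le)
  thus ?thesis using g by (simp add: small_proximity_def)
qed

lemma small_proximity_const: "small_proximity (\<lambda>_. c)"
  by (simp add: small_proximity_def proximity_eq_circle_mean K_const meromorphic_on_const)

lemma small_proximity_cong:
  assumes "small_proximity g" "f meromorphic_on UNIV" "\<forall>\<^sub>\<approx>z\<in>UNIV. f z = g z"
  shows "small_proximity f"
  by (rule small_proximity_dominated[of f "{()}" "\<lambda>_. g"]) (use assms in \<open>auto elim: eventually_mono\<close>)

lemma small_proximity_sum:
  assumes "finite I" "\<And>i. i \<in> I \<Longrightarrow> small_proximity (G i)"
  shows "small_proximity (\<lambda>z. \<Sum>i\<in>I. G i z)"
  by (rule small_proximity_dominated[of _ I G])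
     (use assms in \<open>auto intro!: meromorphic_intros always_eventually norm_sum simp: small_proximity_def\<close>)

lemma small_proximity_dominated2:
  assumes "g meromorphic_on UNIV" "small_proximity g1" "small_proximity g2"
    "\<forall>\<^sub>\<approx>z\<in>UNIV. norm (g z) \<le> norm (g1 z) + norm (g2 z)"
  shows "small_proximity g"
  by (rule small_proximity_dominated[of _ "UNIV :: bool set" "\<lambda>b. if b then g1 else g2"])
     (use assms in \<open>auto simp: UNIV_bool add.commute\<close>)

lemma small_proximity_add:
  "small_proximity f \<Longrightarrow> small_proximity g \<Longrightarrow> small_proximity (\<lambda>z. f z + g z)"
  by (rule small_proximity_dominated2[of _ f g])
     (auto intro!: meromorphic_intros always_eventually norm_triangle_ineq simp: small_proximity_def)

lemma small_proximity_diff: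
  "small_proximity f \<Longrightarrow> small_proximity g \<Longrightarrow> small_proximity (\<lambda>z. f z - g z)"
  by (rule small_proximity_dominated2[of _ f g])
     (auto intro!: meromorphic_intros always_eventually norm_triangle_ineq4 simp: small_proximity_def)

lemma small_proximity_mult:
  assumes "small_proximity f" "small_proximity g"
  shows "small_proximity (\<lambda>z. f z * g z)"
proof -
  have mero: "f meromorphic_on UNIV" "g meromorphic_on UNIV" using assms by (auto simp: small_proximity_def)
  have "(\<lambda>r. proximity r f + proximity r g) \<in> K" using assms by (intro K_add) (auto simp: small_proximity_def)
  moreover have "eventually_outside (\<lambda>r. proximity r (\<lambda>z. f z * g z) \<le> proximity r f + proximity r g)"
  proof (rule eventually_outside_mono)
    show "eventually_outside (\<lambda>r. r \<ge> 0 \<and> continuous_on (sphere 0 r) f \<and> continuous_on (sphere 0 r) g)"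
      by (intro eventually_outside_conj eventually_continuous_circle mero eventually_outsideI eventually_ge_at_top)
  next
    fix r assume r: "r \<ge> 0 \<and> continuous_on (sphere 0 r) f \<and> continuous_on (sphere 0 r) g"
    have "proximity r (\<lambda>z. f z * g z) \<le> circle_mean r (\<lambda>z. log_plus (norm (f z)) + log_plus (norm (g z)))"
      unfolding proximity_eq_circle_mean
      by (intro circle_mean_mono continuous_intros) (use r in \<open>auto simp: norm_mult log_plus_mult_le\<close>)
    also have "\<dots> = proximity r f + proximity r g"
      using r unfolding proximity_eq_circle_mean by (intro circle_mean_add continuous_intros) auto
    finally show "proximity r (\<lambda>z. f z * g z) \<le> proximity r f + proximity r g" .
  qed
  ultimately have "(\<lambda>r. proximity r (\<lambda>z. f z * g z)) \<in> K" by (rule K_le)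
  thus ?thesis using mero by (auto simp: small_proximity_def intro!: meromorphic_intros)
qed

lemma small_count_dominated2:
  assumes "g meromorphic_on UNIV" "small_count g1" "small_count g2"
    "\<And>a. pole_order g a \<le> pole_order g1 a + pole_order g2 a"
  shows "small_count g"
proof -
  have "(\<lambda>r. integrated_count r g1 + integrated_count r g2) \<in> K"
    using assms by (intro K_add) (auto simp: small_count_def)
  moreover have "eventually_outside (\<lambda>r. integrated_count r g \<le> integrated_count r g1 + integrated_count r g2)"
    by (rule eventually_outsideI, rule eventually_mono[OF eventually_ge_at_top[of 1]])
       (rule integrated_count_le_add, use assms in \<open>auto simp: small_count_def\<close>)
  ultimately have "(\<lambda>r. integrated_count r g) \<in> K" by (rule K_le)
  thus ?thesis using assms(1) by (simp add: small_count_def)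
qed

lemma small_count_mult: "small_count f \<Longrightarrow> small_count g \<Longrightarrow> small_count (\<lambda>z. f z * g z)"
  by (rule small_count_dominated2[of _ f g])
     (auto simp: small_count_def intro!: meromorphic_intros pole_order_mult_le meromorphic_on_UNIV_at)

lemma small_count_add: "small_count f \<Longrightarrow> small_count g \<Longrightarrow> small_count (\<lambda>z. f z + g z)"
  by (rule small_count_dominated2[of _ f g])
     (auto simp: small_count_def intro!: meromorphic_intros pole_order_add_le meromorphic_on_UNIV_at)

lemma small_count_deriv: "small_count g \<Longrightarrow> small_count (deriv g)"
  by (rule small_count_dominated2[of _ g g])
     (use pole_order_deriv_le[of g] in \<open>auto simp: small_count_def mult_2 intro!: meromorphic_intros dest: meromorphic_on_UNIV_at\<close>)

lemma small_count_logderiv: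
  assumes "small_count g" "small_count (\<lambda>z. 1 / g z)" "not_identically_zero g"
  shows "small_count (\<lambda>z. deriv g z / g z)"
  by (rule small_count_dominated2[OF _ assms(1,2)])
     (use assms in \<open>auto simp: small_count_def intro!: meromorphic_intros pole_order_logderiv_le meromorphic_on_UNIV_at eventually_nonzero_at\<close>)

lemma small_count_cong:
  assumes "small_count g" "f meromorphic_on UNIV" "\<forall>\<^sub>\<approx>z\<in>UNIV. f z = g z"
  shows "small_count f"
proof (rule small_count_dominated2[OF assms(2,1,1)])
  fix a have "\<forall>\<^sub>F z in at a. f z = g z" using assms(3) by (simp add: eventually_cosparse_open_eq)
  thus "pole_order f a \<le> pole_order g a + pole_order g a" using pole_order_cong by fastforce
qed

lemma small_count_entire:
  assumes "f holomorphic_on UNIV"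
  shows "small_count f"
proof -
  have an: "f analytic_on UNIV" using assms by (simp add: analytic_on_open)
  hence mero: "f meromorphic_on UNIV" by (rule analytic_on_imp_meromorphic_on)
  have "f analytic_on {z}" for z using an analytic_on_subset by blast
  hence np: "\<not> is_pole f z" for z using analytic_at_imp_no_pole by blast
  have "eventually_outside (\<lambda>r. integrated_count r f \<le> 0)"
  proof (rule eventually_outsideI, rule eventually_mono[OF eventually_gt_at_top[of 0]])
    fix r :: real assume "r > 0"
    thus "integrated_count r f \<le> 0" using integrated_count_eq_sum[of "{}" r f] np by simp
  qed
  thus ?thesis using K_le[OF K_const] mero by (simp add: small_count_def)
qed

lemma small_count_diff:
  assumes "small_count f" "small_count g"
  shows "small_count (\<lambda>z. f z - g z)"
proof (rule small_count_dominated2[OF _ assms])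
  show "(\<lambda>z. f z - g z) meromorphic_on UNIV" using assms by (auto simp: small_count_def intro!: meromorphic_intros)
  show "pole_order (\<lambda>z. f z - g z) a \<le> pole_order f a + pole_order g a" for a
    using pole_order_add_le[of f a "\<lambda>z. - g z"] assms
    by (simp add: pole_order_uminus small_count_def meromorphic_on_UNIV_at meromorphic_on_uminus)
qed

lemma small_count_sum:
  assumes "finite I" "\<And>i. i \<in> I \<Longrightarrow> small_count (G i)"
  shows "small_count (\<lambda>z. \<Sum>i\<in>I. G i z)"
  using assms
proof (induction I rule: finite_induct)
  case empty
  thus ?case using small_count_entire[of "\<lambda>_. 0"] by simp
next
  case (insert i I)
  thus ?case using small_count_add[of "G i" "\<lambda>z. \<Sum>i\<in>I. G i z"] by simp
qed

text \<open>The first main theorem bounds the sum of m and N for 1/g; as both are nonnegative, each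
  is bounded by it.\<close>

lemma small_inverse:
  assumes "small_proximity g" "small_count g" "not_identically_zero g"
  shows "small_proximity (\<lambda>z. 1 / g z)" "small_count (\<lambda>z. 1 / g z)"
proof -
  have mero: "g meromorphic_on UNIV" using assms by (auto simp: small_proximity_def)
  have mero': "(\<lambda>z. 1 / g z) meromorphic_on UNIV" by (intro meromorphic_intros mero)
  define u where "u = (\<lambda>r. proximity r g + integrated_count r g + \<bar>ln (norm (zor_poly g 0 0))\<bar>)"
  have u: "u \<in> K" unfolding u_def using assms by (intro K_add K_const) (auto simp: small_proximity_def small_count_def)
  have *: "eventually_outside (\<lambda>r. proximity r (\<lambda>z. 1 / g z) \<le> u r \<and> integrated_count r (\<lambda>z. 1 / g z) \<le> u r)"
  proof (rule eventually_outside_mono)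
    show "eventually_outside (\<lambda>r. r \<ge> 1 \<and> regular_circle r g)"
      by (intro eventually_outside_conj eventually_regular_circle mero assms eventually_outsideI eventually_ge_at_top)
  next
    fix r assume r: "r \<ge> 1 \<and> regular_circle r g"
    hence "integrated_count r (\<lambda>z. 1 / g z) \<ge> 0" "proximity r (\<lambda>z. 1 / g z) \<ge> 0"
      by (auto intro!: integrated_count_nonneg proximity_nonneg mero' regular_circle_continuous_inverse)
    moreover have "proximity r (\<lambda>z. 1 / g z) + integrated_count r (\<lambda>z. 1 / g z) =
        proximity r g + integrated_count r g - ln (norm (zor_poly g 0 0))"
      using first_main_theorem[OF mero assms(3), of r] r by (simp add: characteristic_def)
    ultimately show "proximity r (\<lambda>z. 1 / g z) \<le> u r \<and> integrated_count r (\<lambda>z. 1 / g z) \<le> u r"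
      unfolding u_def by (intro conjI; linarith)
  qed
  have "(\<lambda>r. proximity r (\<lambda>z. 1 / g z)) \<in> K" "(\<lambda>r. integrated_count r (\<lambda>z. 1 / g z)) \<in> K"
    by (rule K_le[OF u], rule eventually_outside_mono[OF *], simp)+
  thus "small_proximity (\<lambda>z. 1 / g z)" "small_count (\<lambda>z. 1 / g z)"
    using mero' by (auto simp: small_proximity_def small_count_def)
qed

end

subsection \<open>Entire functions of finite order\<close>

lemma schwarz_bound_nonneg:
  assumes "regular_circle R g" "R > 0"
  shows "schwarz_bound R s g \<ge> 0"
proof -
  have "circle_mean R (\<lambda>z. \<bar>ln (norm (g z))\<bar>) \<ge> 0"
    using assms regular_circle_continuous[OF assms(1)]
    by (intro circle_mean_nonneg continuous_intros) (auto simp: regular_circle_def)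
  thus ?thesis using assms(2) by (simp add: schwarz_bound_def)
qed

lemma powr_le_of_log_plus:
  assumes "log_plus x \<le> s * ln r" "r > 0"
  shows "x \<le> r powr s"
proof -
  have "x \<le> exp (log_plus x)" by (rule le_exp_log_plus)
  also have "\<dots> \<le> exp (s * ln r)" using assms(1) by simp
  finally show ?thesis using assms(2) by (simp add: powr_def)
qed

lemma not_identically_zero_holomorphic:
  assumes "f holomorphic_on UNIV" "f z \<noteq> 0"
  shows "not_identically_zero f"
  unfolding not_identically_zero_def
proof
  assume "\<forall>\<^sub>\<approx>z\<in>UNIV. f z = 0"
  hence "\<forall>\<^sub>F w in at z. f w = 0" by (simp add: eventually_cosparse_open_eq)
  moreover have "isCont f z" using assms(1) by (intro analytic_at_imp_isCont) (auto simp: analytic_at)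
  ultimately have "f z = 0"
    using LIM_unique[OF _ tendsto_eventually] unfolding isCont_def by blast
  thus False using assms(2) by simp
qed

text \<open>Cauchy's inequalities kill all Taylor coefficients beyond degree \<open>N\<close>.
  Arbitrarily large radii suffice for this, which is all that the negation of an eventual bound
  supplies.\<close>

lemma polynomial_growth_imp_polynomial:
  assumes f: "f holomorphic_on UNIV"
    and bnd: "\<And>x. \<exists>s\<ge>x. s \<ge> 1 \<and> (\<forall>z. norm z = s \<longrightarrow> norm (f z) \<le> B * s ^ N)"
  shows "\<exists>p. \<forall>z. f z = poly p z"
proof -
  have zero: "(deriv ^^ n) f 0 = 0" if n: "n > N" for n
  proof (rule ccontr)
    assume nz: "(deriv ^^ n) f 0 \<noteq> 0"
    define q where "q = norm ((deriv ^^ n) f 0)"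
    have q: "q > 0" using nz by (simp add: q_def)
    obtain s where s: "s \<ge> fact n * \<bar>B\<bar> / q + 1" "s \<ge> 1" "\<And>z. norm z = s \<Longrightarrow> norm (f z) \<le> B * s ^ N"
      using bnd by blast
    have "q \<le> fact n * (B * s ^ N) / s ^ n" unfolding q_def
      by (rule Cauchy_inequality)
         (use f s in \<open>auto intro: holomorphic_on_subset holomorphic_on_imp_continuous_on\<close>)
    also have "\<dots> \<le> fact n * (\<bar>B\<bar> * s ^ N) / s ^ n"
      using s(2) by (intro divide_right_mono mult_left_mono mult_right_mono) auto
    also have "s ^ n = s ^ N * s ^ (n - N)" using n by (simp flip: power_add)
    also have "fact n * (\<bar>B\<bar> * s ^ N) / (s ^ N * s ^ (n - N)) = fact n * \<bar>B\<bar> / s ^ (n - N)" using s(2) by simp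
    also have "\<dots> \<le> fact n * \<bar>B\<bar> / s"
      using s(2) n self_le_power[of s "n - N"] by (intro divide_left_mono) auto
    finally have "q * s \<le> fact n * \<bar>B\<bar>" using s(2) by (simp add: field_simps)
    moreover have "q * s \<ge> fact n * \<bar>B\<bar> + q"
      using mult_left_mono[OF s(1), of q] q by (simp add: distrib_left)
    ultimately show False using q by linarith
  qed
  define p where "p = (\<Sum>n\<le>N. monom ((deriv ^^ n) f 0 / fact n) n)"
  have "f z = poly p z" for z
  proof (rule sums_unique2)
    show "(\<lambda>n. (deriv ^^ n) f 0 / fact n * z ^ n) sums f z"
      using holomorphic_power_series[of f 0 "norm z + 1" z] f by (auto intro: holomorphic_on_subset)
    have "(\<lambda>n. (deriv ^^ n) f 0 / fact n * z ^ n) sums (\<Sum>n\<le>N. (deriv ^^ n) f 0 / fact n * z ^ n)"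
      by (rule sums_finite) (auto simp: zero)
    thus "(\<lambda>n. (deriv ^^ n) f 0 / fact n * z ^ n) sums poly p z"
      by (simp add: p_def poly_sum poly_monom)
  qed
  thus ?thesis by blast
qed

locale finite_order_entire =
  fixes f :: "complex \<Rightarrow> complex" and \<rho> :: real
  assumes transcendental: "transcendental_entire f" and order: "growth_order f = ereal \<rho>"
begin

abbreviation T :: "real \<Rightarrow> real" where
  "T r \<equiv> characteristic r f"

lemma holo: "f holomorphic_on UNIV"
  using transcendental by (simp add: transcendental_entire_def)

lemma analytic: "f analytic_on {z}"
  using holo by (auto simp: analytic_at)

lemma mero: "f meromorphic_on UNIV"
  using holo by (simp add: analytic_on_imp_meromorphic_on analytic_on_open)

lemma nonzero: "not_identically_zero f"
proof -
  have "\<exists>z. f z \<noteq> 0"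
    using transcendental unfolding transcendental_entire_def by (metis poly_0)
  thus ?thesis using not_identically_zero_holomorphic[OF holo] by blast
qed

lemma continuous: "continuous_on A f"
  using holo holomorphic_on_imp_continuous_on continuous_on_subset by blast

lemma T_eq: "r > 0 \<Longrightarrow> T r = proximity r f"
  using integrated_count_eq_sum[of "{}" r f] analytic analytic_at_imp_no_pole[of f]
  by (simp add: characteristic_def)

lemma T_nonneg: "r > 0 \<Longrightarrow> T r \<ge> 0"
  by (simp add: T_eq proximity_nonneg continuous)

text \<open>The mean of log |f| is at most T(R). For 2 s \<le> R the second exponent of
  \<open>norm_entire_le_circle_mean\<close> is at most four times the mean of |log |f||, that is 4
  (2 T(R) + c), so the total is 9 T(R) + 4 c.\<close>

lemma max_modulus_le:
  obtains C where "C \<ge> 0"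
    "\<And>R s z. regular_circle R f \<Longrightarrow> R \<ge> 1 \<Longrightarrow> 2 * s \<le> R \<Longrightarrow> norm z \<le> s \<Longrightarrow> norm (f z) \<le> exp (9 * T R + C)"
proof (rule that[of "4 * \<bar>ln (norm (zor_poly f 0 0))\<bar>"])
  fix R s and z :: complex
  assume R: "regular_circle R f" "R \<ge> 1" "2 * s \<le> R" and z: "norm z \<le> s"
  define c where "c = \<bar>ln (norm (zor_poly f 0 0))\<bar>"
  define M where "M = circle_mean R (\<lambda>z. \<bar>ln (norm (f z))\<bar>)"
  have s0: "s \<ge> 0" using z norm_ge_zero order_trans by blast
  have M: "0 \<le> M" "M \<le> 2 * T R + c"
  proof -
    show "M \<ge> 0" unfolding M_def
      using R regular_circle_continuous[OF R(1)] by (intro circle_mean_nonneg continuous_intros) (auto simp: regular_circle_def)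
    show "M \<le> 2 * T R + c" unfolding M_def c_def by (rule circle_mean_abs_ln_le[OF mero nonzero R(2,1)])
  qed
  have "circle_mean R (\<lambda>z. ln (norm (f z))) \<le> T R"
    using circle_mean_ln_norm(1)[OF R(1)] R(2) T_eq[of R]
      proximity_nonneg[OF regular_circle_continuous_inverse[OF R(1)]] by simp
  moreover have "s * schwarz_bound R s f \<le> 4 * M"
  proof -
    have "(R / 2)\<^sup>2 \<le> (R - s)\<^sup>2" using R by (intro power_mono) auto
    hence "s * (2 * R) / (R - s)\<^sup>2 \<le> (R / 2) * (2 * R) / (R / 2)\<^sup>2"
      using R s0 by (intro frac_le mult_right_mono) auto
    also have "\<dots> = 4" using R by (simp add: field_simps power2_eq_square)
    finally have "s * (2 * R) / (R - s)\<^sup>2 * M \<le> 4 * M" using M(1) by (rule mult_right_mono)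
    thus ?thesis by (simp add: schwarz_bound_def M_def)
  qed
  moreover have "s < R" using R by linarith
  hence "norm (f z) \<le> exp (circle_mean R (\<lambda>z. ln (norm (f z))) + s * schwarz_bound R s f)"
    by (rule norm_entire_le_circle_mean[OF holo nonzero _ R(1) z])
  ultimately have "norm (f z) \<le> exp (9 * T R + 4 * c)"
    using M(2) by (smt (verit) exp_le_cancel_iff)
  thus "norm (f z) \<le> exp (9 * T R + 4 * \<bar>ln (norm (zor_poly f 0 0))\<bar>)" by (simp add: c_def)
qed auto

text \<open>A substitute for the monotonicity of \<open>T\<close>, read off from the maximum modulus
  bound; it moves estimates from exceptional radii to regular ones.\<close>

lemma T_le_T:
  obtains C where "C \<ge> 0"
    "\<And>R s. regular_circle R f \<Longrightarrow> R \<ge> 1 \<Longrightarrow> s > 0 \<Longrightarrow> 2 * s \<le> R \<Longrightarrow> T s \<le> 9 * T R + C"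
proof -
  obtain C where C: "C \<ge> 0"
    "\<And>R s z. regular_circle R f \<Longrightarrow> R \<ge> 1 \<Longrightarrow> 2 * s \<le> R \<Longrightarrow> norm z \<le> s \<Longrightarrow> norm (f z) \<le> exp (9 * T R + C)"
    using max_modulus_le by blast
  show ?thesis
  proof (rule that[OF C(1)])
    fix R s :: real assume R: "regular_circle R f" "R \<ge> 1" "s > 0" "2 * s \<le> R"
    have "proximity s f \<le> circle_mean s (\<lambda>_. 9 * T R + C)"
      unfolding proximity_eq_circle_mean
      using C(2)[OF R(1,2,4)] C(1) T_nonneg[of R] R
      by (intro circle_mean_mono continuous_intros continuous log_plus_le add_nonneg_nonneg) auto
    thus "T s \<le> 9 * T R + C" using R by (simp add: T_eq)
  qed
qed

text \<open>If T(r) < B log r held for arbitrarily large regular radii, \<open>f\<close> would grow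
  polynomially on a sequence of circles and be a polynomial.\<close>

lemma ln_le_T: "eventually_outside (\<lambda>r. B * ln r \<le> T r)"
proof -
  obtain C where C: "C \<ge> 0"
    "\<And>R s z. regular_circle R f \<Longrightarrow> R \<ge> 1 \<Longrightarrow> 2 * s \<le> R \<Longrightarrow> norm z \<le> s \<Longrightarrow> norm (f z) \<le> exp (9 * T R + C)"
    using max_modulus_le by blast
  obtain E where E: "finite_log_measure E" "\<forall>\<^sub>F r in at_top. r \<notin> E \<longrightarrow> regular_circle r f"
    using eventually_regular_circle[OF mero nonzero] by (auto simp: eventually_outside_def)
  have "\<forall>\<^sub>F r in at_top. r \<notin> E \<longrightarrow> B * ln r \<le> T r"
  proof (rule ccontr)
    assume "\<not> ?thesis"
    hence fr: "\<exists>\<^sub>F r in at_top. r \<notin> E \<and> T r < B * ln r" by (simp add: not_eventually not_le)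
    \<comment> \<open>The 9 comes from the maximum modulus bound exp (9 T(r) + C).\<close>
    define N where "N = nat \<lceil>9 * B\<rceil>"
    have "\<exists>p. \<forall>z. f z = poly p z"
    proof (rule polynomial_growth_imp_polynomial[OF holo])
      fix x :: real
      have "\<forall>\<^sub>F r in at_top. r \<ge> 2 * \<bar>x\<bar> + 2" by (rule eventually_ge_at_top)
      from frequently_eventually_conj[OF fr eventually_conj[OF this E(2)]]
      obtain r where r: "r \<notin> E" "T r < B * ln r" "r \<ge> 2 * \<bar>x\<bar> + 2" "regular_circle r f"
        by (auto dest!: frequently_ex)
      define s where "s = r / 2"
      have "norm (f z) \<le> exp C * 2 ^ N * s ^ N" if "norm z = s" for z
      proof -
        have "norm (f z) \<le> exp (9 * T r + C)" using C(2)[OF r(4), of s z] r(3) that by (simp add: s_def)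
        also have "9 * T r \<le> real N * ln r"
        proof -
          have "9 * T r \<le> 9 * B * ln r" using r(2) by simp
          also have "\<dots> \<le> real N * ln r"
            using r(3) by (intro mult_right_mono) (auto simp: N_def intro: order_trans[OF le_of_int_ceiling])
          finally show ?thesis .
        qed
        hence "exp (9 * T r + C) \<le> exp C * exp (real N * ln r)" by (simp flip: exp_add)
        also have "exp (real N * ln r) = r ^ N" using r(3) by (simp add: exp_of_nat_mult)
        finally show ?thesis by (simp add: s_def power_divide)
      qed
      thus "\<exists>s\<ge>x. s \<ge> 1 \<and> (\<forall>z. norm z = s \<longrightarrow> norm (f z) \<le> exp C * 2 ^ N * s ^ N)"
        using r(3) by (intro exI[of _ s]) (auto simp: s_def)
    qed
    thus False using transcendental by (simp add: transcendental_entire_def)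
  qed
  thus ?thesis using E(1) by (auto simp: eventually_outside_def)
qed

section \<open>The order of \<open>f\<close> and the two error classes\<close>

lemma order_nonneg: "\<rho> \<ge> 0"
proof -
  have "\<forall>\<^sub>F r in at_top. 0 \<le> ereal (log_plus (T r) / ln r)"
    by (rule eventually_mono[OF eventually_gt_at_top[of 1]]) (simp add: log_plus_nonneg)
  hence "0 \<le> growth_order f" unfolding growth_order_def by (intro le_Limsup) auto
  thus ?thesis by (simp add: order)
qed

lemma T_le_powr:
  assumes "\<epsilon> > 0"
  shows "\<forall>\<^sub>F r in at_top. T r \<le> r powr (\<rho> + \<epsilon>)"
proof -
  have "growth_order f < ereal (\<rho> + \<epsilon>)" using assms by (simp add: order)
  hence "\<forall>\<^sub>F r in at_top. ereal (log_plus (T r) / ln r) < ereal (\<rho> + \<epsilon>)"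
    unfolding growth_order_def by (rule Limsup_lessD)
  thus ?thesis using eventually_gt_at_top[of 1]
  proof eventually_elim
    case (elim r)
    hence "log_plus (T r) \<le> (\<rho> + \<epsilon>) * ln r" by (simp add: divide_less_eq)
    thus ?case using elim by (intro powr_le_of_log_plus) auto
  qed
qed

text \<open>The upper-bound form of O(r^\<sigma>) + S(r, f) for some \<sigma> < \<rho>. Since
  \<sigma> is chosen before \<eta>, while the constant and the exceptional set may depend on \<eta>,
  no single exceptional set for the little-o has to be constructed.\<close>

definition negligible :: "(real \<Rightarrow> real) set" where
  "negligible = {u. \<exists>\<sigma><\<rho>. \<forall>\<eta>>0. \<exists>C. eventually_outside (\<lambda>r. u r \<le> \<eta> * T r + C * r powr \<sigma>)}"

text \<open>The class for \<open>f\<close> itself and for functions built from it, which are not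
  small but whose logarithmic derivatives are.\<close>

definition order_le :: "(real \<Rightarrow> real) set" where
  "order_le = {u. \<forall>\<epsilon>>0. \<exists>C. eventually_outside (\<lambda>r. u r \<le> C * r powr (\<rho> + \<epsilon>))}"

sublocale neg: growth_class negligible
proof
  fix u v assume uv: "u \<in> negligible" "v \<in> negligible"
  obtain \<sigma> where \<sigma>: "\<sigma> < \<rho>" "\<And>\<eta>. \<eta> > 0 \<Longrightarrow> \<exists>C. eventually_outside (\<lambda>r. u r \<le> \<eta> * T r + C * r powr \<sigma>)"
    using uv(1) by (auto simp: negligible_def)
  obtain \<tau> where \<tau>: "\<tau> < \<rho>" "\<And>\<eta>. \<eta> > 0 \<Longrightarrow> \<exists>C. eventually_outside (\<lambda>r. v r \<le> \<eta> * T r + C * r powr \<tau>)"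
    using uv(2) by (auto simp: negligible_def)
  have "\<exists>C. eventually_outside (\<lambda>r. u r + v r \<le> \<eta> * T r + C * r powr (max \<sigma> \<tau>))" if "\<eta> > 0" for \<eta>
  proof -
    obtain C where C: "eventually_outside (\<lambda>r. u r \<le> \<eta> / 2 * T r + C * r powr \<sigma>)" using \<sigma>(2)[of "\<eta> / 2"] \<open>\<eta> > 0\<close> by auto
    obtain D where D: "eventually_outside (\<lambda>r. v r \<le> \<eta> / 2 * T r + D * r powr \<tau>)" using \<tau>(2)[of "\<eta> / 2"] \<open>\<eta> > 0\<close> by auto
    have "eventually_outside (\<lambda>r. u r + v r \<le> \<eta> * T r + (\<bar>C\<bar> + \<bar>D\<bar>) * r powr (max \<sigma> \<tau>))"
    proof (rule eventually_outside_mono[OF eventually_outside_conj[OF eventually_outside_conj[OF C D] eventually_outsideI[OF eventually_ge_at_top[of 1]]]])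
      fix r assume r: "(u r \<le> \<eta> / 2 * T r + C * r powr \<sigma> \<and> v r \<le> \<eta> / 2 * T r + D * r powr \<tau>) \<and> 1 \<le> r"
      have "C * r powr \<sigma> \<le> \<bar>C\<bar> * r powr (max \<sigma> \<tau>)" "D * r powr \<tau> \<le> \<bar>D\<bar> * r powr (max \<sigma> \<tau>)"
        using r by (intro mult_mono powr_mono; simp)+
      thus "u r + v r \<le> \<eta> * T r + (\<bar>C\<bar> + \<bar>D\<bar>) * r powr (max \<sigma> \<tau>)"
        using r by (simp add: distrib_right)
    qed
    thus ?thesis by blast
  qed
  moreover have "max \<sigma> \<tau> < \<rho>" using \<sigma>(1) \<tau>(1) by simp
  ultimately show "(\<lambda>r. u r + v r) \<in> negligible" unfolding negligible_def by blast
next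
  fix u v assume u: "u \<in> negligible" and le: "eventually_outside (\<lambda>r. v r \<le> u r)"
  obtain \<sigma> where \<sigma>: "\<sigma> < \<rho>" "\<And>\<eta>. \<eta> > 0 \<Longrightarrow> \<exists>C. eventually_outside (\<lambda>r. u r \<le> \<eta> * T r + C * r powr \<sigma>)"
    using u by (auto simp: negligible_def)
  have "\<exists>C. eventually_outside (\<lambda>r. v r \<le> \<eta> * T r + C * r powr \<sigma>)" if "\<eta> > 0" for \<eta>
  proof -
    obtain C where C: "eventually_outside (\<lambda>r. u r \<le> \<eta> * T r + C * r powr \<sigma>)" using \<sigma>(2) \<open>\<eta> > 0\<close> by auto
    from eventually_outside_mono[OF eventually_outside_conj[OF this le], of "\<lambda>r. v r \<le> \<eta> * T r + C * r powr \<sigma>"]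
    show ?thesis by force
  qed
  thus "v \<in> negligible" using \<sigma>(1) unfolding negligible_def by auto
next
  fix c :: real
  \<comment> \<open>The constant goes entirely into \<eta> T(r): for \<rho> = 0 it is not
    O(r^\<sigma>) with \<sigma> < 0. The exponent \<rho> - 1 is just some number below
    \<rho>.\<close>
  have "eventually_outside (\<lambda>r. c \<le> \<eta> * T r + 0 * r powr (\<rho> - 1))" if \<eta>: "\<eta> > 0" for \<eta>
  proof (rule eventually_outside_mono[OF eventually_outside_conj[OF ln_le_T[of "\<bar>c\<bar> / \<eta>"] eventually_outsideI[OF eventually_ge_at_top[of "exp 1"]]]])
    fix r assume r: "\<bar>c\<bar> / \<eta> * ln r \<le> T r \<and> exp 1 \<le> r"
    have "1 \<le> ln r" using r by (subst ln_ge_iff) (auto intro: less_le_trans[OF exp_gt_zero])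
    hence "\<bar>c\<bar> / \<eta> * 1 \<le> \<bar>c\<bar> / \<eta> * ln r" using \<eta> by (intro mult_left_mono) auto
    also have "\<dots> \<le> T r" using r by simp
    finally have "\<bar>c\<bar> \<le> \<eta> * T r" using \<eta> by (simp add: field_simps)
    thus "c \<le> \<eta> * T r + 0 * r powr (\<rho> - 1)" by simp
  qed
  hence *: "\<forall>\<eta>>0. \<exists>C. eventually_outside (\<lambda>r. c \<le> \<eta> * T r + C * r powr (\<rho> - 1))" by blast
  show "(\<lambda>_. c) \<in> negligible" unfolding negligible_def
    by (rule CollectI, rule exI[of _ "\<rho> - 1"], rule conjI, simp, rule *)
qed

sublocale ord: growth_class order_le
proof
  fix u v assume uv: "u \<in> order_le" "v \<in> order_le"
  show "(\<lambda>r. u r + v r) \<in> order_le" unfolding order_le_def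
  proof (clarify)
    fix \<epsilon> :: real assume "\<epsilon> > 0"
    obtain C where C: "eventually_outside (\<lambda>r. u r \<le> C * r powr (\<rho> + \<epsilon>))"
      using uv(1) \<open>\<epsilon> > 0\<close> unfolding order_le_def by blast
    obtain D where D: "eventually_outside (\<lambda>r. v r \<le> D * r powr (\<rho> + \<epsilon>))"
      using uv(2) \<open>\<epsilon> > 0\<close> unfolding order_le_def by blast
    have "eventually_outside (\<lambda>r. u r + v r \<le> (C + D) * r powr (\<rho> + \<epsilon>))"
      by (rule eventually_outside_mono[OF eventually_outside_conj[OF C D]]) (simp add: distrib_right)
    thus "\<exists>C. eventually_outside (\<lambda>r. u r + v r \<le> C * r powr (\<rho> + \<epsilon>))" by blast
  qed
next
  fix u v assume u: "u \<in> order_le" and le: "eventually_outside (\<lambda>r. v r \<le> u r)"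
  show "v \<in> order_le" unfolding order_le_def
  proof (clarify)
    fix \<epsilon> :: real assume "\<epsilon> > 0"
    then obtain C where C: "eventually_outside (\<lambda>r. u r \<le> C * r powr (\<rho> + \<epsilon>))" using u by (auto simp: order_le_def)
    have "eventually_outside (\<lambda>r. v r \<le> C * r powr (\<rho> + \<epsilon>))"
      by (rule eventually_outside_mono[OF eventually_outside_conj[OF C le]]) simp
    thus "\<exists>C. eventually_outside (\<lambda>r. v r \<le> C * r powr (\<rho> + \<epsilon>))" by blast
  qed
next
  fix c :: real
  show "(\<lambda>_. c) \<in> order_le" unfolding order_le_def
  proof (clarify)
    fix \<epsilon> :: real assume \<epsilon>: "\<epsilon> > 0"
    have "eventually_outside (\<lambda>r. c \<le> \<bar>c\<bar> * r powr (\<rho> + \<epsilon>))"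
    proof (rule eventually_outsideI, rule eventually_mono[OF eventually_ge_at_top[of 1]])
      fix r :: real assume "r \<ge> 1"
      hence "\<bar>c\<bar> * 1 \<le> \<bar>c\<bar> * r powr (\<rho> + \<epsilon>)" using \<epsilon> order_nonneg by (intro mult_left_mono ge_one_powr_ge_zero) auto
      thus "c \<le> \<bar>c\<bar> * r powr (\<rho> + \<epsilon>)" by simp
    qed
    thus "\<exists>C. eventually_outside (\<lambda>r. c \<le> C * r powr (\<rho> + \<epsilon>))" by blast
  qed
qed

lemma T_order_le: "T \<in> order_le"
  unfolding order_le_def
proof (clarify)
  fix \<epsilon> :: real assume "\<epsilon> > 0"
  hence "eventually_outside (\<lambda>r. T r \<le> 1 * r powr (\<rho> + \<epsilon>))"
    using T_le_powr by (intro eventually_outsideI) simp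
  thus "\<exists>C. eventually_outside (\<lambda>r. T r \<le> C * r powr (\<rho> + \<epsilon>))" by blast
qed

lemma negligible_subset_order_le: "negligible \<subseteq> order_le"
proof
  fix u assume "u \<in> negligible"
  then obtain \<sigma> C where C: "\<sigma> < \<rho>" "eventually_outside (\<lambda>r. u r \<le> 1 * T r + C * r powr \<sigma>)"
    unfolding negligible_def using zero_less_one by blast
  have "(\<lambda>r. \<bar>C\<bar> * r powr \<rho>) \<in> order_le" unfolding order_le_def
  proof (clarify)
    fix \<epsilon> :: real assume \<epsilon>: "\<epsilon> > 0"
    have "eventually_outside (\<lambda>r. \<bar>C\<bar> * r powr \<rho> \<le> \<bar>C\<bar> * r powr (\<rho> + \<epsilon>))"
      by (rule eventually_outsideI, rule eventually_mono[OF eventually_ge_at_top[of 1]])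
         (use \<epsilon> in \<open>auto intro!: mult_left_mono powr_mono\<close>)
    thus "\<exists>D. eventually_outside (\<lambda>r. \<bar>C\<bar> * r powr \<rho> \<le> D * r powr (\<rho> + \<epsilon>))" by blast
  qed
  hence "(\<lambda>r. T r + \<bar>C\<bar> * r powr \<rho>) \<in> order_le" by (intro ord.K_add T_order_le)
  moreover have "eventually_outside (\<lambda>r. u r \<le> T r + \<bar>C\<bar> * r powr \<rho>)"
  proof (rule eventually_outside_mono[OF eventually_outside_conj[OF C(2) eventually_outsideI[OF eventually_ge_at_top[of 1]]]])
    fix r assume r: "u r \<le> 1 * T r + C * r powr \<sigma> \<and> 1 \<le> r"
    have "C * r powr \<sigma> \<le> \<bar>C\<bar> * r powr \<rho>" using r C(1) by (intro mult_mono powr_mono) auto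
    thus "u r \<le> T r + \<bar>C\<bar> * r powr \<rho>" using r by simp
  qed
  ultimately show "u \<in> order_le" by (rule ord.K_le)
qed

text \<open>Taking \<eta> = 1/2 leaves T(r) = O(r^\<sigma>) off an exceptional set. For \<sigma> < 0
  this bounds \<open>T\<close> at large good radii, against \<open>ln_le_T\<close>. Otherwise choose
  \<tau> between \<sigma> and \<rho>: T(r) > r^\<tau> for arbitrarily large r, while a good R in
  [2 r, 3 r] gives T(r) \<le> 9 T(R) + D = O(r^\<sigma>).\<close>

lemma T_not_negligible: "T \<notin> negligible"
proof
  assume "T \<in> negligible"
  then obtain \<sigma> C where \<sigma>: "\<sigma> < \<rho>" and C: "eventually_outside (\<lambda>r. T r \<le> 1 / 2 * T r + C * r powr \<sigma>)"
    unfolding negligible_def using half_gt_zero[OF zero_less_one] by blast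
  show False
  proof (cases "\<sigma> < 0")
    case True
    have "eventually_outside (\<lambda>r. (T r \<le> 1 / 2 * T r + C * r powr \<sigma> \<and> (2 * \<bar>C\<bar> + 1) * ln r \<le> T r) \<and> r \<ge> exp 1)"
      by (intro eventually_outside_conj C ln_le_T eventually_outsideI eventually_ge_at_top)
    from eventually_ex_outside[OF this] obtain r where r: "T r \<le> 1 / 2 * T r + C * r powr \<sigma>" "(2 * \<bar>C\<bar> + 1) * ln r \<le> T r" "r \<ge> exp 1"
      by (auto simp: eventually_at_top_linorder)
    have r1: "r \<ge> 1" using r(3) one_le_exp_iff[of 1] by linarith
    have "1 \<le> ln r" using r(3) r1 by (subst ln_ge_iff) auto
    hence "(2 * \<bar>C\<bar> + 1) * 1 \<le> (2 * \<bar>C\<bar> + 1) * ln r" by (intro mult_left_mono) auto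
    hence "2 * \<bar>C\<bar> + 1 \<le> T r" using r(2) by simp
    moreover have "r powr \<sigma> \<le> 1" using r1 True powr_mono[of \<sigma> 0 r] by simp
    hence "C * r powr \<sigma> \<le> \<bar>C\<bar> * 1" by (intro mult_mono) auto
    ultimately show False using r(1) by linarith
  next
    case False
    define \<tau> where "\<tau> = (\<sigma> + \<rho>) / 2"
    have \<tau>: "\<sigma> < \<tau>" "\<tau> < \<rho>" "\<tau> > 0" using \<sigma> False by (auto simp: \<tau>_def)
    obtain D where D: "D \<ge> 0" "\<And>R s. regular_circle R f \<Longrightarrow> R \<ge> 1 \<Longrightarrow> s > 0 \<Longrightarrow> 2 * s \<le> R \<Longrightarrow> T s \<le> 9 * T R + D"
      using T_le_T by blast
    have fr: "\<exists>\<^sub>F r in at_top. \<not> ereal (log_plus (T r) / ln r) \<le> ereal \<tau>"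
      unfolding frequently_def
    proof
      assume "\<forall>\<^sub>F r in at_top. \<not> \<not> ereal (log_plus (T r) / ln r) \<le> ereal \<tau>"
      hence "growth_order f \<le> ereal \<tau>" unfolding growth_order_def by (intro Limsup_bounded) simp
      thus False using \<tau>(2) by (simp add: order)
    qed
    have "eventually_outside (\<lambda>r. T r \<le> 1 / 2 * T r + C * r powr \<sigma> \<and> regular_circle r f)"
      by (intro eventually_outside_conj C eventually_regular_circle mero nonzero)
    note ex = eventually_ex_outside[OF this]
    \<comment> \<open>18 is the 9 of \<open>T_le_T\<close> times the 2 from absorbing T(R) / 2, and
      \<open>3 powr \<sigma>\<close> comes from R \<le> 3 r.\<close>
    have "((\<lambda>r. 18 * \<bar>C\<bar> * 3 powr \<sigma> * r powr (\<sigma> - \<tau>) + D * r powr (- \<tau>)) \<longlongrightarrow> 18 * \<bar>C\<bar> * 3 powr \<sigma> * 0 + D * 0) at_top"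
      by (intro tendsto_intros tendsto_neg_powr filterlim_ident) (use \<tau> in auto)
    hence lim: "\<forall>\<^sub>F r in at_top. 18 * \<bar>C\<bar> * 3 powr \<sigma> * r powr (\<sigma> - \<tau>) + D * r powr (- \<tau>) < 1"
      by (intro order_tendstoD(2)) auto
    from frequently_eventually_conj[OF fr eventually_conj[OF ex eventually_conj[OF lim eventually_gt_at_top[of 1]]]]
    obtain r where r0: "\<not> ereal (log_plus (T r) / ln r) \<le> ereal \<tau>"
      "\<exists>R\<in>{2 * r..3 * r}. T R \<le> 1 / 2 * T R + C * R powr \<sigma> \<and> regular_circle R f"
      "18 * \<bar>C\<bar> * 3 powr \<sigma> * r powr (\<sigma> - \<tau>) + D * r powr (- \<tau>) < 1" "r > 1"
      using frequently_ex by blast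
    from r0(2) obtain R where R: "2 * r \<le> R" "R \<le> 3 * r" "T R \<le> 1 / 2 * T R + C * R powr \<sigma>" "regular_circle R f"
      by auto
    have r: "log_plus (T r) / ln r > \<tau>" "r > 1" "2 * r \<le> R" "R \<le> 3 * r" "T R \<le> 1 / 2 * T R + C * R powr \<sigma>"
      "regular_circle R f" "18 * \<bar>C\<bar> * 3 powr \<sigma> * r powr (\<sigma> - \<tau>) + D * r powr (- \<tau>) < 1"
      using r0(1,3,4) R by (simp_all add: not_le)
    have "log_plus (T r) > \<tau> * ln r" using r(1,2) by (simp add: less_divide_eq)
    hence gt: "exp (log_plus (T r)) > r powr \<tau>" using r(2) by (simp add: powr_def)
    moreover have "r powr \<tau> > 1" using r(2) \<tau>(3) by (simp add: gr_one_powr)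
    ultimately have "T r > r powr \<tau>" by (auto simp: log_plus_def max_def split: if_splits)
    also have "T r \<le> 9 * T R + D" using D(2)[OF r(6)] r by simp
    also have "9 * T R \<le> 18 * (C * R powr \<sigma>)" using r(5) by simp
    also have "C * R powr \<sigma> \<le> \<bar>C\<bar> * (3 * r) powr \<sigma>"
      using r False by (intro mult_mono powr_mono2) auto
    also have "18 * (\<bar>C\<bar> * (3 * r) powr \<sigma>) + D = r powr \<tau> * (18 * \<bar>C\<bar> * 3 powr \<sigma> * r powr (\<sigma> - \<tau>) + D * r powr (- \<tau>))"
      using r(2) by (simp add: powr_mult powr_diff powr_minus field_simps)
    also have "\<dots> \<le> r powr \<tau> * 1" using r(7) by (intro mult_left_mono) auto
    finally show False by simp
  qed
qed

end

section \<open>Proximity of logarithmic derivatives and of shifted derivatives\<close>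

lemma sum_mult_exp_bound:
  assumes "finite S" "\<And>a. a \<in> S \<Longrightarrow> 0 \<le> x a"
  shows "1 + (\<Sum>a\<in>S. real (n a) * x a) \<le> exp (\<Sum>a\<in>S. real (n a) * ln (1 + x a))"
  using assms
proof (induction S rule: finite_induct)
  case (insert a S)
  define p where "p = (\<Sum>a\<in>S. real (n a) * x a)"
  have p: "p \<ge> 0" unfolding p_def using insert by (auto intro!: sum_nonneg)
  have xa: "x a \<ge> 0" using insert by auto
  have "1 + real (n a) * x a \<le> (1 + x a) ^ n a" using Bernoulli_inequality[of "x a" "n a"] xa by simp
  also have "\<dots> = exp (real (n a) * ln (1 + x a))" using xa by (simp add: exp_of_nat_mult)
  finally have 1: "1 + real (n a) * x a \<le> exp (real (n a) * ln (1 + x a))" .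
  have "1 + (real (n a) * x a + p) \<le> (1 + real (n a) * x a) * (1 + p)"
    using xa p by (simp add: algebra_simps)
  also have "\<dots> \<le> exp (real (n a) * ln (1 + x a)) * exp (\<Sum>a\<in>S. real (n a) * ln (1 + x a))"
    using 1 insert p by (intro mult_mono) (auto simp: p_def)
  finally show ?case using insert by (simp add: exp_add p_def)
qed simp

text \<open>By Bernoulli's inequality a sum of terms n(a) x(a) is at most the product of the (1 +
  x(a))^n(a), so the logarithm becomes a sum of the terms whose circle means are known. Estimating
  log (1 + K) by K is wasteful, but makes the bound the case D = 1 of \<open>ratio_bound\<close>,
  and one mean estimate then serves for derivatives and shifts.\<close>

lemma log_plus_logderiv_le:
  assumes g: "g meromorphic_on UNIV" "not_identically_zero g"
    and R: "s < R" and circ: "regular_circle R g"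
    and z: "norm z \<le> s" "g analytic_on {z}" "g z \<noteq> 0"
  shows "log_plus (norm (deriv g z / g z)) \<le> ratio_bound R s 1 g z"
proof (rule log_plus_le)
  define S where "S = divisor_set R g"
  define K where "K = schwarz_bound R s g"
  define n where "n = (\<lambda>a. nat \<bar>zorder g a\<bar>)"
  have n: "\<bar>real_of_int (zorder g a)\<bar> = real (n a)" for a by (simp add: n_def)
  have fin: "finite S" using finite_divisor_set[OF g] by (simp add: S_def)
  have s: "s \<ge> 0" using z(1) norm_ge_zero order_trans by blast
  have K: "K \<ge> 0" unfolding K_def using circ R s by (intro schwarz_bound_nonneg) auto
  define x where "x = (\<lambda>a. 1 / norm (z - a) + 1 / (R - s))"
  have x: "x a \<ge> 0" for a using R by (simp add: x_def)
  have ln_x: "ln (1 + x a) \<le> ln (1 + 1 / norm (z - a)) + 1 / (R - s)" for a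
  proof -
    have "0 \<le> 1 / norm (z - a) * (1 / (R - s))" using R by simp
    hence "1 + x a \<le> (1 + 1 / norm (z - a)) * (1 + 1 / (R - s))"
      by (simp only: x_def distrib_left distrib_right mult_1 mult_1_right)
    hence "ln (1 + x a) \<le> ln ((1 + 1 / norm (z - a)) * (1 + 1 / (R - s)))" using x[of a] by (intro ln_mono) auto
    also have "\<dots> = ln (1 + 1 / norm (z - a)) + ln (1 + 1 / (R - s))" using R by (intro ln_mult_pos) (auto intro: add_pos_nonneg)
    also have "ln (1 + 1 / (R - s)) \<le> 1 / (R - s)" using R by (intro ln_add_one_self_le_self) auto
    finally show ?thesis by simp
  qed
  have "norm (deriv g z / g z) \<le> K + (\<Sum>a\<in>S. real (n a) * x a)"
    using norm_logderiv_le[OF g R circ z] by (simp add: K_def S_def x_def n)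
  also have "\<dots> \<le> (1 + K) * (1 + (\<Sum>a\<in>S. real (n a) * x a))"
    using K x by (simp add: algebra_simps sum_nonneg)
  also have "\<dots> \<le> exp K * exp (\<Sum>a\<in>S. real (n a) * ln (1 + x a))"
    using x K by (intro mult_mono sum_mult_exp_bound fin exp_ge_add_one_self) (auto intro!: add_nonneg_nonneg sum_nonneg)
  also have "\<dots> = exp (K + (\<Sum>a\<in>S. real (n a) * ln (1 + x a)))" by (simp add: exp_add)
  also have "\<dots> \<le> exp (ratio_bound R s 1 g z)"
    using ln_x by (auto simp: ratio_bound_def K_def S_def n intro!: sum_mono mult_left_mono)
  finally show "norm (deriv g z / g z) \<le> exp (ratio_bound R s 1 g z)" .
  show "ratio_bound R s 1 g z \<ge> 0"
    using K R by (auto simp: ratio_bound_def K_def intro!: add_nonneg_nonneg sum_nonneg mult_nonneg_nonneg)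
qed

lemma ratio_bound_nonneg:
  assumes "regular_circle R g" "R > 0" "s < R" "D \<ge> 0"
  shows "ratio_bound R s D g z \<ge> 0"
  using assms schwarz_bound_nonneg[OF assms(1,2)]
  by (auto simp: ratio_bound_def intro!: add_nonneg_nonneg sum_nonneg mult_nonneg_nonneg)

lemma not_in_divisor_set:
  assumes "regular_circle r g" "norm z = r" "r > 0"
  shows "z \<notin> divisor_set R g"
  using assms by (auto simp: regular_circle_def divisor_set_def)

lemma continuous_ratio_bound:
  assumes "regular_circle r g" "r > 0" "D \<ge> 0"
  shows "continuous_on (sphere 0 r) (ratio_bound R s D g)"
proof -
  have ne: "norm (z - a) > 0" if "z \<in> sphere 0 r" "a \<in> divisor_set R g" for z a
    using not_in_divisor_set[OF assms(1) _ assms(2), of z R] that by auto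
  have "1 + D / norm (z - a) \<noteq> 0" if "z \<in> sphere 0 r" "a \<in> divisor_set R g" for z a
    using ne[OF that] assms(3) by (auto simp: add_nonneg_eq_0_iff)
  thus ?thesis unfolding ratio_bound_def
    by (intro continuous_intros) (use ne in \<open>force+\<close>)
qed

context finite_order_entire
begin

text \<open>
  \<open>R \<in> [4r, 6r]\<close> and \<open>R' \<in> [2R, 3R]\<close> are chosen outside the exceptional sets; the square root comes
  from the mean of \<open>log (1 + D / |z - a|)\<close> and pushes the order strictly below \<open>\<rho>\<close>.
\<close>
lemma circle_mean_ratio_bound:
  assumes g: "g meromorphic_on UNIV" "not_identically_zero g" "(\<lambda>r. characteristic r g) \<in> order_le"
    and D: "D \<ge> 0"
  obtains A where "eventually_outside (\<lambda>r. regular_circle r g \<and> r \<ge> 1 \<and> r \<ge> D \<and>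
     (\<exists>R. regular_circle R g \<and> 2 * r < R \<and> circle_mean r (ratio_bound R (2 * r) D g) \<le> A * r powr (\<rho> - 1 / 4)))"
proof -
  \<comment> \<open>Taking \<epsilon> = 1/4 spends half of the gain r^(1/2) and leaves the exponent
    \<rho> - 1/4.\<close>
  define \<tau> where "\<tau> = \<rho> + 1 / 4"
  have \<tau>0: "\<tau> \<ge> 0" using order_nonneg by (simp add: \<tau>_def)
  obtain B where B: "eventually_outside (\<lambda>r. characteristic r g \<le> B * r powr \<tau>)"
    using g(3) unfolding order_le_def \<tau>_def by (auto dest: spec[of _ "1 / 4 :: real"])
  obtain C where C: "C \<ge> 0" "\<And>r D a. r > 0 \<Longrightarrow> D \<ge> 0 \<Longrightarrow> norm a \<noteq> r \<Longrightarrow>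
        circle_mean r (\<lambda>z. ln (1 + D / norm (z - a))) \<le> C * sqrt (D / r)"
    using circle_mean_ln_dist_le by blast
  define c where "c = \<bar>ln (norm (zor_poly g 0 0))\<bar>"
  \<comment> \<open>18 = 3 * 6: the radii chosen below satisfy R \<le> 6 r and R' \<le> 3 R, and
    \<open>B1\<close> serves for both.\<close>
  define B1 where "B1 = 2 * (\<bar>B\<bar> * 18 powr \<tau>) + c"
  have B1: "B1 \<ge> 0" by (simp add: B1_def c_def)
  define P where "P = (\<lambda>R. regular_circle R g \<and> characteristic R g \<le> B * R powr \<tau>)"
  have "eventually_outside P" unfolding P_def
    by (intro eventually_outside_conj B eventually_regular_circle g)
  from eventually_ex_outside[OF this] obtain r0 where r0: "\<And>r. r \<ge> r0 \<Longrightarrow> \<exists>R\<in>{2 * r..3 * r}. P R"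
    by (auto simp: eventually_at_top_linorder)
  define A where "A = 4 * D * B1 + B1 / ln 2 * (C * sqrt D + D)"
  show ?thesis
  proof (rule that[of A], rule eventually_outside_mono)
    show "eventually_outside (\<lambda>r. regular_circle r g \<and> r \<ge> Max {1, D, r0})"
      by (intro eventually_outside_conj eventually_regular_circle g eventually_outsideI eventually_ge_at_top)
  next
    fix r assume r': "regular_circle r g \<and> r \<ge> Max {1, D, r0}"
    hence r: "regular_circle r g" "r \<ge> 1" "r \<ge> D" "r \<ge> r0" by auto
    obtain R where R: "4 * r \<le> R" "R \<le> 6 * r" "P R" using r0[of "2 * r"] r by auto
    obtain R' where R': "2 * R \<le> R'" "R' \<le> 3 * R" "P R'" using r0[of R] r R by auto
    have char: "2 * characteristic t g + c \<le> B1 * r powr \<tau>" if "P t" "1 \<le> t" "t \<le> 18 * r" for t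
    proof -
      have "characteristic t g \<le> B * t powr \<tau>" using that by (simp add: P_def)
      also have "\<dots> \<le> \<bar>B\<bar> * (18 * r) powr \<tau>" using that \<tau>0 by (intro mult_mono powr_mono2) auto
      also have "\<dots> = \<bar>B\<bar> * 18 powr \<tau> * r powr \<tau>" using r by (simp add: powr_mult)
      finally have "characteristic t g \<le> \<bar>B\<bar> * 18 powr \<tau> * r powr \<tau>" .
      moreover have "c * 1 \<le> c * r powr \<tau>" using r \<tau>0 by (intro mult_left_mono ge_one_powr_ge_zero) (auto simp: c_def)
      ultimately show ?thesis by (simp add: B1_def distrib_right)
    qed
    define M where "M = circle_mean R (\<lambda>z. \<bar>ln (norm (g z))\<bar>)"
    have "M \<le> 2 * characteristic R g + c" unfolding M_def c_def
      by (rule circle_mean_abs_ln_le) (use g R r in \<open>auto simp: P_def\<close>)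
    also have "\<dots> \<le> B1 * r powr \<tau>" by (rule char) (use R r in auto)
    finally have M: "M \<le> B1 * r powr \<tau>" .
    have K: "schwarz_bound R (2 * r) g \<le> 4 * B1 * (r powr \<tau> / r)"
    proof -
      have "(R / 2)\<^sup>2 \<le> (R - 2 * r)\<^sup>2" using R r by (intro power_mono) auto
      hence "2 * R / (R - 2 * r)\<^sup>2 \<le> 2 * R / (R / 2)\<^sup>2" using R r by (intro divide_left_mono) auto
      also have "\<dots> = 8 / R" using R r by (simp add: field_simps power2_eq_square)
      also have "\<dots> \<le> 4 / r" using R r by (simp add: field_simps)
      finally have "2 * R / (R - 2 * r)\<^sup>2 * M \<le> 4 / r * (B1 * r powr \<tau>)"
        using M B1 r R by (intro mult_mono') (auto simp: M_def schwarz_bound_def intro!: circle_mean_nonneg continuous_intros regular_circle_continuous, auto simp: P_def regular_circle_def)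
      thus ?thesis by (simp add: schwarz_bound_def M_def)
    qed
    define n where "n = (\<Sum>a\<in>divisor_set R g. \<bar>real_of_int (zorder g a)\<bar>)"
    have "n * ln 2 \<le> 2 * characteristic R' g + c" unfolding n_def c_def
      by (rule sum_zorder_le_characteristic) (use g R R' r in \<open>auto simp: P_def\<close>)
    also have "\<dots> \<le> B1 * r powr \<tau>" by (rule char) (use R R' r in auto)
    finally have n: "n \<le> B1 / ln 2 * r powr \<tau>" by (simp add: field_simps)
    have ne: "norm a \<noteq> r" if "a \<in> divisor_set R g" for a
      using not_in_divisor_set[OF r(1), of a R] that r by auto
    have ne': "1 + D / norm (z - a) \<noteq> 0 \<and> norm (z - a) \<noteq> 0" if "z \<in> sphere 0 r" "a \<in> divisor_set R g" for z a
      using ne[OF that(2)] that(1) D by (auto simp: add_nonneg_eq_0_iff)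
    have "circle_mean r (ratio_bound R (2 * r) D g) = D * schwarz_bound R (2 * r) g +
      (\<Sum>a\<in>divisor_set R g. \<bar>real_of_int (zorder g a)\<bar> * (circle_mean r (\<lambda>z. ln (1 + D / norm (z - a))) + D / (R - 2 * r)))"
    proof -
      have c1: "continuous_on (sphere 0 r) (\<lambda>z. ln (1 + D / norm (z - a)))" if "a \<in> divisor_set R g" for a
        by (intro continuous_intros) (use ne' that in auto)
      have "circle_mean r (ratio_bound R (2 * r) D g) = D * schwarz_bound R (2 * r) g +
        circle_mean r (\<lambda>z. \<Sum>a\<in>divisor_set R g. \<bar>real_of_int (zorder g a)\<bar> * (ln (1 + D / norm (z - a)) + D / (R - 2 * r)))"
        unfolding ratio_bound_def using r
        by (subst circle_mean_add) (auto intro!: continuous_intros c1)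
      also have "circle_mean r (\<lambda>z. \<Sum>a\<in>divisor_set R g. \<bar>real_of_int (zorder g a)\<bar> * (ln (1 + D / norm (z - a)) + D / (R - 2 * r))) =
        (\<Sum>a\<in>divisor_set R g. circle_mean r (\<lambda>z. \<bar>real_of_int (zorder g a)\<bar> * (ln (1 + D / norm (z - a)) + D / (R - 2 * r))))"
        using r finite_divisor_set[OF g(1,2)] by (intro circle_mean_sum continuous_intros c1) auto
      also have "\<dots> = (\<Sum>a\<in>divisor_set R g. \<bar>real_of_int (zorder g a)\<bar> * (circle_mean r (\<lambda>z. ln (1 + D / norm (z - a))) + D / (R - 2 * r)))"
        using r by (intro sum.cong refl) (simp add: circle_mean_cmult circle_mean_add c1)
      finally show ?thesis .
    qed
    also have "\<dots> \<le> D * (4 * B1 * (r powr \<tau> / r)) +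
      (\<Sum>a\<in>divisor_set R g. \<bar>real_of_int (zorder g a)\<bar> * (C * sqrt (D / r) + D / r))"
      using K D r R ne
      by (intro add_mono mult_left_mono sum_mono C(2) divide_left_mono) auto
    also have "\<dots> = D * (4 * B1 * (r powr \<tau> / r)) + n * (C * sqrt (D / r) + D / r)"
      by (simp add: n_def sum_distrib_right)
    \<comment> \<open>Terms decaying like 1/r are weakened to 1 / sqrt r, so that all carry the same
      power of r.\<close>
    also have "\<dots> \<le> D * (4 * B1 * (r powr \<tau> / sqrt r)) + (B1 / ln 2 * r powr \<tau>) * (C * sqrt (D / r) + D / sqrt r)"
    proof -
      have "sqrt r \<le> r" using r real_sqrt_le_mono[of r "r * r"] by simp
      thus ?thesis using r D B1 C(1) n
        by (intro add_mono mult_left_mono mult_mono divide_left_mono) (auto intro!: add_nonneg_nonneg)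
    qed
    also have "\<dots> = A * (r powr \<tau> / sqrt r)" by (simp add: A_def real_sqrt_divide add_divide_distrib algebra_simps)
    also have "r powr \<tau> / sqrt r = r powr (\<rho> - 1 / 4)"
      using r by (simp add: \<tau>_def powr_diff[symmetric] flip: powr_half_sqrt)
    finally have "circle_mean r (ratio_bound R (2 * r) D g) \<le> A * r powr (\<rho> - 1 / 4)" .
    moreover have "regular_circle R g" "2 * r < R" using R r by (auto simp: P_def)
    ultimately show "regular_circle r g \<and> r \<ge> 1 \<and> r \<ge> D \<and>
     (\<exists>R. regular_circle R g \<and> 2 * r < R \<and> circle_mean r (ratio_bound R (2 * r) D g) \<le> A * r powr (\<rho> - 1 / 4))"
      using r by blast
  qed
qed

lemma powr_negligible:
  assumes "\<sigma> < \<rho>" "eventually_outside (\<lambda>r. u r \<le> A * r powr \<sigma>)"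
  shows "u \<in> negligible"
proof -
  have "eventually_outside (\<lambda>r. u r \<le> \<eta> * T r + A * r powr \<sigma>)" if "\<eta> > 0" for \<eta>
    by (rule eventually_outside_mono[OF eventually_outside_conj[OF assms(2) eventually_outsideI[OF eventually_gt_at_top[of 0]]]])
       (use that T_nonneg in \<open>auto intro: add_increasing\<close>)
  thus ?thesis using assms(1) unfolding negligible_def by blast
qed

text \<open>No smallness of \<open>g\<close> is asked for: order at most \<rho> is enough, since the
  mean estimate pushes the exponent to \<rho> - 1/4. This is what makes it applicable to
  \<open>F\<close>.\<close>

lemma small_proximity_logderiv:
  assumes g: "ord.small_proximity g" "ord.small_count g" "not_identically_zero g"
  shows "neg.small_proximity (\<lambda>z. deriv g z / g z)"
proof -
  have mero: "g meromorphic_on UNIV" using g(1) by (simp add: ord.small_proximity_def)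
  have "(\<lambda>r. characteristic r g) \<in> order_le" unfolding characteristic_def
    using g by (intro ord.K_add) (auto simp: ord.small_proximity_def ord.small_count_def)
  then obtain A where A: "eventually_outside (\<lambda>r. regular_circle r g \<and> r \<ge> 1 \<and> r \<ge> 1 \<and>
     (\<exists>R. regular_circle R g \<and> 2 * r < R \<and> circle_mean r (ratio_bound R (2 * r) 1 g) \<le> A * r powr (\<rho> - 1 / 4)))"
    using circle_mean_ratio_bound[OF mero g(3), of 1] by auto
  have mero': "(\<lambda>z. deriv g z / g z) meromorphic_on UNIV" by (intro meromorphic_intros mero)
  have "eventually_outside (\<lambda>r. proximity r (\<lambda>z. deriv g z / g z) \<le> A * r powr (\<rho> - 1 / 4))"
  proof (rule eventually_outside_mono[OF eventually_outside_conj[OF A eventually_continuous_circle[OF mero']]])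
    fix r assume "(regular_circle r g \<and> r \<ge> 1 \<and> r \<ge> 1 \<and>
     (\<exists>R. regular_circle R g \<and> 2 * r < R \<and> circle_mean r (ratio_bound R (2 * r) 1 g) \<le> A * r powr (\<rho> - 1 / 4)))
      \<and> continuous_on (sphere 0 r) (\<lambda>z. deriv g z / g z)"
    then obtain R where r: "regular_circle r g" "r \<ge> 1" "continuous_on (sphere 0 r) (\<lambda>z. deriv g z / g z)"
      and R: "regular_circle R g" "2 * r < R" "circle_mean r (ratio_bound R (2 * r) 1 g) \<le> A * r powr (\<rho> - 1 / 4)" by auto
    have "proximity r (\<lambda>z. deriv g z / g z) \<le> circle_mean r (ratio_bound R (2 * r) 1 g)"
      unfolding proximity_eq_circle_mean
      by (intro circle_mean_mono continuous_intros r continuous_ratio_bound log_plus_logderiv_le mero g(3) R)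
         (use r in \<open>auto simp: regular_circle_def\<close>)
    thus "proximity r (\<lambda>z. deriv g z / g z) \<le> A * r powr (\<rho> - 1 / 4)" using R(3) by simp
  qed
  hence "(\<lambda>r. proximity r (\<lambda>z. deriv g z / g z)) \<in> negligible" by (rule powr_negligible[rotated]) simp
  thus ?thesis using mero' by (simp add: neg.small_proximity_def)
qed

lemma ord_small_proximity_f: "ord.small_proximity f"
proof -
  have "(\<lambda>r. proximity r f) \<in> order_le"
    by (rule ord.K_le[OF T_order_le], rule eventually_outsideI, rule eventually_mono[OF eventually_gt_at_top[of 0]])
       (simp add: T_eq)
  thus ?thesis using mero by (simp add: ord.small_proximity_def)
qed

lemma holo_shift_deriv: "(\<lambda>z. (deriv ^^ k) f (z + c)) holomorphic_on UNIV"
proof -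
  have "(deriv ^^ k) f holomorphic_on UNIV" by (intro holomorphic_higher_deriv holo) auto
  hence "((deriv ^^ k) f \<circ> (\<lambda>z. z + c)) holomorphic_on UNIV"
    by (rule holomorphic_on_compose_gen[rotated]) (auto intro: holomorphic_intros)
  thus ?thesis by (simp add: o_def)
qed

text \<open>Cauchy's inequality on the unit circle about z + c bounds the derivative by values f(w)
  with |w - z| \<le> |c| + 1, and these are compared with f(z) by \<open>ratio_bound\<close>. For r
  \<ge> |c| + 1 all such w lie in the disc of radius 2 r.\<close>

lemma small_proximity_shift_ratio:
  "neg.small_proximity (\<lambda>z. (deriv ^^ k) f (z + c) / f z)"
proof -
  define D where "D = norm c + 1"
  define q where "q = (\<lambda>z. (deriv ^^ k) f (z + c) / f z)"
  have D: "D \<ge> 0" by (simp add: D_def)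
  have "(\<lambda>r. characteristic r f) \<in> order_le" by (rule T_order_le)
  then obtain A where A: "eventually_outside (\<lambda>r. regular_circle r f \<and> r \<ge> 1 \<and> r \<ge> D \<and>
     (\<exists>R. regular_circle R f \<and> 2 * r < R \<and> circle_mean r (ratio_bound R (2 * r) D f) \<le> A * r powr (\<rho> - 1 / 4)))"
    using circle_mean_ratio_bound[OF mero nonzero _ D] by blast
  have "(\<lambda>z. (deriv ^^ k) f (z + c)) analytic_on UNIV" using holo_shift_deriv by (simp add: analytic_on_open)
  hence mero': "q meromorphic_on UNIV" unfolding q_def
    by (intro meromorphic_on_divide mero analytic_on_imp_meromorphic_on)
  \<comment> \<open>The constant from Cauchy's inequality is split off and added back through the
    class, because r^(\<rho> - 1/4) tends to 0 if \<rho> < 1/4.\<close>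
  define v where "v = (\<lambda>r. proximity r q - ln (fact k))"
  have "eventually_outside (\<lambda>r. v r \<le> A * r powr (\<rho> - 1 / 4))"
  proof (rule eventually_outside_mono[OF eventually_outside_conj[OF A eventually_continuous_circle[OF mero']]])
    fix r assume "(regular_circle r f \<and> r \<ge> 1 \<and> r \<ge> D \<and>
     (\<exists>R. regular_circle R f \<and> 2 * r < R \<and> circle_mean r (ratio_bound R (2 * r) D f) \<le> A * r powr (\<rho> - 1 / 4)))
      \<and> continuous_on (sphere 0 r) q"
    then obtain R where r: "regular_circle r f" "r \<ge> 1" "r \<ge> D" "continuous_on (sphere 0 r) q"
      and R: "regular_circle R f" "2 * r < R" "circle_mean r (ratio_bound R (2 * r) D f) \<le> A * r powr (\<rho> - 1 / 4)" by blast
    have pt: "log_plus (norm (q z)) \<le> ln (fact k) + ratio_bound R (2 * r) D f z" if z: "norm z = r" for z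
    proof (rule log_plus_le)
      have fz: "f z \<noteq> 0" using r(1) z by (auto simp: regular_circle_def)
      have "norm ((deriv ^^ k) f (z + c)) \<le> fact k * (norm (f z) * exp (ratio_bound R (2 * r) D f z)) / 1 ^ k"
      proof (rule Cauchy_inequality)
        fix w assume w: "norm ((z + c) - w) = 1"
        have "w - z = c - ((z + c) - w)" by simp
        hence wz: "norm (w - z) \<le> D" using w norm_triangle_ineq4[of c "(z + c) - w"] by (simp add: D_def)
        moreover have "norm w \<le> norm z + norm (w - z)" using norm_triangle_ineq[of z "w - z"] by simp
        ultimately have "norm w \<le> 2 * r" using r z by simp
        thus "norm (f w) \<le> norm (f z) * exp (ratio_bound R (2 * r) D f z)"
          by (intro norm_entire_le_ratio_bound holo nonzero R fz wz) (use r z in auto)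
      qed (use holo in \<open>auto intro: holomorphic_on_subset continuous\<close>)
      hence "norm (q z) \<le> fact k * exp (ratio_bound R (2 * r) D f z)"
        using fz by (simp add: q_def norm_divide divide_le_eq mult_ac)
      thus "norm (q z) \<le> exp (ln (fact k) + ratio_bound R (2 * r) D f z)" by (simp add: exp_add)
      show "ln (fact k) + ratio_bound R (2 * r) D f z \<ge> 0"
        using R r D by (intro add_nonneg_nonneg ratio_bound_nonneg) (auto simp: fact_ge_1)
    qed
    have "proximity r q \<le> circle_mean r (\<lambda>z. ln (fact k) + ratio_bound R (2 * r) D f z)"
      unfolding proximity_eq_circle_mean
      by (intro circle_mean_mono continuous_intros r continuous_ratio_bound pt D) (use r in auto)
    also have "\<dots> = ln (fact k) + circle_mean r (ratio_bound R (2 * r) D f)"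
      using r D by (subst circle_mean_add) (auto intro!: continuous_intros continuous_ratio_bound)
    finally show "v r \<le> A * r powr (\<rho> - 1 / 4)" using R(3) by (simp add: v_def)
  qed
  hence "v \<in> negligible" by (rule powr_negligible[rotated]) simp
  from neg.K_add[OF this neg.K_const[of "ln (fact k)"]] have "(\<lambda>r. proximity r q) \<in> negligible"
    by (simp add: v_def)
  thus ?thesis using mero' by (simp add: neg.small_proximity_def q_def)
qed

lemma ord_of_neg:
  "neg.small_proximity g \<Longrightarrow> ord.small_proximity g" "neg.small_count g \<Longrightarrow> ord.small_count g"
  using negligible_subset_order_le
  by (auto simp: neg.small_proximity_def ord.small_proximity_def neg.small_count_def ord.small_count_def)

lemma not_small_proximity_f: "\<not> neg.small_proximity f"
proof
  assume "neg.small_proximity f"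
  hence "(\<lambda>r. proximity r f) \<in> negligible" by (simp add: neg.small_proximity_def)
  hence "T \<in> negligible"
    by (rule neg.K_le, intro eventually_outsideI, intro eventually_mono[OF eventually_gt_at_top[of 0]])
       (simp add: T_eq)
  thus False using T_not_negligible by simp
qed

text \<open>With \<epsilon> half the gap, lam + \<epsilon> is an exponent below \<rho> as
  \<open>negligible\<close> demands. On large circles where \<open>a\<close> is continuous, m and N
  are nonnegative, so each inherits the bound on T(r, a).\<close>

lemma lambda_small_imp:
  assumes a: "lambda_small lam f a" and lam: "lam < \<rho>"
  shows "neg.small_proximity a" "neg.small_count a"
proof -
  have mero': "a meromorphic_on UNIV" using a by (simp add: lambda_small_def)
  define \<epsilon> where "\<epsilon> = (\<rho> - lam) / 2"
  have \<epsilon>: "\<epsilon> > 0" "lam + \<epsilon> < \<rho>" using lam by (auto simp: \<epsilon>_def field_simps)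
  obtain F g h where F: "finite_log_measure F"
    "g \<in> O[at_top_outside F](\<lambda>r. r powr (lam + \<epsilon>))" "S_error f h"
    "\<forall>\<^sub>F r in at_top_outside F. characteristic r a = g r + h r"
    using a \<epsilon> unfolding lambda_small_def by (metis order less_ereal.simps(1))
  obtain E where E: "finite_log_measure E" "h \<in> o[at_top_outside E](\<lambda>r. T r)"
    using F(3) by (auto simp: S_error_def)
  from landau_o.bigE[OF F(2)] obtain C where C: "\<forall>\<^sub>F r in at_top_outside F. norm (g r) \<le> C * norm (r powr (lam + \<epsilon>))"
    by blast
  have "eventually_outside (\<lambda>r. characteristic r a \<le> \<eta> * T r + C * r powr (lam + \<epsilon>))" if \<eta>: "\<eta> > 0" for \<eta>
  proof -
    have 1: "eventually_outside (\<lambda>r. norm (h r) \<le> \<eta> * norm (T r))"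
      by (rule eventually_outside_at_top_outside[OF E(1)]) (rule landau_o.smallD[OF E(2) \<eta>])
    have 2: "eventually_outside (\<lambda>r. norm (g r) \<le> C * norm (r powr (lam + \<epsilon>)))"
      by (rule eventually_outside_at_top_outside[OF F(1) C])
    have 3: "eventually_outside (\<lambda>r. characteristic r a = g r + h r)"
      by (rule eventually_outside_at_top_outside[OF F(1,4)])
    show ?thesis
      by (rule eventually_outside_mono[OF eventually_outside_conj[OF eventually_outside_conj[OF 1 2]
            eventually_outside_conj[OF 3 eventually_outsideI[OF eventually_gt_at_top[of 0]]]]])
         (use T_nonneg in auto)
  qed
  hence neg: "(\<lambda>r. characteristic r a) \<in> negligible" using \<epsilon>(2) unfolding negligible_def by blast
  have *: "eventually_outside (\<lambda>r. continuous_on (sphere 0 r) a \<and> r \<ge> 1)"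
    by (intro eventually_outside_conj eventually_continuous_circle mero' eventually_outsideI eventually_ge_at_top)
  have "(\<lambda>r. proximity r a) \<in> negligible"
    by (rule neg.K_le[OF neg], rule eventually_outside_mono[OF *])
       (auto simp: characteristic_def integrated_count_nonneg mero')
  moreover have "(\<lambda>r. integrated_count r a) \<in> negligible"
    by (rule neg.K_le[OF neg], rule eventually_outside_mono[OF *])
       (auto simp: characteristic_def proximity_nonneg)
  ultimately show "neg.small_proximity a" "neg.small_count a"
    using mero' by (auto simp: neg.small_proximity_def neg.small_count_def)
qed

end

subsection \<open>The delay-differential equation\<close>

lemma not_identically_zeroI:
  assumes "\<forall>\<^sub>\<approx>z\<in>UNIV. g z \<noteq> 0"
  shows "not_identically_zero g"
  unfolding not_identically_zero_def
proof
  assume "\<forall>\<^sub>\<approx>z\<in>UNIV. g z = 0"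
  with assms have "\<forall>\<^sub>\<approx>z\<in>(UNIV :: complex set). False" by eventually_elim auto
  hence "\<forall>\<^sub>F z in at (0 :: complex). False" by (simp add: eventually_cosparse_open_eq)
  thus False by simp
qed

lemma analytic_at_has_field_derivative:
  "g analytic_on {z} \<Longrightarrow> (g has_field_derivative deriv g z) (at z)"
  by (rule field_differentiable_derivI[OF analytic_on_imp_differentiable_at]) auto

context growth_class
begin

lemma small_proximity_power: "small_proximity g \<Longrightarrow> small_proximity (\<lambda>z. g z ^ n)"
  by (induction n) (auto intro: small_proximity_mult small_proximity_const)

end

context finite_order_entire
begin

text \<open>Write g' as g times g'/g; the zero function has no logarithmic derivative and is treated
  apart.\<close>

lemma small_proximity_deriv:
  assumes "neg.small_proximity g" "neg.small_count g"
  shows "neg.small_proximity (deriv g)"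
proof (cases "not_identically_zero g")
  case True
  have mero': "g meromorphic_on UNIV" using assms by (simp add: neg.small_proximity_def)
  have "neg.small_proximity (\<lambda>z. g z * (deriv g z / g z))"
    by (intro neg.small_proximity_mult assms small_proximity_logderiv ord_of_neg True)
  moreover have "\<forall>\<^sub>\<approx>z\<in>UNIV. deriv g z = g z * (deriv g z / g z)"
    using eventually_nonzero_cosparse[OF mero' True] by eventually_elim auto
  moreover have "deriv g meromorphic_on UNIV" by (intro meromorphic_intros mero')
  ultimately show ?thesis using neg.small_proximity_cong by blast
next
  case False
  have mero': "g meromorphic_on UNIV" using assms by (simp add: neg.small_proximity_def)
  have ev: "\<forall>\<^sub>\<approx>z\<in>UNIV. g z = 0" using False by (simp add: not_identically_zero_def)
  have "\<forall>\<^sub>\<approx>z\<in>UNIV. deriv g z = 0"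
    using ev
  proof eventually_elim
    case (elim z)
    have "\<forall>\<^sub>F w in at z. g w = 0" using ev by (simp add: eventually_cosparse_open_eq)
    hence "\<forall>\<^sub>F w in nhds z. g w = 0" using elim by (simp add: eventually_nhds_conv_at)
    hence "deriv g z = deriv (\<lambda>_. 0) z" by (intro deriv_cong_ev) auto
    thus ?case by simp
  qed
  thus ?thesis
    by (intro neg.small_proximity_cong[OF neg.small_proximity_const[of 0]]) (auto intro!: meromorphic_intros mero')
qed

lemma f_nonzero_cosparse: "\<forall>\<^sub>\<approx>z\<in>UNIV. f z \<noteq> 0"
  by (rule eventually_nonzero_cosparse[OF mero nonzero])

lemma small_proximity_inverse_contra:
  assumes "neg.small_proximity (\<lambda>z. 1 / f z)" "neg.small_count (\<lambda>z. 1 / f z)"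
  shows False
proof -
  have "\<forall>\<^sub>\<approx>z\<in>UNIV. 1 / f z \<noteq> 0" using f_nonzero_cosparse by eventually_elim simp
  hence "not_identically_zero (\<lambda>z. 1 / f z)" by (rule not_identically_zeroI)
  from neg.small_inverse(1)[OF assms this] have "neg.small_proximity f" by simp
  thus False using not_small_proximity_f by simp
qed

lemma has_derivative_shift:
  "((\<lambda>z. (deriv ^^ k) f (z + c)) has_field_derivative (deriv ^^ Suc k) f (z + c)) (at z)"
proof -
  have "(deriv ^^ k) f holomorphic_on UNIV" by (intro holomorphic_higher_deriv holo) auto
  hence "((deriv ^^ k) f has_field_derivative (deriv ^^ Suc k) f (z + c)) (at (z + c))"
    by (simp add: holomorphic_derivI)
  thus ?thesis by (simp add: DERIV_shift)
qed

end

section \<open>Clunie's argument for \<open>F\<close>\<close>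

locale delay_equation = finite_order_entire +
  fixes \<alpha> \<beta> :: "complex \<Rightarrow> complex" and b :: "nat \<Rightarrow> complex \<Rightarrow> complex"
    and c :: "nat \<Rightarrow> complex" and k :: "nat \<Rightarrow> nat" and m n :: nat
  assumes \<alpha>: "neg.small_proximity \<alpha>" "neg.small_count \<alpha>" "not_identically_zero \<alpha>"
    and \<beta>: "neg.small_proximity \<beta>" "neg.small_count \<beta>"
    and b: "\<And>j. j \<le> m \<Longrightarrow> neg.small_proximity (b j)" "\<And>j. j \<le> m \<Longrightarrow> neg.small_count (b j)"
    and n: "n \<ge> 3"
    and L_nonzero: "not_identically_zero (delay_diff_poly m b k c f)"
begin

definition L :: "complex \<Rightarrow> complex" where "L = delay_diff_poly m b k c f"

definition F :: "complex \<Rightarrow> complex" where "F = (\<lambda>z. L z - \<alpha> z * f z ^ n - \<beta> z)"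

lemma L_eq: "L z = (\<Sum>j\<le>m. b j z * (deriv ^^ k j) f (z + c j))"
  by (simp add: L_def delay_diff_poly_def)

lemma meros: "\<alpha> meromorphic_on UNIV" "\<beta> meromorphic_on UNIV" "j \<le> m \<Longrightarrow> b j meromorphic_on UNIV"
  using \<alpha> \<beta> b by (auto simp: neg.small_proximity_def)

lemma L_mero: "L meromorphic_on UNIV"
proof -
  have "(\<lambda>z. (deriv ^^ k) f (z + c)) meromorphic_on UNIV" for k c
    using holo_shift_deriv by (simp add: analytic_on_imp_meromorphic_on analytic_on_open)
  thus ?thesis unfolding L_eq[abs_def] by (intro meromorphic_intros meros) auto
qed

lemma F_mero: "F meromorphic_on UNIV"
  unfolding F_def by (intro meromorphic_intros L_mero meros mero)

lemma small_proximity_L_over_f: "neg.small_proximity (\<lambda>z. L z / f z)"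
proof -
  have "neg.small_proximity (\<lambda>z. \<Sum>j\<le>m. b j z * ((deriv ^^ k j) f (z + c j) / f z))"
    by (intro neg.small_proximity_sum neg.small_proximity_mult small_proximity_shift_ratio b) auto
  thus ?thesis by (simp add: L_eq sum_divide_distrib)
qed

lemma small_count_L: "neg.small_count L"
  unfolding L_eq[abs_def]
  by (intro neg.small_count_sum neg.small_count_mult neg.small_count_entire holo_shift_deriv b) auto

lemma small_count_F: "neg.small_count F"
  unfolding F_def
  by (intro neg.small_count_diff neg.small_count_mult small_count_L \<alpha> \<beta> neg.small_count_entire
      holomorphic_intros holo)

text \<open>L = (L / f) f has order at most \<rho>, hence so has \<open>F\<close>. This feeds both
  the estimate of F'/F and the upper bound for the zero exponent.\<close>

lemma ord_F: "ord.small_proximity F" "ord.small_count F"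
proof -
  have "ord.small_proximity (\<lambda>z. L z / f z * f z)"
    by (intro ord.small_proximity_mult ord_of_neg small_proximity_L_over_f ord_small_proximity_f)
  moreover have "\<forall>\<^sub>\<approx>z\<in>UNIV. L z = L z / f z * f z"
    using f_nonzero_cosparse by eventually_elim simp
  ultimately have "ord.small_proximity L" using ord.small_proximity_cong L_mero by blast
  moreover have "ord.small_proximity (\<lambda>z. \<alpha> z * f z ^ n)"
    by (intro ord.small_proximity_mult ord.small_proximity_power ord_small_proximity_f ord_of_neg(1)[OF \<alpha>(1)])
  ultimately show "ord.small_proximity F" unfolding F_def
    by (intro ord.small_proximity_diff ord_of_neg(1)[OF \<beta>(1)])
  show "ord.small_count F" using small_count_F by (rule ord_of_neg)
qed

text \<open>L' is again a combination of shifted derivatives of \<open>f\<close>, of orders k_j and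
  k_j + 1, with small coefficients b_j' and b_j.\<close>

lemma small_proximity_deriv_L_over_f: "neg.small_proximity (\<lambda>z. deriv L z / f z)"
proof -
  have "neg.small_proximity (\<lambda>z. \<Sum>j\<le>m. deriv (b j) z * ((deriv ^^ k j) f (z + c j) / f z) +
      b j z * ((deriv ^^ Suc (k j)) f (z + c j) / f z))"
    by (intro neg.small_proximity_sum neg.small_proximity_add neg.small_proximity_mult
        small_proximity_shift_ratio small_proximity_deriv b) auto
  moreover have "\<forall>\<^sub>\<approx>z\<in>UNIV. \<forall>j\<in>{..m}. b j analytic_on {z}"
    by (intro eventually_ball_finite ballI meromorphic_on_imp_analytic_cosparse meros) auto
  hence "\<forall>\<^sub>\<approx>z\<in>UNIV. deriv L z / f z = (\<Sum>j\<le>m. deriv (b j) z * ((deriv ^^ k j) f (z + c j) / f z) +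
      b j z * ((deriv ^^ Suc (k j)) f (z + c j) / f z))"
  proof eventually_elim
    case (elim z)
    have "(L has_field_derivative (\<Sum>j\<le>m. deriv (b j) z * (deriv ^^ k j) f (z + c j) +
        (deriv ^^ Suc (k j)) f (z + c j) * b j z)) (at z)"
      unfolding L_eq[abs_def]
      by (intro DERIV_sum DERIV_mult has_derivative_shift analytic_at_has_field_derivative) (use elim in auto)
    hence "deriv L z = (\<Sum>j\<le>m. deriv (b j) z * (deriv ^^ k j) f (z + c j) +
        (deriv ^^ Suc (k j)) f (z + c j) * b j z)" by (rule DERIV_imp_deriv)
    thus ?case by (simp add: sum_divide_distrib add_divide_distrib mult_ac)
  qed
  moreover have "(\<lambda>z. deriv L z / f z) meromorphic_on UNIV" by (intro meromorphic_intros L_mero mero)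
  ultimately show ?thesis using neg.small_proximity_cong by blast
qed

text \<open>Dividing by \<open>f\<close> gives f^(n - 1) = (L / f - \<beta> / f) / (s \<alpha>).
  Where |f| > 1 this bounds |f| by small terms, as |f| \<le> |f|^(n - 1) and |\<beta> / f| \<le>
  |\<beta>|; so m(r, f) would be small. The case s = 1 excludes F = 0, other values exclude F = C
  \<alpha> f^n with C \<noteq> -1.\<close>

lemma no_identity:
  assumes "s \<noteq> 0" "\<forall>\<^sub>\<approx>z\<in>UNIV. L z - \<beta> z = s * (\<alpha> z * f z ^ n)"
  shows False
proof -
  define \<gamma> where "\<gamma> = (\<lambda>z. 1 / s * (1 / \<alpha> z))"
  have \<gamma>: "neg.small_proximity \<gamma>" unfolding \<gamma>_def
    by (intro neg.small_proximity_mult neg.small_proximity_const neg.small_inverse \<alpha>)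
  \<comment> \<open>The constant 1 takes care of the points with |f| \<le> 1.\<close>
  define G where "G = (\<lambda>i::nat. if i = 0 then (\<lambda>z. 1) else if i = 1 then (\<lambda>z. L z / f z * \<gamma> z) else (\<lambda>z. \<beta> z * \<gamma> z))"
  have "\<forall>\<^sub>\<approx>z\<in>UNIV. norm (f z) \<le> (\<Sum>i\<in>{0,1,2}. norm (G i z))"
    using assms(2) f_nonzero_cosparse eventually_nonzero_cosparse[OF meros(1) \<alpha>(3)]
  proof eventually_elim
    case (elim z)
    have "norm (f z) \<le> 1 + norm (L z / f z) * norm (\<gamma> z) + norm (\<beta> z) * norm (\<gamma> z)"
    proof (cases "norm (f z) \<le> 1")
      case False
      have "f z * f z ^ (n - 1) = f z ^ n" using n by (simp flip: power_Suc)
      hence "f z ^ (n - 1) * f z = (L z - \<beta> z) * \<gamma> z" using elim assms(1) by (simp add: \<gamma>_def mult.commute)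
      hence "f z ^ (n - 1) = (L z / f z - \<beta> z / f z) * \<gamma> z" using elim(2) by (simp add: field_simps)
      hence "norm (f z) ^ (n - 1) = norm (L z / f z - \<beta> z / f z) * norm (\<gamma> z)" by (metis norm_mult norm_power)
      also have "\<dots> \<le> (norm (L z / f z) + norm (\<beta> z)) * norm (\<gamma> z)"
      proof (intro mult_right_mono)
        have "norm (\<beta> z / f z) \<le> norm (\<beta> z)" using False by (simp add: norm_divide divide_le_eq mult_le_cancel_left1)
        thus "norm (L z / f z - \<beta> z / f z) \<le> norm (L z / f z) + norm (\<beta> z)"
          using norm_triangle_ineq4[of "L z / f z" "\<beta> z / f z"] by linarith
      qed auto
      finally have "norm (f z) ^ (n - 1) \<le> (norm (L z / f z) + norm (\<beta> z)) * norm (\<gamma> z)" .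
      moreover have "norm (f z) \<le> norm (f z) ^ (n - 1)" using False n by (intro self_le_power) auto
      ultimately show ?thesis by (simp add: distrib_right)
    qed (auto intro: add_nonneg_nonneg order_trans)
    thus ?case by (simp add: G_def norm_mult norm_divide)
  qed
  moreover have "neg.small_proximity (\<lambda>z. L z / f z * \<gamma> z)" "neg.small_proximity (\<lambda>z. \<beta> z * \<gamma> z)"
    by (intro neg.small_proximity_mult small_proximity_L_over_f \<gamma> \<beta>)+
  hence "neg.small_proximity (G i)" for i
    using neg.small_proximity_const[of 1] by (simp add: G_def)
  ultimately have "neg.small_proximity f" by (intro neg.small_proximity_dominated[of f "{0,1,2}" G] mero) auto
  thus False using not_small_proximity_f by simp
qed

lemma F_nonzero: "not_identically_zero F"
  unfolding not_identically_zero_def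
proof
  assume "\<forall>\<^sub>\<approx>z\<in>UNIV. F z = 0"
  hence "\<forall>\<^sub>\<approx>z\<in>UNIV. L z - \<beta> z = 1 * (\<alpha> z * f z ^ n)"
    by eventually_elim (simp add: F_def algebra_simps)
  thus False by (rule no_identity[rotated]) simp
qed

lemma not_small_count_inverse_F:
  assumes "neg.small_count (\<lambda>z. 1 / F z)"
  shows False
proof -
  define \<psi> where "\<psi> = (\<lambda>z. deriv F z / F z)"
  have \<psi>: "neg.small_proximity \<psi>" "neg.small_count \<psi>" unfolding \<psi>_def
    using small_proximity_logderiv[OF ord_F F_nonzero] neg.small_count_logderiv[OF small_count_F assms F_nonzero] by auto
  define P where "P = (\<lambda>z. deriv \<alpha> z * f z + of_nat n * (\<alpha> z * deriv f z) - \<alpha> z * (\<psi> z * f z))"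
  \<comment> \<open>The right-hand side Q is split as A f + B: terms containing shifts of
    \<open>f\<close> are divided by \<open>f\<close>, which makes them small, and \<open>B\<close>
    collects the terms with \<beta>. \<open>W\<close> is P / f.\<close>
  define A where "A = (\<lambda>z. deriv L z / f z - \<psi> z * (L z / f z))"
  define B where "B = (\<lambda>z. \<psi> z * \<beta> z - deriv \<beta> z)"
  define W where "W = (\<lambda>z. deriv \<alpha> z + of_nat n * (\<alpha> z * (deriv f z / f z)) - \<alpha> z * \<psi> z)"
  have A: "neg.small_proximity A" unfolding A_def
    by (intro neg.small_proximity_diff neg.small_proximity_mult small_proximity_deriv_L_over_f small_proximity_L_over_f \<psi>)
  have B: "neg.small_proximity B" unfolding B_def
    by (intro neg.small_proximity_diff neg.small_proximity_mult \<psi> \<beta> small_proximity_deriv)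
  have "neg.small_proximity (\<lambda>z. deriv f z / f z)" using small_proximity_shift_ratio[of 1 0] by simp
  hence W: "neg.small_proximity W" unfolding W_def
    by (intro neg.small_proximity_diff neg.small_proximity_add neg.small_proximity_mult neg.small_proximity_const \<psi> \<alpha> small_proximity_deriv)
  have count_f: "neg.small_count f" using holo by (rule neg.small_count_entire)
  have P_count: "neg.small_count P" unfolding P_def
    by (intro neg.small_count_diff neg.small_count_add neg.small_count_mult neg.small_count_deriv count_f \<alpha> \<psi>
        neg.small_count_entire[of "\<lambda>_. of_nat n"]) auto
  have P_mero: "P meromorphic_on UNIV" using P_count by (simp add: neg.small_count_def)
  have good: "\<forall>\<^sub>\<approx>z\<in>UNIV. f z \<noteq> 0 \<and> \<alpha> z \<noteq> 0 \<and> F z \<noteq> 0 \<and> \<alpha> analytic_on {z} \<and> \<beta> analytic_on {z} \<and> L analytic_on {z}"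
    by (intro eventually_conj f_nonzero_cosparse eventually_nonzero_cosparse meros F_mero F_nonzero \<alpha>
        meromorphic_on_imp_analytic_cosparse L_mero)
  have dF: "(F has_field_derivative deriv L z - (deriv \<alpha> z * f z ^ n + of_nat n * f z ^ (n - 1) * deriv f z * \<alpha> z) - deriv \<beta> z) (at z)"
    if "\<alpha> analytic_on {z}" "\<beta> analytic_on {z}" "L analytic_on {z}" for z
  proof -
    note d = analytic_at_has_field_derivative
    have "((\<lambda>z. f z ^ n) has_field_derivative of_nat n * f z ^ (n - 1) * deriv f z) (at z)"
      using DERIV_power[OF d[OF analytic], of n] by (simp add: mult_ac)
    thus ?thesis unfolding F_def by (intro DERIV_diff DERIV_mult d that)
  qed
  have eq: "\<forall>\<^sub>\<approx>z\<in>UNIV. f z ^ (n - 1) * P z = A z * f z + B z \<and> P z = f z * W z"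
    using good
  proof eventually_elim
    case (elim z)
    have "deriv F z = deriv L z - (deriv \<alpha> z * f z ^ n + of_nat n * f z ^ (n - 1) * deriv f z * \<alpha> z) - deriv \<beta> z"
      by (rule DERIV_imp_deriv[OF dF]) (use elim in auto)
    moreover have "deriv F z = \<psi> z * (L z - \<alpha> z * f z ^ n - \<beta> z)" using elim by (simp add: \<psi>_def F_def[symmetric] F_def[THEN fun_cong, symmetric])
    moreover have "f z ^ n = f z ^ (n - 1) * f z" using n by (simp flip: power_Suc2)
    ultimately have "f z ^ (n - 1) * P z = deriv L z - deriv \<beta> z - \<psi> z * (L z - \<beta> z)"
      by (simp add: P_def algebra_simps)
    moreover have "A z * f z + B z = deriv L z - deriv \<beta> z - \<psi> z * (L z - \<beta> z)"
      using elim by (simp add: A_def B_def field_simps)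
    moreover have "P z = f z * W z" using elim by (simp add: P_def W_def field_simps)
    ultimately show ?case by simp
  qed
  define G where "G = (\<lambda>i::nat. if i = 0 then A else if i = 1 then B else W)"
  have G: "neg.small_proximity (G i)" for i using A B W by (auto simp: G_def)
  \<comment> \<open>One bound serves P and f P. Where |f| \<le> 1 both are at most |W|; elsewhere
    the identity is divided by \<open>f\<close> and |B / f| \<le> |B|.\<close>
  have dom: "\<forall>\<^sub>\<approx>z\<in>UNIV. norm (P z) \<le> (\<Sum>i\<in>{0,1,2}. norm (G i z)) \<and> norm (f z * P z) \<le> (\<Sum>i\<in>{0,1,2}. norm (G i z))"
    using eq
  proof eventually_elim
    case (elim z)
    have "norm (P z) \<le> norm (A z) + norm (B z) + norm (W z) \<and> norm (f z * P z) \<le> norm (A z) + norm (B z) + norm (W z)"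
    proof (cases "norm (f z) \<le> 1")
      case True
      have "norm (P z) = norm (f z) * norm (W z)" using elim by (simp add: norm_mult)
      also have "\<dots> \<le> 1 * norm (W z)" using True by (intro mult_right_mono) auto
      finally have 1: "norm (P z) \<le> norm (W z)" by simp
      have "norm (f z * P z) \<le> 1 * norm (P z)" unfolding norm_mult using True by (intro mult_right_mono) auto
      with 1 show ?thesis by (smt (verit) norm_ge_zero)
    next
      case False
      hence f1: "norm (f z) > 1" by simp
      \<comment> \<open>Here n \<ge> 3 enters: of the n - 1 factors \<open>f\<close>, one is
        cancelled against A f + B, one is kept with P, and the others have modulus above 1.\<close>
      have "n - 1 = Suc (Suc (n - 3))" using n by simp
      hence "f z ^ (n - 1) * P z = f z * (f z ^ (n - 3) * (f z * P z))" by (simp add: mult_ac)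
      hence "norm (f z) * (norm (f z) ^ (n - 3) * norm (f z * P z)) = norm (A z * f z + B z)"
        using elim by (metis norm_mult norm_power)
      also have "\<dots> \<le> norm (A z) * norm (f z) + norm (B z)" using norm_triangle_ineq[of "A z * f z" "B z"] by (simp add: norm_mult)
      also have "\<dots> \<le> norm (f z) * (norm (A z) + norm (B z))"
        using mult_right_mono[of 1 "norm (f z)" "norm (B z)"] f1 by (simp add: algebra_simps)
      finally have "norm (f z) ^ (n - 3) * norm (f z * P z) \<le> norm (A z) + norm (B z)"
        by (rule mult_left_le_imp_le) (use f1 in linarith)
      moreover have "1 * norm (f z * P z) \<le> norm (f z) ^ (n - 3) * norm (f z * P z)"
        using f1 by (intro mult_right_mono one_le_power) auto
      moreover have "norm (P z) \<le> norm (f z * P z)" unfolding norm_mult using f1 by (simp add: mult_le_cancel_right1)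
      ultimately show ?thesis by (smt (verit) norm_ge_zero)
    qed
    thus ?case by (simp add: G_def)
  qed
  have fP_mero: "(\<lambda>z. f z * P z) meromorphic_on UNIV" by (intro meromorphic_intros mero P_mero)
  have P: "neg.small_proximity P"
    by (rule neg.small_proximity_dominated[OF P_mero, of "{0,1,2}" G]) (use G dom in \<open>auto elim: eventually_mono\<close>)
  have fP: "neg.small_proximity (\<lambda>z. f z * P z)"
    by (rule neg.small_proximity_dominated[OF fP_mero, of "{0,1,2}" G]) (use G dom in \<open>auto elim: eventually_mono\<close>)
  show False
  proof (cases "not_identically_zero P")
    case True
    have "neg.small_proximity (\<lambda>z. (f z * P z) * (1 / P z))"
      by (intro neg.small_proximity_mult fP neg.small_inverse P P_count True)
    moreover have "\<forall>\<^sub>\<approx>z\<in>UNIV. f z = (f z * P z) * (1 / P z)"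
      using eventually_nonzero_cosparse[OF P_mero True] by eventually_elim simp
    ultimately have "neg.small_proximity f" using neg.small_proximity_cong mero by blast
    thus False using not_small_proximity_f by simp
  next
    case False
    hence P0: "\<forall>\<^sub>\<approx>z\<in>UNIV. P z = 0" by (simp add: not_identically_zero_def)
    \<comment> \<open>P = 0 says that \<alpha> f^n has the same logarithmic derivative \<psi> as
      \<open>F\<close>, so this quotient has derivative 0.\<close>
    define h where "h = (\<lambda>z. F z / (\<alpha> z * f z ^ n))"
    have h_mero: "h meromorphic_on UNIV" unfolding h_def by (intro meromorphic_intros F_mero meros mero)
    have dh: "\<forall>\<^sub>\<approx>z\<in>UNIV. (h has_field_derivative 0) (at z)"
      using good P0
    proof eventually_elim
      case (elim z)
      note d = analytic_at_has_field_derivative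
      have fn: "f z ^ n = f z ^ (n - 1) * f z" using n by (simp flip: power_Suc2)
      have "((\<lambda>z. f z ^ n) has_field_derivative of_nat n * f z ^ (n - 1) * deriv f z) (at z)"
        using DERIV_power[OF d[OF analytic], of n] by (simp add: mult_ac)
      hence d1: "((\<lambda>z. \<alpha> z * f z ^ n) has_field_derivative deriv \<alpha> z * f z ^ n + of_nat n * f z ^ (n - 1) * deriv f z * \<alpha> z) (at z)"
        by (intro DERIV_mult d) (use elim in auto)
      have "f z ^ (n - 1) * P z = 0" using elim by simp
      hence e1: "deriv \<alpha> z * f z ^ n + of_nat n * f z ^ (n - 1) * deriv f z * \<alpha> z = \<psi> z * (\<alpha> z * f z ^ n)"
        by (simp add: P_def fn algebra_simps)
      have "(F has_field_derivative deriv F z) (at z)"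
        unfolding DERIV_deriv_iff_field_differentiable using dF[of z] elim field_differentiable_def by blast
      hence d2: "(F has_field_derivative \<psi> z * F z) (at z)" using elim by (simp add: \<psi>_def)
      have "(h has_field_derivative (\<psi> z * F z * (\<alpha> z * f z ^ n) - F z * (\<psi> z * (\<alpha> z * f z ^ n))) / ((\<alpha> z * f z ^ n) * (\<alpha> z * f z ^ n))) (at z)"
        unfolding h_def by (rule DERIV_divide[OF d2 d1[unfolded e1]]) (use elim in auto)
      thus ?case by (simp add: mult_ac)
    qed
    \<comment> \<open>\<open>h\<close> is known to be constant only on a disc free of bad points; a
      meromorphic function on the plane that takes a value on a disc takes it off a sparse
      set.\<close>
    obtain C where C: "\<forall>\<^sub>\<approx>z\<in>UNIV. h z = C"
    proof -
      have ev: "\<forall>\<^sub>F z in at a. (h has_field_derivative 0) (at z)" for a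
        using dh by (simp add: eventually_cosparse_open_eq)
      obtain a where a: "(h has_field_derivative 0) (at a)"
        using eventually_happens[OF ev[of 0]] by auto
      have "\<forall>\<^sub>F z in nhds a. (h has_field_derivative 0) (at z)"
        using ev[of a] a by (simp add: eventually_nhds_conv_at)
      then obtain e where e: "e > 0" "\<And>z. z \<in> ball a e \<Longrightarrow> (h has_field_derivative 0) (at z)"
        by (auto simp: eventually_nhds_metric dist_commute)
      obtain C where hC: "\<And>z. z \<in> ball a e \<Longrightarrow> h z = C"
        using has_field_derivative_zero_constant[of "ball a e" h] e(2) has_field_derivative_at_within by blast
      have "\<forall>\<^sub>F z in at a. z \<in> ball a e" using e(1) by (intro eventually_at_in_open') auto
      hence hC': "\<forall>\<^sub>F z in at a. h z = C" by eventually_elim (rule hC)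
      have "\<not> (\<forall>\<^sub>\<approx>z\<in>UNIV. h z \<noteq> C)"
      proof
        assume "\<forall>\<^sub>\<approx>z\<in>UNIV. h z \<noteq> C"
        hence "\<forall>\<^sub>F z in at a. h z \<noteq> C" by (simp add: eventually_cosparse_open_eq)
        with hC' have "\<forall>\<^sub>F z in at a. False" by eventually_elim simp
        thus False by simp
      qed
      thus ?thesis using that meromorphic_imp_constant_or_avoid[OF h_mero open_UNIV connected_UNIV, of C] by blast
    qed
    have F_eq: "\<forall>\<^sub>\<approx>z\<in>UNIV. F z = C * (\<alpha> z * f z ^ n)"
      using C good by eventually_elim (auto simp: h_def divide_eq_eq)
    show False
    proof (cases "1 + C = 0")
      case False
      have "\<forall>\<^sub>\<approx>z\<in>UNIV. L z - \<beta> z = (1 + C) * (\<alpha> z * f z ^ n)"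
        using F_eq by eventually_elim (simp add: F_def algebra_simps)
      thus False by (rule no_identity[OF False])
    next
      case True
      hence "C = -1" by (simp add: add_eq_0_iff)
      hence F_eq': "\<forall>\<^sub>\<approx>z\<in>UNIV. F z = - (\<alpha> z * f z ^ n)" using F_eq by simp
      hence L\<beta>: "\<forall>\<^sub>\<approx>z\<in>UNIV. L z = \<beta> z" by eventually_elim (simp add: F_def)
      \<comment> \<open>Here L \<noteq> 0 enters: it allows division by \<beta> = L, which gives 1 /
        f = (L / f) (1 / \<beta>) a small proximity.\<close>
      have \<beta>_nz: "not_identically_zero \<beta>"
        unfolding not_identically_zero_def
      proof
        assume "\<forall>\<^sub>\<approx>z\<in>UNIV. \<beta> z = 0"
        with L\<beta> have "\<forall>\<^sub>\<approx>z\<in>UNIV. L z = 0" by eventually_elim simp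
        thus False using L_nonzero by (simp add: not_identically_zero_def L_def)
      qed
      have inv_mero: "(\<lambda>z. 1 / f z) meromorphic_on UNIV" by (intro meromorphic_intros mero)
      have "neg.small_proximity (\<lambda>z. L z / f z * (1 / \<beta> z))"
        by (intro neg.small_proximity_mult small_proximity_L_over_f neg.small_inverse \<beta> \<beta>_nz)
      moreover have "\<forall>\<^sub>\<approx>z\<in>UNIV. 1 / f z = L z / f z * (1 / \<beta> z)"
        using L\<beta> eventually_nonzero_cosparse[OF meros(2) \<beta>_nz] by eventually_elim simp
      ultimately have p: "neg.small_proximity (\<lambda>z. 1 / f z)" using neg.small_proximity_cong inv_mero by blast
      \<comment> \<open>Now F = - \<alpha> f^n, so every pole of 1 / f is accounted for by a pole of
        \<alpha> or of 1 / F.\<close>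
      have "neg.small_count (\<lambda>z. (- (f z ^ (n - 1))) * (\<alpha> z * (1 / F z)))"
        by (intro neg.small_count_mult assms \<alpha> neg.small_count_entire holomorphic_intros holo)
      moreover have "\<forall>\<^sub>\<approx>z\<in>UNIV. 1 / f z = (- (f z ^ (n - 1))) * (\<alpha> z * (1 / F z))"
        using F_eq' good
      proof eventually_elim
        case (elim z)
        have "f z ^ n = f z ^ (n - 1) * f z" using n by (simp flip: power_Suc2)
        thus ?case using elim by (simp add: field_simps)
      qed
      ultimately have "neg.small_count (\<lambda>z. 1 / f z)" using neg.small_count_cong inv_mero by blast
      with p show False by (rule small_proximity_inverse_contra)
    qed
  qed
qed

section \<open>The exponent of convergence of the zeros of \<open>F\<close>\<close>

lemma inverse_F_mero: "(\<lambda>z. 1 / F z) meromorphic_on UNIV"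
  by (intro meromorphic_intros F_mero)

text \<open>N(r, 1/F) is bounded only off an exceptional set, but the limsup runs over all r;
  monotonicity of N carries the bound over from a good R in [2 r, 3 r]. Half of \<epsilon> pays for
  the constant.\<close>

lemma zero_exponent_le: "zero_exponent F \<le> ereal \<rho>"
proof (rule ereal_le_epsilon2)
  fix \<epsilon> :: real assume \<epsilon>: "\<epsilon> > 0"
  define N where "N = (\<lambda>r. integrated_count r (\<lambda>z. 1 / F z))"
  define \<tau> where "\<tau> = \<rho> + \<epsilon> / 2"
  have \<tau>: "\<tau> \<ge> 0" using \<epsilon> order_nonneg by (simp add: \<tau>_def)
  have "ord.small_count (\<lambda>z. 1 / F z)" by (rule ord.small_inverse[OF ord_F F_nonzero])
  hence "N \<in> order_le" by (simp add: ord.small_count_def N_def)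
  then obtain C where C: "eventually_outside (\<lambda>r. N r \<le> C * r powr \<tau>)"
    using half_gt_zero[OF \<epsilon>] unfolding order_le_def \<tau>_def by blast
  have "((\<lambda>r. \<bar>C\<bar> * 3 powr \<tau> * r powr (- (\<epsilon> / 2))) \<longlongrightarrow> \<bar>C\<bar> * 3 powr \<tau> * 0) at_top"
    by (intro tendsto_intros tendsto_neg_powr filterlim_ident) (use \<epsilon> in auto)
  hence lim: "\<forall>\<^sub>F r in at_top. \<bar>C\<bar> * 3 powr \<tau> * r powr (- (\<epsilon> / 2)) < 1"
    by (intro order_tendstoD(2)) auto
  have "\<forall>\<^sub>F r in at_top. ereal (log_plus (N r) / ln r) \<le> ereal (\<rho> + \<epsilon>)"
    using eventually_ex_outside[OF C] lim eventually_gt_at_top[of 1]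
  proof eventually_elim
    case (elim r)
    then obtain R where R: "2 * r \<le> R" "R \<le> 3 * r" "N R \<le> C * R powr \<tau>" by auto
    have "N r \<le> N R" unfolding N_def using elim R by (intro integrated_count_mono inverse_F_mero) auto
    also have "N R \<le> C * R powr \<tau>" by (rule R)
    also have "\<dots> \<le> \<bar>C\<bar> * (3 * r) powr \<tau>" using R elim \<tau> by (intro mult_mono powr_mono2) auto
    also have "\<dots> = r powr (\<rho> + \<epsilon>) * (\<bar>C\<bar> * 3 powr \<tau> * r powr (- (\<epsilon> / 2)))"
      using elim by (simp add: powr_mult \<tau>_def add.commute flip: powr_add)
    also have "\<dots> \<le> r powr (\<rho> + \<epsilon>) * 1" using elim by (intro mult_left_mono) auto
    finally have "N r \<le> exp ((\<rho> + \<epsilon>) * ln r)" using elim by (simp add: powr_def)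
    hence "log_plus (N r) \<le> (\<rho> + \<epsilon>) * ln r" using elim \<epsilon> order_nonneg by (intro log_plus_le) auto
    thus ?case using elim by (simp add: divide_le_eq)
  qed
  thus "zero_exponent F \<le> ereal \<rho> + ereal \<epsilon>"
    unfolding zero_exponent_def N_def by (intro Limsup_bounded) simp
qed

text \<open>A smaller exponent would leave room for a \<sigma> < \<rho> with N(r, 1/F) =
  O(r^\<sigma>), which is negligible.\<close>

lemma zero_exponent_ge: "zero_exponent F \<ge> ereal \<rho>"
proof (rule ccontr)
  assume "\<not> ereal \<rho> \<le> zero_exponent F"
  then obtain \<sigma> where \<sigma>: "zero_exponent F < ereal \<sigma>" "\<sigma> < \<rho>"
    using ereal_dense2[of "zero_exponent F" "ereal \<rho>"] by (auto simp: not_le)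
  have "\<forall>\<^sub>F r in at_top. ereal (log_plus (integrated_count r (\<lambda>z. 1 / F z)) / ln r) < ereal \<sigma>"
    using \<sigma>(1) unfolding zero_exponent_def by (rule Limsup_lessD)
  hence "\<forall>\<^sub>F r in at_top. integrated_count r (\<lambda>z. 1 / F z) \<le> 1 * r powr \<sigma>"
    using eventually_gt_at_top[of 1]
  proof eventually_elim
    case (elim r)
    hence "log_plus (integrated_count r (\<lambda>z. 1 / F z)) \<le> \<sigma> * ln r" by (simp add: divide_less_eq)
    thus ?case using elim powr_le_of_log_plus by simp
  qed
  hence "(\<lambda>r. integrated_count r (\<lambda>z. 1 / F z)) \<in> negligible"
    by (intro powr_negligible[OF \<sigma>(2)] eventually_outsideI)
  hence "neg.small_count (\<lambda>z. 1 / F z)" using inverse_F_mero by (simp add: neg.small_count_def)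
  thus False by (rule not_small_count_inverse_F)
qed

end

text \<open>Nonvanishing belongs to the conclusion because the exponent of convergence is meaningful
  only for functions that are not identically zero.\<close>

theorem theorem1p1:
  fixes f \<alpha> \<beta> :: "complex \<Rightarrow> complex"
    and b :: "nat \<Rightarrow> complex \<Rightarrow> complex" and c :: "nat \<Rightarrow> complex" and k :: "nat \<Rightarrow> nat"
    and m n :: nat and \<rho> lam :: real
    and L \<Phi> :: "complex \<Rightarrow> complex"
  defines "L \<equiv> delay_diff_poly m b k c f"
    and "\<Phi> \<equiv> (\<lambda>z. L z - \<alpha> z * f z ^ n)"
  assumes "transcendental_entire f"
    and "growth_order f = ereal \<rho>"
    and "lam < \<rho>"
    and "lambda_small lam f \<alpha>" and "not_identically_zero \<alpha>"
    and "lambda_small lam f \<beta>"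
    and "\<And>j. j \<le> m \<Longrightarrow> lambda_small lam f (b j)"
    and "inj_on c {..m}"
    and "not_identically_zero L"
    and "n \<ge> 3"
  shows "not_identically_zero (\<lambda>z. \<Phi> z - \<beta> z)
    \<and> zero_exponent (\<lambda>z. \<Phi> z - \<beta> z) = growth_order f"
proof -
  interpret finite_order_entire f \<rho> by unfold_locales fact+
  note small = lambda_small_imp[OF _ \<open>lam < \<rho>\<close>]
  interpret eq: delay_equation f \<rho> \<alpha> \<beta> b c k m n
  proof
    show "neg.small_proximity (b j)" "neg.small_count (b j)" if "j \<le> m" for j
      using small \<open>\<And>j. j \<le> m \<Longrightarrow> lambda_small lam f (b j)\<close>[OF that] by auto
    show "not_identically_zero (delay_diff_poly m b k c f)"
      using \<open>not_identically_zero L\<close> by (simp add: L_def)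
  qed (fact small[OF \<open>lambda_small lam f \<alpha>\<close>] small[OF \<open>lambda_small lam f \<beta>\<close>]
      \<open>not_identically_zero \<alpha>\<close> \<open>n \<ge> 3\<close>)+
  have "(\<lambda>z. \<Phi> z - \<beta> z) = eq.F" by (simp add: eq.F_def \<Phi>_def L_def eq.L_def)
  thus ?thesis using eq.F_nonzero eq.zero_exponent_le eq.zero_exponent_ge order by auto
qed

end
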